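(* Fix an integer $p\ge 3$, let $\lambda=\lambda_p=2\cos(\pi/p)$, and let $k$ be an odd positive integer. Let $\mathcal{A}_1,\dots,\mathcal{A}_L$ be hyperbolic $G_p$-equivalence classes of $\lambda$-BQFs with $\mathcal{A}_\ell=-\mathcal{A}_\ell$, let $D_\ell$ be the discriminant of the forms in $\mathcal{A}_\ell$, and let $d_1,\dots,d_L$ be complex constants. Suppose the Dirichlet series $\phi(s)=\sum_{n=1}^\infty a_n n^{-s}$ converges absolutely in the half-plane $\operatorname{Re}(s)>\gamma$, and put $\Phi(s)=(2\pi/\lambda)^{-s}\Gamma(s)\phi(s)$. Suppose that (a) $\Phi(s)$ has a meromorphic continuation to the $s$-plane with, at worst, simple poles at integer points; (b) $\Phi(s)$ is bounded in every lacunary vertical strip $S(\sigma_1,\sigma_2;t_0)=\{\sigma+it:\sigma_1\le\sigma\le\sigma_2,\ |t|\ge t_0>0\}$; and (c) $\Phi(2k-s)+\Phi(s)=R(s)$, where $$R(s)=-\sum_{\ell=1}^{L} d_\ell D_\ell^{-k/2}\, i^{s}\sum_{\alpha\in\mathcal{Z}_{\mathcal{A}_\ell}}\Big\{\alpha^{s-k}B(2k-s,s-k)\,{}_2F_1\!\left[k,1-k;k-s+1;\tfrac{\alpha'}{\alpha'-\alpha}\right]+(\alpha')^{s-k}B(s,k-s)\,{}_2F_1\!\left[k,1-k;s-k+1;\tfrac{\alpha'}{\alpha'-\alpha}\right]\Big\}.$$ Then $\phi(s)$ is the Dirichlet series associated with an entire automorphic integral of weight $2k$ on $G_p$, namely $F(z)=\sum_{n=1}^\infty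 a_ne^{2\pi i n z/\lambda}$, with Hecke-symmetric rational period function $$q(z)=\sum_{\ell=1}^L d_\ell D_\ell^{-k/2}\sum_{\alpha\in\mathcal{Z}_{\mathcal{A}_\ell}}\frac{(\alpha-\alpha')^k}{(z-\alpha)^k(z-\alpha')^k}+c_0q_0(z),$$ for some constant $c_0$, where $q_0(z)=\nu(1-z^{-2k})$ if $2k\ne2$ and $q_0(z)=\nu(1-z^{-2})+\eta z^{-1}$ if $2k=2$, for some constants $\nu,\eta$.
   Context: $S=\begin{pmatrix}1&\lambda\\0&1\end{pmatrix}$, $T=\begin{pmatrix}0&-1\\1&0\end{pmatrix}$, and the Hecke group is $G_p=\langle S,T\rangle/\{\pm I\}\subseteq \mathrm{PSL}(2,\mathbb{R})$, acting by $Mz=\frac{az+b}{cz+d}$. An entire automorphic integral of weight $2k$ on $G_p$ with rational period function (RPF) $q$ is a function $F$ holomorphic on the upper half-plane with expansion $F(z)=\sum_{n\ge0}a_ne^{2\pi i n z/\lambda}$ such that $z^{-2k}F(-1/z)=F(z)+q(z)$, with $q$ rational; the Dirichlet series associated with $F$ is $\sum_{n\ge1}a_nn^{-s}$. An element of $G_p$ with trace $a+d$ is hyperbolic if $|a+d|>2$; it is primitive if it is not $N^n$ for some $N\in G_p$, $n\ge2$. A hyperbolic fixed point is a real number fixed by a hyperbolic element of $G_p$; its Hecke conjugate $\alpha'$ is the other point fixed by its (cyclic) stabilizer. A $\lambda$-BQF is $Q=[A,B,C]$, $Q(x,y)=Ax^2+Bxy+Cy^2$, with $A,B,C\in\mathbb{Z}[\lambda]$,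 discriminant $B^2-4AC$; $G_p$ acts by $(Q\circ M)(x,y)=Q(ax+by,cx+dy)$, giving $G_p$-equivalence classes. For a hyperbolic fixed point $\alpha$, let $M_\alpha=\begin{pmatrix}a&b\\c&d\end{pmatrix}$ (sign chosen so $a+d>0$) be the unique primitive hyperbolic element of $G_p$ with positive trace such that $\alpha=\frac{a-d+\sqrt{(a+d)^2-4}}{2c}$, and set $Q_\alpha=[c,d-a,-b]$. The forms $Q_\alpha$ are called hyperbolic; a class is hyperbolic if it consists of hyperbolic forms. For a hyperbolic form $Q=[A,B,C]$ of discriminant $D$ put $\alpha_Q=\frac{-B+\sqrt D}{2A}$; $Q$ is simple if $A>0>C$. For a class $\mathcal A$, $-\mathcal A=\{[-A,-B,-C]:[A,B,C]\in\mathcal A\}$ and $\mathcal{Z}_{\mathcal A}=\{\alpha_Q: Q\in\mathcal A\text{ simple}\}$. An RPF is Hecke-symmetric if its set of nonzero poles is invariant under $\alpha\mapsto\alpha'$. Powers $z^{a}=e^{a\log z}$ use the principal branch with $-\pi\le\arg z<\pi$. $B(a,b)=\Gamma(a)\Gamma(b)/\Gamma(a+b)$; ${}_2F_1$ is the Gauss hypergeometric function. *)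

theory Defs
  imports "HOL-Complex_Analysis.Complex_Analysis"
begin

definition hecke_lambda :: "nat \<Rightarrow> real" where
  "hecke_lambda p = 2 * cos (pi / real p)"

definition hecke_S :: "nat \<Rightarrow> real^2^2" where
  "hecke_S p = vector [vector [1, hecke_lambda p], vector [0, 1]]"

definition hecke_T :: "real^2^2" where
  "hecke_T = vector [vector [0, -1], vector [1, 0]]"

text \<open>
  The subgroup \<open>\<langle>S, T\<rangle>\<close> of \<open>SL(2,\<real>)\<close>. The Hecke group \<open>G\<^sub>p\<close> is its quotient by \<open>{\<plusminus>I}\<close>; an element
  of \<open>G\<^sub>p\<close> is represented below by either of its two matrices, so that equality in \<open>G\<^sub>p\<close> is equality
  of matrices up to sign.
\<close>

inductive_set hecke_group :: "nat \<Rightarrow> (real^2^2) set" for p :: nat where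
  one: "mat 1 \<in> hecke_group p"
| S: "hecke_S p \<in> hecke_group p"
| T: "hecke_T \<in> hecke_group p"
| mult: "M \<in> hecke_group p \<Longrightarrow> N \<in> hecke_group p \<Longrightarrow> M ** N \<in> hecke_group p"
| inverse: "M \<in> hecke_group p \<Longrightarrow> matrix_inv M \<in> hecke_group p"

definition psl_eq :: "real^2^2 \<Rightarrow> real^2^2 \<Rightarrow> bool" where
  "psl_eq M N \<longleftrightarrow> M = N \<or> M = - N"

definition matrix_power :: "real^2^2 \<Rightarrow> nat \<Rightarrow> real^2^2" where
  "matrix_power M n = (((**) M) ^^ n) (mat 1)"

definition hyperbolic :: "real^2^2 \<Rightarrow> bool" where
  "hyperbolic M \<longleftrightarrow> \<bar>trace M\<bar> > 2"

definition hecke_primitive :: "nat \<Rightarrow> real^2^2 \<Rightarrow> bool" where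
  "hecke_primitive p M \<longleftrightarrow>
     \<not> (\<exists>N\<in>hecke_group p. \<exists>n\<ge>2. psl_eq M (matrix_power N n))"

text \<open>
  The first conjunct says that the image of \<open>x\<close> is not \<open>\<infinity>\<close>.
\<close>

definition moebius_fixes :: "real^2^2 \<Rightarrow> real \<Rightarrow> bool" where
  "moebius_fixes M x \<longleftrightarrow>
     M$2$1 * x + M$2$2 \<noteq> 0 \<and> (M$1$1 * x + M$1$2) / (M$2$1 * x + M$2$2) = x"

definition hyperbolic_fixed_point :: "nat \<Rightarrow> real \<Rightarrow> bool" where
  "hyperbolic_fixed_point p \<alpha> \<longleftrightarrow> (\<exists>M\<in>hecke_group p. hyperbolic M \<and> moebius_fixes M \<alpha>)"

definition hecke_conj :: "nat \<Rightarrow> real \<Rightarrow> real" where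
  "hecke_conj p \<alpha> =
     (THE \<beta>. \<beta> \<noteq> \<alpha> \<and> (\<forall>M\<in>hecke_group p. moebius_fixes M \<alpha> \<longrightarrow> moebius_fixes M \<beta>))"

text \<open>
  \<open>is_M_alpha p \<alpha> M\<close> says that \<open>M\<close> is the matrix \<open>M\<^sub>\<alpha>\<close> of positive trace.
\<close>

definition is_M_alpha :: "nat \<Rightarrow> real \<Rightarrow> real^2^2 \<Rightarrow> bool" where
  "is_M_alpha p \<alpha> M \<longleftrightarrow>
     M \<in> hecke_group p \<and> hyperbolic M \<and> hecke_primitive p M \<and> trace M > 0 \<and>
     M$2$1 \<noteq> 0 \<and>
     \<alpha> = (M$1$1 - M$2$2 + sqrt ((M$1$1 + M$2$2)\<^sup>2 - 4)) / (2 * M$2$1)"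

type_synonym bqf = "real \<times> real \<times> real"

fun bqf_eval :: "bqf \<Rightarrow> real \<Rightarrow> real \<Rightarrow> real" where
  "bqf_eval (A, B, C) x y = A * x\<^sup>2 + B * x * y + C * y\<^sup>2"

fun bqf_disc :: "bqf \<Rightarrow> real" where
  "bqf_disc (A, B, C) = B\<^sup>2 - 4 * A * C"

fun bqf_neg :: "bqf \<Rightarrow> bqf" where
  "bqf_neg (A, B, C) = (- A, - B, - C)"

fun bqf_root :: "bqf \<Rightarrow> real" where
  "bqf_root (A, B, C) = (- B + sqrt (bqf_disc (A, B, C))) / (2 * A)"

fun bqf_simple :: "bqf \<Rightarrow> bool" where
  "bqf_simple (A, B, C) \<longleftrightarrow> A > 0 \<and> 0 > C"

definition Z_lambda :: "nat \<Rightarrow> real set" where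
  "Z_lambda p = range (\<lambda>P :: int poly. poly (map_poly of_int P) (hecke_lambda p))"

definition lambda_bqfs :: "nat \<Rightarrow> bqf set" where
  "lambda_bqfs p = Z_lambda p \<times> Z_lambda p \<times> Z_lambda p"

text \<open>
  \<open>bqf_equiv p Q Q'\<close> is \<open>Q' = Q \<circ> M\<close> for some \<open>M\<close>, as an identity of quadratic forms.
\<close>

definition bqf_equiv :: "nat \<Rightarrow> bqf \<Rightarrow> bqf \<Rightarrow> bool" where
  "bqf_equiv p Q Q' \<longleftrightarrow>
     (\<exists>M\<in>hecke_group p. \<forall>x y.
        bqf_eval Q' x y = bqf_eval Q (M$1$1 * x + M$1$2 * y) (M$2$1 * x + M$2$2 * y))"

definition bqf_classes :: "nat \<Rightarrow> bqf set set" where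
  "bqf_classes p = (\<lambda>Q. {Q' \<in> lambda_bqfs p. bqf_equiv p Q Q'}) ` lambda_bqfs p"

definition hyperbolic_bqf :: "nat \<Rightarrow> bqf \<Rightarrow> bool" where
  "hyperbolic_bqf p Q \<longleftrightarrow>
     (\<exists>\<alpha> M. hyperbolic_fixed_point p \<alpha> \<and> is_M_alpha p \<alpha> M \<and>
            Q = (M$2$1, M$2$2 - M$1$1, - M$1$2))"

definition hyperbolic_class :: "nat \<Rightarrow> bqf set \<Rightarrow> bool" where
  "hyperbolic_class p \<A> \<longleftrightarrow> \<A> \<in> bqf_classes p \<and> (\<forall>Q\<in>\<A>. hyperbolic_bqf p Q)"

definition simple_roots :: "bqf set \<Rightarrow> real set" where
  "simple_roots \<A> = bqf_root ` {Q \<in> \<A>. bqf_simple Q}"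

text \<open>
  Complex powers with \<open>-\<pi> \<le> arg z < \<pi>\<close>. The library's \<open>Ln\<close> has its imaginary part in \<open>(-\<pi>, \<pi>]\<close>,
  so it differs on the negative real axis.
\<close>

definition log_branch :: "complex \<Rightarrow> complex" where
  "log_branch z = (if Im z = 0 \<and> Re z < 0 then Ln z - 2 * of_real pi * \<i> else Ln z)"

definition pow_branch :: "complex \<Rightarrow> complex \<Rightarrow> complex" where
  "pow_branch z a = exp (a * log_branch z)"

definition hypergeo_2F1 :: "complex \<Rightarrow> complex \<Rightarrow> complex \<Rightarrow> complex \<Rightarrow> complex" where
  "hypergeo_2F1 a b c z = eval_fps (fps_hypergeo [a, b] [c] 1) z"

definition lacunary_strip :: "real \<Rightarrow> real \<Rightarrow> real \<Rightarrow> complex set" where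
  "lacunary_strip \<sigma>\<^sub>1 \<sigma>\<^sub>2 t\<^sub>0 = {s. \<sigma>\<^sub>1 \<le> Re s \<and> Re s \<le> \<sigma>\<^sub>2 \<and> \<bar>Im s\<bar> \<ge> t\<^sub>0}"

definition rational_fun :: "(complex \<Rightarrow> complex) \<Rightarrow> bool" where
  "rational_fun q \<longleftrightarrow>
     (\<exists>P Q :: complex poly. Q \<noteq> 0 \<and> (\<forall>z. poly Q z \<noteq> 0 \<longrightarrow> q z = poly P z / poly Q z))"

definition has_hecke_expansion :: "nat \<Rightarrow> (complex \<Rightarrow> complex) \<Rightarrow> (nat \<Rightarrow> complex) \<Rightarrow> bool" where
  "has_hecke_expansion p F a \<longleftrightarrow>
     (\<forall>z. Im z > 0 \<longrightarrow>
        (\<lambda>n. a n * exp (2 * of_real pi * \<i> * of_nat n * z / of_real (hecke_lambda p))) sums F z)"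

text \<open>
  \<open>F\<close> is an entire automorphic integral of weight \<open>2k\<close> on \<open>G\<^sub>p\<close> with rational period function \<open>q\<close>.
\<close>

definition entire_automorphic_integral ::
  "nat \<Rightarrow> nat \<Rightarrow> (complex \<Rightarrow> complex) \<Rightarrow> (complex \<Rightarrow> complex) \<Rightarrow> bool" where
  "entire_automorphic_integral p k F q \<longleftrightarrow>
     F holomorphic_on {z. Im z > 0} \<and>
     (\<exists>a. has_hecke_expansion p F a) \<and>
     rational_fun q \<and>
     (\<forall>z. Im z > 0 \<longrightarrow> z powi (- 2 * int k) * F (- 1 / z) = F z + q z)"

text \<open>
  \<open>\<Sum>n\<ge>1. a\<^sub>n n\<^sup>-\<^sup>s\<close> is the Dirichlet series associated with \<open>F\<close>; the value \<open>a 0\<close> plays no role.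
\<close>

definition associated_dirichlet_series :: "nat \<Rightarrow> (complex \<Rightarrow> complex) \<Rightarrow> (nat \<Rightarrow> complex) \<Rightarrow> bool" where
  "associated_dirichlet_series p F a \<longleftrightarrow>
     (\<exists>b. has_hecke_expansion p F b \<and> (\<forall>n\<ge>1. b n = a n))"

text \<open>
  The first conjunct makes the Hecke conjugate of every nonzero pole meaningful.
\<close>

definition hecke_symmetric :: "nat \<Rightarrow> (complex \<Rightarrow> complex) \<Rightarrow> bool" where
  "hecke_symmetric p q \<longleftrightarrow>
     (\<forall>z. z \<noteq> 0 \<and> is_pole q z \<longrightarrow> (\<exists>\<alpha>. hyperbolic_fixed_point p \<alpha> \<and> z = of_real \<alpha>)) \<and>
     hecke_conj p ` {\<alpha>. \<alpha> \<noteq> 0 \<and> is_pole q (of_real \<alpha>)} = {\<alpha>. \<alpha> \<noteq> 0 \<and> is_pole q (of_real \<alpha>)}"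

end

theory Submission
  imports Defs "HOL-Probability.Probability" "HOL-Real_Asymp.Real_Asymp" "HOL-Library.Landau_Symbols"
begin

text \<open>
  On the positive imaginary axis \<open>\<Phi>\<close> is the Mellin transform of \<open>F\<close>. Inserting the Gaussian factor
  \<open>exp (\<epsilon> (s - k)\<^sup>2)\<close> makes the inverse Mellin integrals absolutely convergent, so that mere boundedness
  in lacunary strips suffices to move the contour across the simple poles at the integers; letting
  \<open>\<epsilon>\<close> tend to \<open>0\<close> removes the factor. On the line \<open>Re s = 1/2\<close> the right-hand side of the functional
  equation is minus the Mellin transform of the sum of the kernels
  \<open>(\<alpha> - \<alpha>')\<^sup>k / ((z - \<alpha>)\<^sup>k (z - \<alpha>')\<^sup>k)\<close>, by partial fractions and a reflection formula for terminating
  hypergeometric series. Hence \<open>F|T - F\<close> is this sum plus a Laurent polynomial in \<open>z\<close>.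

  The Laurent polynomial is pinned down by the relations \<open>T\<^sup>2 = U\<^sup>p = 1\<close> of the Hecke group, \<open>U = S T\<close>:
  in \<open>\<Sum>j<p. q|U\<^sup>j = 0\<close> only the terms \<open>j = 0, 1\<close> can be singular at \<open>0\<close>, because hyperbolic fixed points
  are not cusps. That fact, and the uniqueness of the Hecke conjugate, follow from a discreteness
  statement: every nonzero entry of a matrix in the Hecke group has absolute value at least \<open>1\<close>.
\<close>

text \<open>The line Re s = 1/2 is dictated by the partial fractions: the pieces of first order, 1 /
  (\<alpha> - z) and 1 / (z - \<alpha>'), have Mellin integrals that converge only for 0 < Re s < 1.
  The Gaussian is centred at s = k so that it is invariant under s -> 2k - s and both terms of the
  functional equation receive the same factor. All integrals are written in v = ln y, where Mellin
  transforms become Fourier integrals on vertical lines. Oddness of k gives i^(-2k) = -1, which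
  reconciles the plus sign of the functional equation with F|T - F.

  The gap 1 in the discreteness statement comes from sin (j pi/p) >= sin (pi/p) for 0 < j < p,
  carried through reduced words with nonnegative entries.

  For the Laurent part, q + q|U is bounded as z tends to 0 on the imaginary axis while q + q|T = 0.
  In the difference, the translation by \<lambda> gains exactly one power of z, so exponents above 1
  - 2k other than 0 are excluded; the symmetry n -> -n - 2k of the T relation excludes those below
  -2k.\<close>

no_notation fps_nth (infixl "$" 75)

section \<open>Matrices in the Hecke group\<close>

definition mat2 :: "real \<Rightarrow> real \<Rightarrow> real \<Rightarrow> real \<Rightarrow> real^2^2" where
  "mat2 a b c d = vector [vector [a, b], vector [c, d]]"

lemma mat2_nth [simp]:
  "mat2 a b c d $ 1 $ 1 = a" "mat2 a b c d $ 1 $ 2 = b"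
  "mat2 a b c d $ 2 $ 1 = c" "mat2 a b c d $ 2 $ 2 = d"
  by (simp_all add: mat2_def)

lemma mat2_eq_iff:
  "M = N \<longleftrightarrow> M$1$1 = N$1$1 \<and> M$1$2 = N$1$2 \<and> M$2$1 = N$2$1 \<and> M$2$2 = N$2$2"
  for M N :: "real^2^2"
  by (auto simp: vec_eq_iff forall_2)

lemma matrix_mult_nth_2:
  "(M ** N) $ i $ j = M$i$1 * N$1$j + M$i$2 * N$2$j" for M N :: "real^2^2"
  by (simp add: matrix_matrix_mult_def sum_2)

lemma mat_1_nth_2:
  "(mat 1 :: real^2^2) $ 1 $ 1 = 1" "(mat 1 :: real^2^2) $ 1 $ 2 = 0"
  "(mat 1 :: real^2^2) $ 2 $ 1 = 0" "(mat 1 :: real^2^2) $ 2 $ 2 = 1"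
  by (simp_all add: mat_def)

lemma matrix_inv_left_right:
  fixes M :: "real^2^2"
  assumes "invertible M"
  shows "M ** matrix_inv M = mat 1" "matrix_inv M ** M = mat 1"
  using someI_ex[OF assms[unfolded invertible_def]] by (simp_all add: matrix_inv_def)

lemma matrix_inv_unique:
  fixes M N :: "real^2^2"
  assumes "M ** N = mat 1"
  shows "matrix_inv M = N"
proof -
  have NM: "N ** M = mat 1"
    using assms matrix_left_right_inverse by blast
  then have "invertible M"
    using assms invertible_def by blast
  then have "matrix_inv M = matrix_inv M ** (M ** N)"
    using assms by simp
  also have "\<dots> = N"
    using \<open>invertible M\<close> by (simp add: matrix_mul_assoc matrix_inv_left_right)
  finally show ?thesis .
qed

lemma matrix_inv_2:
  fixes M :: "real^2^2"
  assumes "det M = 1"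
  shows "matrix_inv M = mat2 (M$2$2) (- M$1$2) (- M$2$1) (M$1$1)"
  using assms
  by (intro matrix_inv_unique) (simp add: mat2_eq_iff matrix_mult_nth_2 mat_1_nth_2 det_2 mult.commute)

lemma hecke_T_eq: "hecke_T = mat2 0 (-1) 1 0"
  by (simp add: hecke_T_def mat2_def)

lemma hecke_S_eq: "hecke_S p = mat2 1 (hecke_lambda p) 0 1"
  by (simp add: hecke_S_def mat2_def)

lemma det_hecke_group: "M \<in> hecke_group p \<Longrightarrow> det M = 1"
proof (induction rule: hecke_group.induct)
  case (inverse M)
  then show ?case
    using matrix_inv_2[of M] by (simp add: det_2 mult.commute)
next
  case (mult M N)
  then show ?case
    by (simp add: det_mul)
qed (simp_all add: det_2 hecke_T_eq hecke_S_eq mat_1_nth_2)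

text \<open>The value at cos (pi/p) of the Chebyshev polynomial of the second kind of degree j - 1;
  the sequence 0, 1, \<lambda>, \<lambda>^2 - 1, ... supplies the entries of the powers of S T.
  Integer indices make room for j - 1 at j = 0 and for the reflection j -> p - j.\<close>

definition sin_ratio :: "nat \<Rightarrow> int \<Rightarrow> real" where
  "sin_ratio p j = sin (of_int j * pi / real p) / sin (pi / real p)"

context
  fixes p :: nat
  assumes p: "p \<ge> 3"
begin


lemma sin_pi_over_p_pos: "sin (pi / real p) > 0"
  using p by (intro sin_gt_zero) (auto simp: field_simps)

lemma sin_ratio_0 [simp]: "sin_ratio p 0 = 0"
  by (simp add: sin_ratio_def)

lemma sin_ratio_1 [simp]: "sin_ratio p 1 = 1"
  using sin_pi_over_p_pos by (simp add: sin_ratio_def)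

lemma sin_ratio_minus: "sin_ratio p (- j) = - sin_ratio p j"
  by (simp add: sin_ratio_def)

lemma sin_ratio_reflect: "sin_ratio p (int p - j) = sin_ratio p j"
proof -
  have "of_int (int p - j) * pi / real p = pi - of_int j * pi / real p"
    using p by (simp add: field_simps)
  then show ?thesis
    by (simp add: sin_ratio_def)
qed

lemma sin_ratio_p [simp]: "sin_ratio p (int p) = 0"
  using sin_ratio_reflect[of 0] by simp

lemma sin_ratio_p_minus_1 [simp]: "sin_ratio p (int p - 1) = 1"
  using sin_ratio_reflect[of 1] by simp

lemma sin_ratio_p_plus_1 [simp]: "sin_ratio p (int p + 1) = -1"
  using sin_ratio_reflect[of "-1"] by (simp add: sin_ratio_minus)

lemma sin_ratio_minus_1 [simp]: "sin_ratio p (-1) = -1"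
  using sin_ratio_minus[of 1] by simp

text \<open>The Chebyshev recurrence, from the addition formula for sin; it converts right
  multiplication by a generator into a shift of the index.\<close>

lemma sin_ratio_rec: "sin_ratio p (j + 1) = hecke_lambda p * sin_ratio p j - sin_ratio p (j - 1)"
proof -
  have "sin (of_int (j + 1) * pi / real p) + sin (of_int (j - 1) * pi / real p)
      = 2 * cos (pi / real p) * sin (of_int j * pi / real p)"
    by (simp add: ring_distribs add_divide_distrib diff_divide_distrib sin_add sin_diff)
  then show ?thesis
    using sin_pi_over_p_pos by (simp add: sin_ratio_def hecke_lambda_def field_simps)
qed

text \<open>By the reflection j -> p - j only 2j <= p has to be considered, where sin increases on
  [0, pi/2]. The number 1 obtained here is the constant of the discreteness statement.\<close>

lemma sin_ratio_ge_1:
  assumes "1 \<le> j" "j \<le> int p - 1"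
  shows "sin_ratio p j \<ge> 1"
proof -
  have *: "sin_ratio p i \<ge> 1" if "1 \<le> i" "2 * i \<le> int p" for i
  proof -
    have "sin (pi / real p) \<le> sin (of_int i * pi / real p)"
    proof (rule sin_monotone_2pi_le)
      show "pi / real p \<le> of_int i * pi / real p"
        using that p by (intro divide_right_mono) auto
      have "2 * real_of_int i \<le> real p"
        using that by linarith
      then have "(2 * real_of_int i) * pi \<le> real p * pi"
        by (intro mult_right_mono) auto
      then show "of_int i * pi / real p \<le> pi / 2"
        using p by (simp add: field_simps)
      show "- (pi / 2) \<le> pi / real p"
        using pi_gt_zero by (meson divide_nonneg_nonneg of_nat_0_le_iff order_trans neg_le_0_iff_le pi_ge_zero pi_half_ge_zero)
    qed
    then show ?thesis
      using sin_pi_over_p_pos by (simp add: sin_ratio_def)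
  qed
  show ?thesis
  proof (cases "2 * j \<le> int p")
    case False
    then show ?thesis
      using *[of "int p - j"] assms sin_ratio_reflect[of j] by simp
  qed (use * assms in auto)
qed

lemma hecke_lambda_pos: "hecke_lambda p > 0"
  using sin_ratio_rec[of 1] sin_ratio_ge_1[of 2] p by simp

text \<open>
  Up to sign, \<open>hecke_V j\<close> is \<open>U\<^sup>j T\<close> with \<open>U = S T\<close> of order \<open>p\<close>. Its entries are nonnegative, and each
  is \<open>0\<close> or at least \<open>1\<close>, for \<open>0 < j < p\<close>.
\<close>

definition hecke_V :: "int \<Rightarrow> real^2^2" where
  "hecke_V j = mat2 (sin_ratio p j) (sin_ratio p (j + 1)) (sin_ratio p (j - 1)) (sin_ratio p j)"

definition hecke_word :: "int list \<Rightarrow> real^2^2" where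
  "hecke_word js = foldl (\<lambda>M j. M ** hecke_V j) (mat 1) js"

lemma hecke_word_Nil [simp]: "hecke_word [] = mat 1"
  by (simp add: hecke_word_def)

lemma hecke_word_snoc [simp]: "hecke_word (js @ [j]) = hecke_word js ** hecke_V j"
  by (simp add: hecke_word_def)

text \<open>The first column shifts by itself, the second by the recurrence. A word that ends in
  \<open>hecke_T\<close> therefore absorbs a following \<open>hecke_S p\<close> into its last
  letter.\<close>

lemma hecke_V_T_S: "hecke_V j ** (hecke_T ** hecke_S p) = hecke_V (j + 1)"
  using sin_ratio_rec[of j] sin_ratio_rec[of "j + 1"]
  by (simp add: hecke_V_def hecke_T_eq hecke_S_eq mat2_eq_iff matrix_mult_nth_2)

lemma hecke_V_S_inv: "hecke_V j ** mat2 1 (- hecke_lambda p) 0 1 = hecke_V (j - 1) ** hecke_T"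
  using sin_ratio_rec[of j] sin_ratio_rec[of "j - 1"]
  by (simp add: hecke_V_def hecke_T_eq hecke_S_eq mat2_eq_iff matrix_mult_nth_2)

lemma hecke_V_p: "hecke_V (int p) = hecke_T"
  by (simp add: hecke_V_def hecke_T_eq)

lemma hecke_V_0: "hecke_V 0 = - hecke_T"
  by (simp add: hecke_V_def hecke_T_eq mat2_eq_iff)

lemma hecke_V_1: "hecke_V 1 = hecke_S p"
  using sin_ratio_rec[of 1] by (simp add: hecke_V_def hecke_S_eq mat2_eq_iff)

lemma T_S_inv: "hecke_T ** mat2 1 (- hecke_lambda p) 0 1 = hecke_V (int p - 1) ** hecke_T"
  using hecke_V_S_inv[of "int p"] by (simp add: hecke_V_p)

lemma T_T: "hecke_T ** hecke_T = - mat 1"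
  by (simp add: hecke_T_eq mat2_eq_iff matrix_mult_nth_2 mat_1_nth_2)

text \<open>Modulo sign the group is generated by T of order 2 and U = S T of order p. A reduced
  word alternates T with powers U^j, 0 < j < p; grouping each power with the T after it gives the
  letters \<open>hecke_V j\<close>, and E and F account for an extra T at either end.\<close>

definition normal_forms :: "(real^2^2) set" where
  "normal_forms = {M. \<exists>E\<in>{mat 1, hecke_T}. \<exists>F\<in>{mat 1, hecke_T}. \<exists>js. set js \<subseteq> {1..int p - 1} \<and>
     (M = E ** hecke_word js ** F \<or> M = - (E ** hecke_word js ** F))}"

lemma minus_mult_left_2: "(- M) ** N = - (M ** N)" for M N :: "real^2^2"
  by (simp add: mat2_eq_iff matrix_mult_nth_2)

lemma minus_mult_right_2: "M ** (- N) = - (M ** N)" for M N :: "real^2^2"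
  by (simp add: mat2_eq_iff matrix_mult_nth_2)

lemma normal_formsI:
  assumes "E \<in> {mat 1, hecke_T}" "F \<in> {mat 1, hecke_T}" "set js \<subseteq> {1..int p - 1}"
    "M = E ** hecke_word js ** F"
  shows "M \<in> normal_forms"
  using assms unfolding normal_forms_def by blast

lemma normal_forms_minus: "M \<in> normal_forms \<Longrightarrow> - M \<in> normal_forms"
  unfolding normal_forms_def by (auto; metis minus_minus)

lemma normal_forms_multI:
  assumes "M \<in> normal_forms"
    and "\<And>E F js. E \<in> {mat 1, hecke_T} \<Longrightarrow> F \<in> {mat 1, hecke_T} \<Longrightarrow>
           set js \<subseteq> {1..int p - 1} \<Longrightarrow> E ** hecke_word js ** F ** N \<in> normal_forms"
  shows "M ** N \<in> normal_forms"
proof -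
  from assms(1) obtain E F js where
    EF: "E \<in> {mat 1, hecke_T}" "F \<in> {mat 1, hecke_T}" "set js \<subseteq> {1..int p - 1}"
    and M: "M = E ** hecke_word js ** F \<or> M = - (E ** hecke_word js ** F)"
    unfolding normal_forms_def by blast
  from M assms(2)[OF EF] show ?thesis
    by (auto simp: minus_mult_left_2 intro: normal_forms_minus)
qed

lemma normal_forms_mult_T:
  assumes "M \<in> normal_forms"
  shows "M ** hecke_T \<in> normal_forms"
proof -
  have *: "E ** hecke_word js ** F ** hecke_T \<in> normal_forms"
    if E: "E \<in> {mat 1, hecke_T}" and F: "F \<in> {mat 1, hecke_T}" and js: "set js \<subseteq> {1..int p - 1}"
    for E F js
  proof (cases "F = mat 1")
    case True
    then show ?thesis
      using E js by (intro normal_formsI[of E hecke_T js]) auto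
  next
    case False
    then have "E ** hecke_word js ** F ** hecke_T = - (E ** hecke_word js ** mat 1)"
      using F by (simp flip: matrix_mul_assoc add: T_T minus_mult_right_2)
    then show ?thesis
      using E js normal_forms_minus normal_formsI[of E "mat 1" js] by auto
  qed
  show ?thesis
    by (rule normal_forms_multI[OF assms *])
qed

text \<open>Without a trailing T the letter \<open>hecke_V 1\<close> = S is appended. With a
  trailing T the last index rises by 1; if it reaches p, the letter becomes T and serves as the new
  trailing T. On an empty word, T S is kept with T as the leading factor, and T T S collapses to -
  S.\<close>

lemma normal_forms_mult_S:
  assumes "M \<in> normal_forms"
  shows "M ** hecke_S p \<in> normal_forms"
proof -
  have *: "E ** hecke_word js ** F ** hecke_S p \<in> normal_forms"
    if E: "E \<in> {mat 1, hecke_T}" and F: "F \<in> {mat 1, hecke_T}" and js: "set js \<subseteq> {1..int p - 1}"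
    for E F js
  proof (cases "F = mat 1")
    case True
    then show ?thesis
      using E js p by (intro normal_formsI[of E "mat 1" "js @ [1]"]) (auto simp: hecke_V_1 matrix_mul_assoc)
  next
    case F: False
    with that have FT: "F = hecke_T" by auto
    show ?thesis
    proof (cases js rule: rev_cases)
      case Nil
      show ?thesis
      proof (cases "E = mat 1")
        case True
        then show ?thesis
          using Nil p FT by (intro normal_formsI[of hecke_T "mat 1" "[1]"]) (auto simp: hecke_word_def hecke_V_1)
      next
        case False
        then have "E ** hecke_word js ** F ** hecke_S p = - (mat 1 ** hecke_word [1] ** mat 1)"
          using E Nil FT by (auto simp: hecke_word_def hecke_V_1 T_T minus_mult_left_2)
        moreover have "mat 1 ** hecke_word [1] ** mat 1 \<in> normal_forms"
          using p by (intro normal_formsI[of "mat 1" "mat 1" "[1]"]) auto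
        ultimately show ?thesis
          using normal_forms_minus by auto
      qed
    next
      case (snoc js' j)
      have eq: "E ** hecke_word js ** F ** hecke_S p = E ** (hecke_word js' ** hecke_V (j + 1))"
        by (simp add: snoc FT flip: matrix_mul_assoc hecke_V_T_S)
      show ?thesis
      proof (cases "j + 1 = int p")
        case True
        then show ?thesis
          unfolding eq using E js snoc
          by (intro normal_formsI[of E hecke_T js']) (auto simp: hecke_V_p matrix_mul_assoc)
      next
        case False
        then show ?thesis
          unfolding eq using E js snoc
          by (intro normal_formsI[of E "mat 1" "js' @ [j + 1]"]) auto
      qed
    qed
  qed
  show ?thesis
    by (rule normal_forms_multI[OF assms *])
qed

text \<open>Counterpart of the multiplication by S: after a trailing T a letter with index p - 1 is
  inserted, and otherwise the last index drops by 1 while a trailing T appears. At index 1 the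
  letter becomes \<open>hecke_V 0\<close> = - T, which cancels against that T.\<close>

lemma normal_forms_mult_S_inv:
  assumes "M \<in> normal_forms"
  shows "M ** mat2 1 (- hecke_lambda p) 0 1 \<in> normal_forms"
proof -
  let ?S' = "mat2 1 (- hecke_lambda p) 0 1"
  have *: "E ** hecke_word js ** F ** ?S' \<in> normal_forms"
    if E: "E \<in> {mat 1, hecke_T}" and F: "F \<in> {mat 1, hecke_T}" and js: "set js \<subseteq> {1..int p - 1}"
    for E F js
  proof (cases "F = mat 1")
    case False
    with F have FT: "F = hecke_T" by auto
    have "E ** hecke_word js ** F ** ?S' = E ** hecke_word (js @ [int p - 1]) ** hecke_T"
      by (simp add: FT T_S_inv flip: matrix_mul_assoc)
    then show ?thesis
      using E js p by (intro normal_formsI[of E hecke_T "js @ [int p - 1]"]) auto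
  next
    case F: True
    show ?thesis
    proof (cases js rule: rev_cases)
      case Nil
      show ?thesis
      proof (cases "E = mat 1")
        case False
        then have "E ** hecke_word js ** F ** ?S' = mat 1 ** hecke_word [int p - 1] ** hecke_T"
          using Nil F E by (auto simp: hecke_word_def T_S_inv)
        then show ?thesis
          using p by (intro normal_formsI[of "mat 1" hecke_T "[int p - 1]"]) auto
      next
        case True
        \<comment> \<open>The inverse of S alone has no T on its left; writing 1 as - T T creates
          one.\<close>
        have "hecke_T ** hecke_word [int p - 1] ** hecke_T = (hecke_T ** hecke_T) ** ?S'"
          by (simp add: hecke_word_def T_S_inv flip: matrix_mul_assoc)
        then have "E ** hecke_word js ** F ** ?S' = - (hecke_T ** hecke_word [int p - 1] ** hecke_T)"
          using Nil F True by (simp add: T_T minus_mult_left_2)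
        moreover have "hecke_T ** hecke_word [int p - 1] ** hecke_T \<in> normal_forms"
          using p by (intro normal_formsI[of hecke_T hecke_T "[int p - 1]"]) auto
        ultimately show ?thesis
          using normal_forms_minus by auto
      qed
    next
      case (snoc js' j)
      have eq: "E ** hecke_word js ** F ** ?S' = E ** (hecke_word js' ** hecke_V (j - 1)) ** hecke_T"
        by (simp add: snoc F hecke_V_S_inv flip: matrix_mul_assoc)
      show ?thesis
      proof (cases "j = 1")
        case True
        have "E ** hecke_word js ** F ** ?S' = E ** hecke_word js' ** mat 1"
          unfolding eq by (simp add: True hecke_V_0 T_T minus_mult_right_2 minus_mult_left_2 flip: matrix_mul_assoc)
        then show ?thesis
          using E js snoc by (intro normal_formsI[of E "mat 1" js']) auto
      next
        case False
        then show ?thesis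
          unfolding eq using E js snoc
          by (intro normal_formsI[of E hecke_T "js' @ [j - 1]"]) auto
      qed
    qed
  qed
  show ?thesis
    by (rule normal_forms_multI[OF assms *])
qed

text \<open>Stability under right multiplication is enough, since \<open>mat 1\<close> is a normal
  form. The induction carries N and its inverse together because the rule \<open>inverse\<close> of
  \<open>hecke_group\<close> applies to every element, not to generators alone.\<close>

lemma hecke_group_subset_normal_forms: "hecke_group p \<subseteq> normal_forms"
proof
  fix N assume "N \<in> hecke_group p"
  then have "\<forall>M\<in>normal_forms. M ** N \<in> normal_forms \<and> M ** matrix_inv N \<in> normal_forms"
  proof (induction rule: hecke_group.induct)
    case one
    have "matrix_inv (mat 1 :: real^2^2) = mat 1"
      by (intro matrix_inv_unique) simp
    then show ?case
      by simp
  next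
    case S
    have "matrix_inv (hecke_S p) = mat2 1 (- hecke_lambda p) 0 1"
      by (subst matrix_inv_2) (auto simp: hecke_S_eq det_2)
    then show ?case
      using normal_forms_mult_S normal_forms_mult_S_inv by auto
  next
    case T
    have "matrix_inv hecke_T = - hecke_T"
      by (intro matrix_inv_unique) (simp add: minus_mult_right_2 T_T)
    then show ?case
      using normal_forms_mult_T normal_forms_minus by (auto simp: minus_mult_right_2)
  next
    case (mult M N)
    have inv: "invertible M" "invertible N"
      using mult det_hecke_group by (auto simp: invertible_det_nz)
    have "(M ** N) ** (matrix_inv N ** matrix_inv M) = M ** (N ** matrix_inv N) ** matrix_inv M"
      by (simp add: matrix_mul_assoc)
    also have "\<dots> = mat 1"
      using inv by (simp add: matrix_inv_left_right)
    finally have "matrix_inv (M ** N) = matrix_inv N ** matrix_inv M"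
      by (rule matrix_inv_unique)
    then show ?case
      using mult.IH by (simp add: matrix_mul_assoc)
  next
    case (inverse M)
    have inv: "invertible M"
      using inverse det_hecke_group by (auto simp: invertible_det_nz)
    then have "matrix_inv (matrix_inv M) = M"
      by (intro matrix_inv_unique) (simp add: matrix_inv_left_right)
    then show ?case
      using inverse.IH by simp
  qed
  moreover have "mat 1 \<in> normal_forms"
    by (rule normal_formsI[of "mat 1" "mat 1" "[]"]) auto
  ultimately show "N \<in> normal_forms"
    by fastforce
qed

text \<open>Closed under sums and products, so it passes to products of matrices with entries in it.
  Allowing both signs would destroy closure under sums, which is why the letters are chosen
  nonnegative.\<close>

definition unit_gap :: "real set" where
  "unit_gap = {x. x = 0 \<or> x \<ge> 1}"

lemma hecke_word_gap:
  assumes "set js \<subseteq> {1..int p - 1}"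
  shows "hecke_word js $ i $ j \<in> unit_gap"
  using assms
proof (induction js arbitrary: i j rule: rev_induct)
  case Nil
  then show ?case
    by (auto simp: mat_def unit_gap_def)
next
  case (snoc x js)
  have mult: "a * b \<in> unit_gap" if "a \<in> unit_gap" "b \<in> unit_gap" for a b
    using that mult_mono[of 1 a 1 b] by (auto simp: unit_gap_def)
  have add: "a + b \<in> unit_gap" if "a \<in> unit_gap" "b \<in> unit_gap" for a b
    using that by (auto simp: unit_gap_def)
  have sr: "sin_ratio p y \<in> unit_gap" if "0 \<le> y" "y \<le> int p" for y
    using that sin_ratio_ge_1[of y] by (cases "y = 0 \<or> y = int p") (auto simp: unit_gap_def)
  have "\<forall>i j. hecke_V x $ i $ j \<in> unit_gap"
    using snoc.prems sr[of x] sr[of "x + 1"] sr[of "x - 1"] by (simp add: forall_2 hecke_V_def)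
  then show ?case
    using snoc by (auto simp: matrix_mult_nth_2 intro!: add mult)
qed

text \<open>E and F only permute rows or columns and change signs, so the gap of the words survives
  in absolute value. This is discreteness in quantitative form.\<close>

lemma hecke_group_entry_gap:
  assumes "M \<in> hecke_group p"
  shows "M $ i $ j = 0 \<or> \<bar>M $ i $ j\<bar> \<ge> 1"
proof -
  from assms hecke_group_subset_normal_forms obtain E F js where
    EF: "E \<in> {mat 1, hecke_T}" "F \<in> {mat 1, hecke_T}" and js: "set js \<subseteq> {1..int p - 1}"
    and M: "M = E ** hecke_word js ** F \<or> M = - (E ** hecke_word js ** F)"
    unfolding normal_forms_def by blast
  have "\<forall>i j. (E ** hecke_word js ** F) $ i $ j = 0 \<or> \<bar>(E ** hecke_word js ** F) $ i $ j\<bar> \<ge> 1"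
    using EF hecke_word_gap[OF js, of 1 1] hecke_word_gap[OF js, of 1 2] hecke_word_gap[OF js, of 2 1] hecke_word_gap[OF js, of 2 2]
    by (auto simp: forall_2 matrix_mult_nth_2 mat_1_nth_2 hecke_T_eq unit_gap_def)
  then have "(E ** hecke_word js ** F) $ i $ j = 0 \<or> \<bar>(E ** hecke_word js ** F) $ i $ j\<bar> \<ge> 1"
    by blast
  then show ?thesis
    using M by auto
qed

text \<open>If the entry were 0, the diagonal entries would have product 1 and absolute value at
  least 1, hence be 1 or -1, and the trace would be at most 2 in absolute value. So \<infinity> is
  not fixed by a hyperbolic element.\<close>

lemma hyperbolic_lower_left_nonzero:
  assumes "M \<in> hecke_group p" "hyperbolic M"
  shows "M $ 2 $ 1 \<noteq> 0"
proof
  assume c: "M $ 2 $ 1 = 0"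
  have "M$1$1 * M$2$2 = 1"
    using det_hecke_group[OF assms(1)] c by (simp add: det_2)
  then have prod: "\<bar>M$1$1\<bar> * \<bar>M$2$2\<bar> = 1"
    by (simp flip: abs_mult)
  then have "M$1$1 \<noteq> 0" "M$2$2 \<noteq> 0"
    by auto
  then have ge: "\<bar>M$1$1\<bar> \<ge> 1" "\<bar>M$2$2\<bar> \<ge> 1"
    using hecke_group_entry_gap[OF assms(1), of 1 1] hecke_group_entry_gap[OF assms(1), of 2 2]
    by simp_all
  then have "\<bar>M$1$1\<bar> \<le> 1" "\<bar>M$2$2\<bar> \<le> 1"
    using prod mult_left_mono[OF ge(2), of "\<bar>M$1$1\<bar>"] mult_right_mono[OF ge(1), of "\<bar>M$2$2\<bar>"]
    by simp_all
  then have "\<bar>trace M\<bar> \<le> 2"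
    by (simp add: trace_def sum_2)
  then show False
    using assms(2) by (simp add: hyperbolic_def)
qed

section \<open>Hyperbolic fixed points, their stabilizers and Hecke conjugates\<close>

lemma moebius_fixes_iff:
  assumes "det M = 1"
  shows "moebius_fixes M x \<longleftrightarrow> M$2$1 * x\<^sup>2 + (M$2$2 - M$1$1) * x - M$1$2 = 0"
proof -
  have "M$2$1 * x + M$2$2 \<noteq> 0" if "M$2$1 * x\<^sup>2 + (M$2$2 - M$1$1) * x - M$1$2 = 0"
  proof
    assume *: "M$2$1 * x + M$2$2 = 0"
    then have d: "M$2$2 = - M$2$1 * x"
      by simp
    then have "M$1$2 = - M$1$1 * x"
      using that by (simp add: algebra_simps power2_eq_square)
    with d have "det M = 0"
      by (simp add: det_2)
    with assms show False
      by simp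
  qed
  then show ?thesis
    by (auto simp: moebius_fixes_def field_simps power2_eq_square)
qed

text \<open>The quotient is the image of \<infinity> under N. If a hyperbolic M fixed it,
  conjugation by N would give a hyperbolic element of the group that fixes \<infinity>, that is, one
  with lower left entry 0.\<close>

lemma hyperbolic_fixed_point_not_cusp:
  assumes "hyperbolic_fixed_point p \<alpha>" "N \<in> hecke_group p" "N $ 2 $ 1 \<noteq> 0"
  shows "\<alpha> \<noteq> N $ 1 $ 1 / N $ 2 $ 1"
proof
  assume \<alpha>: "\<alpha> = N $ 1 $ 1 / N $ 2 $ 1"
  from assms obtain M where M: "M \<in> hecke_group p" "hyperbolic M" "moebius_fixes M \<alpha>"
    by (auto simp: hyperbolic_fixed_point_def)
  define X where "X = matrix_inv N ** M ** N"
  have X: "X \<in> hecke_group p"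
    using assms M by (auto simp: X_def intro: hecke_group.intros)
  have detN: "det N = 1"
    using assms det_hecke_group by blast
  have invN: "matrix_inv N = mat2 (N$2$2) (- N$1$2) (- N$2$1) (N$1$1)"
    by (rule matrix_inv_2[OF detN])
  have "trace X = M$1$1 * det N + M$2$2 * det N"
    by (simp add: trace_def sum_2 X_def invN matrix_mult_nth_2 det_2 algebra_simps)
  then have "trace X = trace M"
    using detN by (simp add: trace_def sum_2)
  then have "hyperbolic X"
    using M by (simp add: hyperbolic_def)
  have "X $ 2 $ 1 = - (N$2$1)\<^sup>2 * (M$2$1 * - (N$1$1 / N$2$1)\<^sup>2 + (M$1$1 - M$2$2) * (N$1$1 / N$2$1) + M$1$2)"
    using assms(3) by (simp add: X_def invN matrix_mult_nth_2 field_simps power2_eq_square)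
  also have "M$2$1 * - (N$1$1 / N$2$1)\<^sup>2 + (M$1$1 - M$2$2) * (N$1$1 / N$2$1) + M$1$2 = 0"
    using M(3) det_hecke_group[OF M(1)] by (simp add: moebius_fixes_iff \<alpha> algebra_simps)
  finally show False
    using hyperbolic_lower_left_nonzero[OF X \<open>hyperbolic X\<close>] by simp
qed

text \<open>The matrix of determinant 1 that fixes \<alpha>, with lower left entry c and factor of
  automorphy j = c \<alpha> + d. The pairs (j, c) are coordinates on the stabilizer of \<alpha> in
  SL(2); j = 1 gives its unipotent elements.\<close>

definition fixing_matrix :: "real \<Rightarrow> real \<Rightarrow> real \<Rightarrow> real^2^2" where
  "fixing_matrix \<alpha> j c = mat2 (1 / j + c * \<alpha>) (\<alpha> * j - \<alpha> / j - c * \<alpha>\<^sup>2) c (j - c * \<alpha>)"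

lemma fixing_matrix_mult:
  assumes "j \<noteq> 0" "j' \<noteq> 0"
  shows "fixing_matrix \<alpha> j c ** fixing_matrix \<alpha> j' c' = fixing_matrix \<alpha> (j * j') (c / j' + j * c')"
  using assms
  by (simp add: fixing_matrix_def mat2_eq_iff matrix_mult_nth_2) (simp add: field_simps power2_eq_square)

text \<open>The scaling by j^2 is what moves a unipotent element towards the identity when
  conjugation by a hyperbolic element, or by its inverse, is iterated.\<close>

lemma fixing_matrix_conj:
  assumes "j \<noteq> 0"
  shows "fixing_matrix \<alpha> j c ** fixing_matrix \<alpha> 1 x ** fixing_matrix \<alpha> (1 / j) (- c) = fixing_matrix \<alpha> 1 (j\<^sup>2 * x)"
proof -
  have "(c + j * x) * j - j * c = j\<^sup>2 * x"
    by (simp add: algebra_simps power2_eq_square)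
  then show ?thesis
    using assms by (simp add: fixing_matrix_mult)
qed

lemma fixing_matrix_1_0: "fixing_matrix \<alpha> 1 0 = mat 1"
  by (simp add: fixing_matrix_def mat2_eq_iff mat_1_nth_2)

lemma matrix_inv_fixing_matrix:
  assumes "j \<noteq> 0"
  shows "matrix_inv (fixing_matrix \<alpha> j c) = fixing_matrix \<alpha> (1 / j) (- c)"
  using assms by (intro matrix_inv_unique) (simp add: fixing_matrix_mult fixing_matrix_1_0)

lemma moebius_fixes_imp_fixing_matrix:
  assumes "det M = 1" "moebius_fixes M \<alpha>"
  obtains j where "j \<noteq> 0" "M = fixing_matrix \<alpha> j (M$2$1)"
proof
  define j where "j = M$2$1 * \<alpha> + M$2$2"
  show j: "j \<noteq> 0"
    using assms by (simp add: j_def moebius_fixes_def)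
  have fix_eq: "M$2$1 * \<alpha>\<^sup>2 + (M$2$2 - M$1$1) * \<alpha> - M$1$2 = 0"
    using assms moebius_fixes_iff by blast
  have "(M$1$1 - M$2$1 * \<alpha>) * j = det M - M$2$1 * (M$2$1 * \<alpha>\<^sup>2 + (M$2$2 - M$1$1) * \<alpha> - M$1$2)"
    by (simp add: j_def det_2 algebra_simps power2_eq_square)
  then have a: "M$1$1 = 1 / j + M$2$1 * \<alpha>"
    using assms j by (simp add: fix_eq) (simp add: field_simps)
  show "M = fixing_matrix \<alpha> j (M$2$1)"
    using fix_eq by (simp add: mat2_eq_iff fixing_matrix_def a) (simp add: j_def algebra_simps power2_eq_square)
qed

text \<open>
  The stabiliser of \<open>\<alpha>\<close> is a group of affine maps; a hyperbolic element together with an element moving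
  the second fixed point would produce arbitrarily small parabolic elements.
\<close>

lemma hecke_stabilizer_fixes_other:
  assumes M: "M \<in> hecke_group p" "hyperbolic M" "moebius_fixes M \<alpha>" "moebius_fixes M \<beta>" "\<beta> \<noteq> \<alpha>"
    and N: "N \<in> hecke_group p" "moebius_fixes N \<alpha>"
  shows "moebius_fixes N \<beta>"
proof -
  obtain \<mu> where \<mu>: "\<mu> \<noteq> 0" and M_eq: "M = fixing_matrix \<alpha> \<mu> (M$2$1)"
    using moebius_fixes_imp_fixing_matrix[OF det_hecke_group[OF M(1)] M(3)] by blast
  obtain j where j: "j \<noteq> 0" and N_eq: "N = fixing_matrix \<alpha> j (N$2$1)"
    using moebius_fixes_imp_fixing_matrix[OF det_hecke_group[OF N(1)] N(2)] by blast
  define m c where "m = M$2$1" and "c = N$2$1"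
  have M_eq: "M = fixing_matrix \<alpha> \<mu> m" and N_eq: "N = fixing_matrix \<alpha> j c"
    using M_eq N_eq by (simp_all add: m_def c_def)
  have m0: "m \<noteq> 0"
    using hyperbolic_lower_left_nonzero[OF M(1,2)] by (simp add: m_def)
  have fixes_iff: "moebius_fixes (fixing_matrix \<alpha> i e) \<beta> \<longleftrightarrow> e * (\<beta> - \<alpha>) = 1 / i - i"
    if "i \<noteq> 0" "fixing_matrix \<alpha> i e \<in> hecke_group p" for i e
  proof -
    \<comment> \<open>\<alpha> is a root of the fixed point equation; dividing it out leaves a
      linear condition on the second root.\<close>
    have "e * \<beta>\<^sup>2 + (i - e * \<alpha> - (1 / i + e * \<alpha>)) * \<beta> - (\<alpha> * i - \<alpha> / i - e * \<alpha>\<^sup>2)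
        = (\<beta> - \<alpha>) * (e * (\<beta> - \<alpha>) - (1 / i - i))"
      using that by (simp add: field_simps power2_eq_square)
    then show ?thesis
      using that det_hecke_group M(5) by (subst moebius_fixes_iff) (auto simp: fixing_matrix_def)
  qed
  have M\<beta>: "m * (\<beta> - \<alpha>) = 1 / \<mu> - \<mu>"
    using fixes_iff[of \<mu> m] \<mu> M M_eq by auto
  then have \<mu>_sq: "\<mu>\<^sup>2 \<noteq> 1"
    using m0 M(5) \<mu> by (auto simp: power2_eq_square field_simps)
  \<comment> \<open>The factors of automorphy cancel in the commutator of M and N, so it is
    unipotent; w is its parameter, and w = 0 will imply that N fixes \<beta>.\<close>
  define w where "w = j * c * (\<mu>\<^sup>2 - 1) + \<mu> * m * (1 - j\<^sup>2)"
  have invM: "matrix_inv M = fixing_matrix \<alpha> (1 / \<mu>) (- m)" and invN: "matrix_inv N = fixing_matrix \<alpha> (1 / j) (- c)"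
    using \<mu> j by (simp_all add: M_eq N_eq matrix_inv_fixing_matrix)
  have K: "fixing_matrix \<alpha> 1 w \<in> hecke_group p"
  proof -
    have "(M ** N) ** (matrix_inv M ** matrix_inv N) \<in> hecke_group p"
      using M N by (intro hecke_group.intros)
    also have "(M ** N) ** (matrix_inv M ** matrix_inv N) = fixing_matrix \<alpha> 1 w"
    proof -
      have "(m / j + \<mu> * c) / (1 / \<mu> * (1 / j)) + \<mu> * j * (- m / (1 / j) + 1 / \<mu> * - c) = w"
        using \<mu> j by (simp add: w_def field_simps power2_eq_square)
      then show ?thesis
        using \<mu> j unfolding invM invN unfolding M_eq N_eq by (simp add: fixing_matrix_mult)
    qed
    finally show ?thesis .
  qed
  have up: "fixing_matrix \<alpha> 1 (\<mu>\<^sup>2 ^ n * w) \<in> hecke_group p" for n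
  proof (induction n)
    case (Suc n)
    have "M ** fixing_matrix \<alpha> 1 (\<mu>\<^sup>2 ^ n * w) ** matrix_inv M \<in> hecke_group p"
      using M Suc by (intro hecke_group.intros)
    also have "M ** fixing_matrix \<alpha> 1 (\<mu>\<^sup>2 ^ n * w) ** matrix_inv M = fixing_matrix \<alpha> 1 (\<mu>\<^sup>2 * (\<mu>\<^sup>2 ^ n * w))"
      unfolding invM unfolding M_eq by (rule fixing_matrix_conj[OF \<mu>])
    also have "\<mu>\<^sup>2 * (\<mu>\<^sup>2 ^ n * w) = \<mu>\<^sup>2 ^ Suc n * w"
      by (simp only: power_Suc mult.assoc)
    finally show ?case .
  qed (use K in simp)
  have down: "fixing_matrix \<alpha> 1 ((1 / \<mu>\<^sup>2) ^ n * w) \<in> hecke_group p" for n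
  proof (induction n)
    case (Suc n)
    have "matrix_inv M ** fixing_matrix \<alpha> 1 ((1 / \<mu>\<^sup>2) ^ n * w) ** M \<in> hecke_group p"
      using M Suc by (intro hecke_group.intros)
    also have "matrix_inv M ** fixing_matrix \<alpha> 1 ((1 / \<mu>\<^sup>2) ^ n * w) ** M
        = fixing_matrix \<alpha> 1 ((1 / \<mu>)\<^sup>2 * ((1 / \<mu>\<^sup>2) ^ n * w))"
      unfolding invM unfolding M_eq using fixing_matrix_conj[of "1 / \<mu>" \<alpha> "- m"] \<mu> by simp
    also have "(1 / \<mu>)\<^sup>2 * ((1 / \<mu>\<^sup>2) ^ n * w) = (1 / \<mu>\<^sup>2) ^ Suc n * w"
      by (simp only: power_Suc mult.assoc power_one_over)
    finally show ?case .
  qed (use K in simp)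
  \<comment> \<open>Since \<mu>^2 is not 1, conjugation by M or by its inverse contracts the
    parameter.\<close>
  obtain \<rho> where \<rho>: "0 < \<rho>" "\<rho> < 1" and in_group: "\<And>n. fixing_matrix \<alpha> 1 (\<rho> ^ n * w) \<in> hecke_group p"
  proof (cases "\<mu>\<^sup>2 < 1")
    case True
    then show ?thesis
      using that[of "\<mu>\<^sup>2"] up \<mu> by simp
  next
    case False
    then have "\<mu>\<^sup>2 > 1"
      using \<mu>_sq by linarith
    then show ?thesis
      using that[of "1 / \<mu>\<^sup>2"] down \<mu> by simp
  qed
  \<comment> \<open>The lower left entries of these group elements are \<rho>^n w; a nonzero one of
    absolute value below 1 violates the entry gap.\<close>
  have "w = 0"
  proof (rule ccontr)
    assume "w \<noteq> 0"
    have "(\<lambda>n. \<rho> ^ n * \<bar>w\<bar>) \<longlonglongrightarrow> 0 * \<bar>w\<bar>"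
      using \<rho> by (intro tendsto_intros LIMSEQ_realpow_zero) auto
    then have "eventually (\<lambda>n. \<rho> ^ n * \<bar>w\<bar> < 1) sequentially"
      by (intro order_tendstoD(2)[of _ 0]) auto
    then obtain n where n: "\<rho> ^ n * \<bar>w\<bar> < 1"
      using eventually_happens by force
    have "\<rho> ^ n * w = 0 \<or> \<bar>\<rho> ^ n * w\<bar> \<ge> 1"
      using hecke_group_entry_gap[OF in_group[of n], of 2 1] by (simp add: fixing_matrix_def)
    then show False
      using n \<open>w \<noteq> 0\<close> \<rho> by (auto simp: abs_mult)
  qed
  then have "j * c * (\<mu>\<^sup>2 - 1) = \<mu> * m * (j\<^sup>2 - 1)"
    by (simp add: w_def algebra_simps)
  moreover have "\<mu>\<^sup>2 - 1 = - \<mu> * (m * (\<beta> - \<alpha>))"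
    unfolding M\<beta> using \<mu> by (simp add: field_simps power2_eq_square)
  ultimately have "\<mu> * m * (j * (c * (\<beta> - \<alpha>)) + j\<^sup>2 - 1) = 0"
    by (simp add: algebra_simps)
  then have "j * (c * (\<beta> - \<alpha>)) + j\<^sup>2 - 1 = 0"
    using \<mu> m0 by simp
  then have "c * (\<beta> - \<alpha>) = 1 / j - j"
    using j by (simp add: field_simps power2_eq_square)
  then show ?thesis
    using fixes_iff[of j c] N j by (simp add: N_eq)
qed

text \<open>Existence in the definite description is the stabilizer lemma; uniqueness holds because
  the fixed point equation of M is quadratic with nonzero leading coefficient and so has no third
  root.\<close>

lemma hecke_conj_eq:
  assumes M: "M \<in> hecke_group p" "hyperbolic M" "moebius_fixes M \<alpha>" "moebius_fixes M \<beta>" "\<beta> \<noteq> \<alpha>"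
  shows "hecke_conj p \<alpha> = \<beta>"
  unfolding hecke_conj_def
proof (rule the_equality)
  show "\<beta> \<noteq> \<alpha> \<and> (\<forall>N\<in>hecke_group p. moebius_fixes N \<alpha> \<longrightarrow> moebius_fixes N \<beta>)"
    using hecke_stabilizer_fixes_other[OF M] M by blast
next
  fix b assume b: "b \<noteq> \<alpha> \<and> (\<forall>N\<in>hecke_group p. moebius_fixes N \<alpha> \<longrightarrow> moebius_fixes N b)"
  let ?f = "\<lambda>x. M$2$1 * x\<^sup>2 + (M$2$2 - M$1$1) * x - M$1$2"
  have "?f \<alpha> = 0" "?f \<beta> = 0" "?f b = 0"
    using M b det_hecke_group[OF M(1)] by (auto simp: moebius_fixes_iff)
  then have "(\<beta> - \<alpha>) * (M$2$1 * (\<beta> + \<alpha>) + (M$2$2 - M$1$1)) = 0"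
    "(b - \<alpha>) * (M$2$1 * (b + \<alpha>) + (M$2$2 - M$1$1)) = 0"
    by (simp_all add: algebra_simps power2_eq_square)
  then have "M$2$1 * (\<beta> + \<alpha>) + (M$2$2 - M$1$1) = 0" "M$2$1 * (b + \<alpha>) + (M$2$2 - M$1$1) = 0"
    using b M(5) by simp_all
  then have "M$2$1 * (b - \<beta>) = 0"
    by (simp only: ring_distribs)
  then show "b = \<beta>"
    using hyperbolic_lower_left_nonzero[OF M(1,2)] by simp
qed

text \<open>A hyperbolic form has the coefficients of the fixed point equation of its matrix, so its
  two roots are the fixed points and Hecke conjugation exchanges them; A > 0 > C makes their product
  negative.\<close>

lemma simple_root_properties:
  assumes "hyperbolic_class p \<A>" "\<alpha> \<in> simple_roots \<A>"
  shows "\<alpha> > 0" "hecke_conj p \<alpha> < 0"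
    "hyperbolic_fixed_point p \<alpha>" "hyperbolic_fixed_point p (hecke_conj p \<alpha>)"
    "hecke_conj p (hecke_conj p \<alpha>) = \<alpha>"
proof -
  obtain Q where Q: "Q \<in> \<A>" "bqf_simple Q" "\<alpha> = bqf_root Q"
    using assms by (auto simp: simple_roots_def)
  obtain M where M: "M \<in> hecke_group p" "hyperbolic M" and Q_eq: "Q = (M$2$1, M$2$2 - M$1$1, - M$1$2)"
    using assms Q by (auto simp: hyperbolic_class_def hyperbolic_bqf_def is_M_alpha_def)
  define a b c e where "a = M$1$1" and "b = M$1$2" and "c = M$2$1" and "e = M$2$2"
  have bc: "c > 0" "b > 0"
    using Q by (simp_all add: Q_eq b_def c_def)
  define r where "r = sqrt ((e - a)\<^sup>2 + 4 * c * b)"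
  have r: "r\<^sup>2 = (e - a)\<^sup>2 + 4 * c * b"
    using bc by (simp add: r_def)
  have "r > \<bar>e - a\<bar>"
    using bc unfolding r_def by (intro real_less_rsqrt) auto
  then have r_gt: "a - e + r > 0" "a - e - r < 0"
    by linarith+
  have \<alpha>: "\<alpha> = (a - e + r) / (2 * c)"
    by (simp add: Q Q_eq r_def a_def b_def c_def e_def)
  define \<beta> where "\<beta> = (a - e - r) / (2 * c)"
  show pos: "\<alpha> > 0"
    using r_gt bc by (simp add: \<alpha>)
  have neg: "\<beta> < 0"
    using r_gt bc by (simp add: \<beta>_def divide_neg_pos)
  have "c * \<alpha>\<^sup>2 + (e - a) * \<alpha> - b = (r\<^sup>2 - (e - a)\<^sup>2 - 4 * c * b) / (4 * c)"
    using bc by (simp add: \<alpha> power2_eq_square divide_simps) (simp add: algebra_simps)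
  moreover have "c * \<beta>\<^sup>2 + (e - a) * \<beta> - b = (r\<^sup>2 - (e - a)\<^sup>2 - 4 * c * b) / (4 * c)"
    using bc by (simp add: \<beta>_def power2_eq_square divide_simps) (simp add: algebra_simps)
  ultimately have fixed: "moebius_fixes M \<alpha>" "moebius_fixes M \<beta>"
    using r det_hecke_group[OF M(1)]
    by (simp_all add: moebius_fixes_iff a_def b_def c_def e_def)
  have conj: "hecke_conj p \<alpha> = \<beta>" "hecke_conj p \<beta> = \<alpha>"
    using hecke_conj_eq M fixed pos neg by auto
  show "hecke_conj p \<alpha> < 0" "hyperbolic_fixed_point p \<alpha>" "hyperbolic_fixed_point p (hecke_conj p \<alpha>)"
    "hecke_conj p (hecke_conj p \<alpha>) = \<alpha>"
    using M fixed conj neg by (auto simp: hyperbolic_fixed_point_def)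
qed

lemma hecke_V_in_hecke_group: "hecke_V (int n) \<in> hecke_group p"
proof (induction n)
  case 0
  have "matrix_inv hecke_T = - hecke_T"
    by (intro matrix_inv_unique) (simp add: minus_mult_right_2 T_T)
  then show ?case
    using hecke_group.inverse[OF hecke_group.T, of p] by (simp add: hecke_V_0)
next
  case (Suc n)
  have "hecke_V (int (Suc n)) = hecke_V (int n) ** (hecke_T ** hecke_S p)"
    using hecke_V_T_S[of "int n"] by (simp add: add.commute)
  then show ?case
    using Suc by (auto intro: hecke_group.intros)
qed

text \<open>The quotient is the image of \<infinity> under \<open>hecke_V j\<close>, a cusp. These
  cusps are the limits of U^j z as z tends to 0, where the period function has to be
  continuous.\<close>

lemma simple_root_ne_sin_ratio:
  assumes "hyperbolic_class p \<A>" "\<alpha> \<in> simple_roots \<A>" "2 \<le> j" "j < p"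
  shows "\<alpha> \<noteq> sin_ratio p (int j) / sin_ratio p (int j - 1)"
  using hyperbolic_fixed_point_not_cusp[OF simple_root_properties(3)[OF assms(1,2)]
      hecke_V_in_hecke_group[of j]] sin_ratio_ge_1[of "int j - 1"] assms(3,4)
  by (simp add: hecke_V_def)

end

section \<open>Inverse Mellin transforms with a Gaussian factor\<close>

lemma integral_symmetric_tendsto:
  fixes f :: "real \<Rightarrow> complex"
  assumes f: "integrable lborel f"
  shows "(\<lambda>n. integral {- real n..real n} f) \<longlonglongrightarrow> (LBINT t. f t)"
proof -
  have [measurable]: "f \<in> borel_measurable borel"
    using f by auto
  have eq: "integral {- real n..real n} f = (LBINT t. indicator {- real n..real n} t *\<^sub>R f t)" for n
    using f set_borel_integral_eq_integral(2)[of "{- real n..real n}" f]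
    by (simp add: set_integrable_def set_lebesgue_integral_def integrable_mult_indicator)
  have "(\<lambda>n. LBINT t. indicator {- real n..real n} t *\<^sub>R f t) \<longlonglongrightarrow> (LBINT t. f t)"
  proof (rule integral_dominated_convergence[where w = "\<lambda>t. norm (f t)"])
    show "AE t in lborel. (\<lambda>n. indicat_real {- real n..real n} t *\<^sub>R f t) \<longlonglongrightarrow> f t"
    proof (rule AE_I2)
      fix t
      have "eventually (\<lambda>n. indicat_real {- real n..real n} t *\<^sub>R f t = f t) sequentially"
        using eventually_ge_at_top[of "nat \<lceil>\<bar>t\<bar>\<rceil>"]
        by eventually_elim (auto simp: indicator_def; linarith)
      then show "(\<lambda>n. indicat_real {- real n..real n} t *\<^sub>R f t) \<longlonglongrightarrow> f t"
        by (rule tendsto_eventually)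
    qed
    show "AE t in lborel. norm (indicat_real {- real n..real n} t *\<^sub>R f t) \<le> norm (f t)" for n
      by (auto simp: indicator_def)
  qed (use f in auto)
  then show ?thesis
    by (simp add: eq)
qed

text \<open>The residue theorem on rectangles of growing height: B controls the horizontal edges,
  and ds = i dt removes the i from 2 pi i. The wider strip between a' and b' is the open set that
  contains the closed rectangles.\<close>

lemma strip_shift:
  fixes f :: "complex \<Rightarrow> complex" and a b a' b' t0 :: real and P :: "complex set" and B :: "real \<Rightarrow> real"
  assumes ab: "a' < a" "a < b" "b < b'"
    and holo: "f holomorphic_on {s. a' < Re s \<and> Re s < b'} - P"
    and P: "finite P" "P \<subseteq> {s. a < Re s \<and> Re s < b}"
    and int_a: "integrable lborel (\<lambda>t. f (Complex a t))"
    and int_b: "integrable lborel (\<lambda>t. f (Complex b t))"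
    and bound: "\<And>\<sigma> t. \<sigma> \<in> {a..b} \<Longrightarrow> \<bar>t\<bar> \<ge> t0 \<Longrightarrow> norm (f (Complex \<sigma> t)) \<le> B \<bar>t\<bar>"
    and B: "(B \<longlongrightarrow> 0) at_top"
  shows "(LBINT t. f (Complex b t)) - (LBINT t. f (Complex a t)) = 2 * pi * (\<Sum>s\<in>P. residue f s)"
proof -
  define S where "S = {s. a' < Re s \<and> Re s < b'}"
  have S: "open S" "connected S"
  proof -
    have "S = {s. a' < Re s} \<inter> {s. Re s < b'}"
      by (auto simp: S_def)
    then have "convex S"
      by (auto intro!: convex_Int convex_halfspace_Re_gt convex_halfspace_Re_lt)
    then show "connected S"
      by (rule convex_connected)
    show "open S"
      unfolding S_def by (intro open_Collect_conj open_Collect_less continuous_intros)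
  qed
  define T0 where "T0 = Max (insert \<bar>t0\<bar> ((\<lambda>s. \<bar>Im s\<bar>) ` P)) + 1"
  have T0: "\<bar>t0\<bar> < T0" "\<And>s. s \<in> P \<Longrightarrow> \<bar>Im s\<bar> < T0"
  proof -
    have fin: "finite (insert \<bar>t0\<bar> ((\<lambda>s. \<bar>Im s\<bar>) ` P))"
      using P by simp
    show "\<bar>t0\<bar> < T0"
      using Max_ge[OF fin, of "\<bar>t0\<bar>"] unfolding T0_def by simp
    show "\<bar>Im s\<bar> < T0" if "s \<in> P" for s
      using Max_ge[OF fin, of "\<bar>Im s\<bar>"] that unfolding T0_def by simp
  qed
  define IV where "IV = (\<lambda>\<sigma> T. integral {- T..T} (\<lambda>t. f (Complex \<sigma> t)))"
  \<comment> \<open>The defect of the formula at height T; up to a factor of modulus 1 it is the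
    contribution of the two horizontal edges.\<close>
  define E where "E = (\<lambda>T. IV b T - IV a T - 2 * pi * (\<Sum>s\<in>P. residue f s))"
  have E_bound: "norm (E T) \<le> 2 * (b - a) * \<bar>B T\<bar>" if T: "T \<ge> T0" for T
  proof -
    have Tpos: "T > 0"
      using T T0(1) by linarith
    define a1 a2 a3 a4 where "a1 = Complex a (- T)" and "a2 = Complex b (- T)"
      and "a3 = Complex b T" and "a4 = Complex a T"
    have rect: "rectpath a1 a3 = linepath a1 a2 +++ linepath a2 a3 +++ linepath a3 a4 +++ linepath a4 a1"
      by (simp add: rectpath_def Let_def a1_def a2_def a3_def a4_def)
    have img: "path_image (rectpath a1 a3) = {z. Re z \<in> {a, b} \<and> Im z \<in> {- T..T}} \<union>
                 {z. Im z \<in> {- T, T} \<and> Re z \<in> {a..b}}"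
      using ab Tpos by (subst path_image_rectpath) (auto simp: a1_def a3_def)
    have sub: "path_image (rectpath a1 a3) \<subseteq> S - P"
      unfolding img using ab P(2) T0(2) T by (force simp: S_def)
    have cont: "continuous_on (path_image (rectpath a1 a3)) f"
      using holo sub by (auto simp: S_def intro: holomorphic_on_imp_continuous_on holomorphic_on_subset)
    have segs: "path_image (rectpath a1 a3) = closed_segment a1 a2 \<union> closed_segment a2 a3 \<union>
                  closed_segment a3 a4 \<union> closed_segment a4 a1"
      by (simp add: rect path_image_join Un_assoc)
    have ci: "f contour_integrable_on linepath a1 a2" "f contour_integrable_on linepath a2 a3"
      "f contour_integrable_on linepath a3 a4" "f contour_integrable_on linepath a4 a1"
      by (intro contour_integrable_continuous_linepath continuous_on_subset[OF cont]; auto simp: segs)+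
    have "contour_integral (rectpath a1 a3) f
        = 2 * pi * \<i> * (\<Sum>s\<in>P. winding_number (rectpath a1 a3) s * residue f s)"
    proof (rule Residue_theorem[OF S P(1)])
      show "f holomorphic_on S - P"
        using holo by (simp add: S_def)
      show "\<forall>z. z \<notin> S \<longrightarrow> winding_number (rectpath a1 a3) z = 0"
      proof (intro allI impI)
        fix z assume "z \<notin> S"
        then have "z \<notin> cbox a1 a3"
          using ab by (auto simp: S_def in_cbox_complex_iff a1_def a3_def)
        then show "winding_number (rectpath a1 a3) z = 0"
          using ab Tpos by (intro winding_number_rectpath_outside) (auto simp: a1_def a3_def)
      qed
    qed (use sub in auto)
    also have "(\<Sum>s\<in>P. winding_number (rectpath a1 a3) s * residue f s) = (\<Sum>s\<in>P. residue f s)"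
    proof (rule sum.cong[OF refl])
      fix s assume "s \<in> P"
      then have "s \<in> box a1 a3"
        using P(2) T0(2)[of s] T by (force simp: in_box_complex_iff a1_def a3_def)
      then show "winding_number (rectpath a1 a3) s * residue f s = residue f s"
        by (simp add: winding_number_rectpath)
    qed
    finally have res: "contour_integral (rectpath a1 a3) f = 2 * pi * \<i> * (\<Sum>s\<in>P. residue f s)" .
    have vert: "contour_integral (linepath (Complex \<sigma> (- T)) (Complex \<sigma> T)) f = \<i> * IV \<sigma> T" for \<sigma>
      using Tpos contour_integral_linepath_same_Re[of "Complex \<sigma> (- T)" \<sigma> "Complex \<sigma> T" "- T" T f]
      by (simp add: IV_def)
    have down: "contour_integral (linepath a4 a1) f = - (\<i> * IV a T)"
    proof -
      have "continuous_on (closed_segment a4 a1) f"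
        by (rule continuous_on_subset[OF cont]) (auto simp: segs)
      then show ?thesis
        using vert[of a] contour_integral_reverse_linepath[of a4 a1 f] by (simp add: a1_def a4_def)
    qed
    have "\<i> * E T = - contour_integral (linepath a1 a2) f - contour_integral (linepath a3 a4) f"
      using res vert[of b] down ci unfolding rect
      by (simp add: E_def a2_def a3_def algebra_simps)
    then have "norm (E T) = norm (- contour_integral (linepath a1 a2) f - contour_integral (linepath a3 a4) f)"
      by (metis norm_mult norm_ii mult_1)
    also have "\<dots> \<le> norm (contour_integral (linepath a1 a2) f) + norm (contour_integral (linepath a3 a4) f)"
      by (metis norm_minus_cancel norm_triangle_ineq4)
    also have "norm (contour_integral (linepath a1 a2) f) \<le> \<bar>B T\<bar> * norm (a2 - a1)"
    proof (rule contour_integral_bound_linepath[OF ci(1)])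
      fix x assume "x \<in> closed_segment a1 a2"
      then have "Im x = - T" "Re x \<in> {a..b}"
        using ab by (auto simp: a1_def a2_def closed_segment_same_Im closed_segment_eq_real_ivl split: if_splits)
      moreover have "t0 \<le> T"
        using T T0(1) by linarith
      ultimately show "norm (f x) \<le> \<bar>B T\<bar>"
        using bound[of "Re x" "Im x", unfolded complex.collapse] Tpos by simp
    qed auto
    also have "norm (contour_integral (linepath a3 a4) f) \<le> \<bar>B T\<bar> * norm (a4 - a3)"
    proof (rule contour_integral_bound_linepath[OF ci(3)])
      fix x assume "x \<in> closed_segment a3 a4"
      then have "Im x = T" "Re x \<in> {a..b}"
        using ab by (auto simp: a3_def a4_def closed_segment_same_Im closed_segment_eq_real_ivl split: if_splits)
      moreover have "t0 \<le> T"
        using T T0(1) by linarith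
      ultimately show "norm (f x) \<le> \<bar>B T\<bar>"
        using bound[of "Re x" "Im x", unfolded complex.collapse] Tpos by simp
    qed auto
    also have "norm (a2 - a1) = b - a"
      using ab by (simp add: a1_def a2_def cmod_def)
    also have "norm (a4 - a3) = b - a"
      using ab by (simp add: a3_def a4_def cmod_def)
    finally show ?thesis
      by (simp add: algebra_simps)
  qed
  have "(\<lambda>n. E (real n)) \<longlonglongrightarrow> 0"
  proof (rule Lim_null_comparison)
    show "eventually (\<lambda>n. norm (E (real n)) \<le> 2 * (b - a) * \<bar>B (real n)\<bar>) sequentially"
      using eventually_ge_at_top[of "nat \<lceil>T0\<rceil>"] by eventually_elim (intro E_bound, linarith)
    have "(\<lambda>n. B (real n)) \<longlonglongrightarrow> 0"
      by (rule filterlim_compose[OF B filterlim_real_sequentially])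
    then show "(\<lambda>n. 2 * (b - a) * \<bar>B (real n)\<bar>) \<longlonglongrightarrow> 0"
      by (intro tendsto_eq_intros) auto
  qed
  moreover have "(\<lambda>n. E (real n)) \<longlonglongrightarrow>
      (LBINT t. f (Complex b t)) - (LBINT t. f (Complex a t)) - 2 * pi * (\<Sum>s\<in>P. residue f s)"
    unfolding E_def IV_def
    by (intro tendsto_intros integral_symmetric_tendsto int_a int_b)
  ultimately have "(LBINT t. f (Complex b t)) - (LBINT t. f (Complex a t)) - 2 * pi * (\<Sum>s\<in>P. residue f s) = 0"
    using LIMSEQ_unique by blast
  then show ?thesis
    by simp
qed


text \<open>Rescaling the variable by sqrt (2 \<epsilon>) reduces the claim to the characteristic
  function of the standard normal distribution.\<close>

lemma gaussian_fourier:
  fixes \<epsilon> w :: real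
  assumes \<epsilon>: "\<epsilon> > 0"
  shows "has_bochner_integral lborel (\<lambda>t. of_real (exp (- \<epsilon> * t\<^sup>2)) * iexp (w * t))
           (of_real (sqrt (pi / \<epsilon>) * exp (- w\<^sup>2 / (4 * \<epsilon>))))"
proof -
  define c where "c = sqrt (2 * \<epsilon>)"
  have c: "c > 0" "c\<^sup>2 = 2 * \<epsilon>"
    using \<epsilon> by (auto simp: c_def)
  define \<theta> where "\<theta> = w / c"
  interpret N: prob_space std_normal_distribution
    by (rule prob_space_normal_density) simp
  have "integrable std_normal_distribution (\<lambda>x. iexp (\<theta> * x))"
    by (rule N.integrable_const_bound[of _ 1]) auto
  then have "integrable lborel (\<lambda>x. std_normal_density x *\<^sub>R iexp (\<theta> * x))"
    by (subst (asm) integrable_density) auto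
  moreover have "(LBINT x. std_normal_density x *\<^sub>R iexp (\<theta> * x)) = of_real (exp (- \<theta>\<^sup>2 / 2))"
    using fun_cong[OF char_std_normal_distribution, of \<theta>]
    unfolding char_def by (subst (asm) integral_density) auto
  ultimately have "has_bochner_integral lborel (\<lambda>x. std_normal_density x *\<^sub>R iexp (\<theta> * x))
      (of_real (exp (- \<theta>\<^sup>2 / 2)))"
    by (simp add: has_bochner_integral_iff)
  then have "has_bochner_integral lborel (\<lambda>x. std_normal_density (0 + c * x) *\<^sub>R iexp (\<theta> * (0 + c * x)))
      (of_real (exp (- \<theta>\<^sup>2 / 2)) /\<^sub>R \<bar>c\<bar>)"
    using c by (subst (asm) lborel_has_bochner_integral_real_affine_iff[where c = c and t = 0]) auto
  then have "has_bochner_integral lborel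
      (\<lambda>x. sqrt (2 * pi) *\<^sub>R (std_normal_density (0 + c * x) *\<^sub>R iexp (\<theta> * (0 + c * x))))
      (sqrt (2 * pi) *\<^sub>R (of_real (exp (- \<theta>\<^sup>2 / 2)) /\<^sub>R \<bar>c\<bar>))"
    by (intro has_bochner_integral_scaleR_right)
  moreover have "sqrt (2 * pi) *\<^sub>R (std_normal_density (0 + c * x) *\<^sub>R iexp (\<theta> * (0 + c * x)))
      = of_real (exp (- \<epsilon> * x\<^sup>2)) * iexp (w * x)" for x
  proof -
    have 1: "\<theta> * (0 + c * x) = w * x" and 2: "- (0 + c * x)\<^sup>2 / 2 = - \<epsilon> * x\<^sup>2"
      using c by (auto simp: \<theta>_def power_mult_distrib)
    show ?thesis
      unfolding std_normal_density_def 1 2 by (simp add: scaleR_conv_of_real)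
  qed
  moreover have "sqrt (2 * pi) *\<^sub>R (of_real (exp (- \<theta>\<^sup>2 / 2)) /\<^sub>R \<bar>c\<bar>)
      = complex_of_real (sqrt (pi / \<epsilon>) * exp (- w\<^sup>2 / (4 * \<epsilon>)))"
  proof -
    have "sqrt (2 * pi) / c = sqrt (pi / \<epsilon>)"
      by (simp add: c_def real_sqrt_divide real_sqrt_mult)
    moreover have "\<theta>\<^sup>2 / 2 = w\<^sup>2 / (4 * \<epsilon>)"
      using c \<epsilon> by (simp add: \<theta>_def power_divide)
    ultimately show ?thesis
      using c by (simp add: scaleR_conv_of_real field_simps flip: of_real_mult of_real_divide)
  qed
  ultimately show ?thesis
    by simp
qed

text \<open>The integral of H(s) exp (\<epsilon> (s - b)^2) y^(-s) over Re s = \<sigma>, divided by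
  2 pi i, with v = ln y. Centring the Gaussian at b makes it invariant under s -> 2b - s.\<close>

definition mellin_inv :: "real \<Rightarrow> real \<Rightarrow> (complex \<Rightarrow> complex) \<Rightarrow> real \<Rightarrow> real \<Rightarrow> complex" where
  "mellin_inv \<epsilon> b H \<sigma> v = (LBINT t. H (Complex \<sigma> t) * exp (of_real \<epsilon> * (Complex \<sigma> t - of_real b)\<^sup>2) *
      exp (- Complex \<sigma> t * of_real v)) / of_real (2 * pi)"

text \<open>After inserting the integral for H and exchanging the order, the t-integral is the
  Fourier transform of a Gaussian: again a Gaussian in x, with centre v - 2 \<epsilon> (c - b) and
  width of order sqrt \<epsilon>. The variable r rescales it to the fixed weight exp (-
  r^2).\<close>

lemma mellin_inv_gaussian:
  fixes u :: "real \<Rightarrow> complex" and c b v \<epsilon> :: real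
  defines "U \<equiv> \<lambda>x. u x * of_real (exp (c * x))"
  assumes \<epsilon>: "\<epsilon> > 0" and int: "integrable lborel U"
    and H: "\<And>t. H (Complex c t) = (LBINT x. u x * exp (Complex c t * of_real x))"
  shows "mellin_inv \<epsilon> b H c v = of_real (exp (\<epsilon> * (c - b)\<^sup>2 - c * v) / sqrt pi) *
           (LBINT r. U (v - 2 * \<epsilon> * (c - b) + 2 * sqrt \<epsilon> * r) * of_real (exp (- r\<^sup>2)))"
proof -
  define \<delta> where "\<delta> = c - b"
  have [measurable]: "U \<in> borel_measurable borel"
    using int by auto
  have H': "H (Complex c t) = (LBINT x. U x * iexp (t * x))" for t
    unfolding H U_def
    by (intro Bochner_Integration.integral_cong refl)
       (simp add: Complex_eq exp_add[symmetric] exp_of_real[symmetric] algebra_simps)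
  define g where "g = (\<lambda>x t. U x * (of_real (exp (- \<epsilon> * t\<^sup>2)) * iexp ((x - v + 2 * \<epsilon> * \<delta>) * t)))"
  define C where "C = complex_of_real (exp (\<epsilon> * \<delta>\<^sup>2 - c * v))"
  have integrand: "H (Complex c t) * exp (of_real \<epsilon> * (Complex c t - of_real b)\<^sup>2) * exp (- Complex c t * of_real v)
      = C * (LBINT x. g x t)" for t
  proof -
    have e: "exp (of_real \<epsilon> * (Complex c t - of_real b)\<^sup>2) * exp (- Complex c t * of_real v)
        = C * (of_real (exp (- \<epsilon> * t\<^sup>2)) * iexp ((- v + 2 * \<epsilon> * \<delta>) * t))"
      by (simp add: C_def \<delta>_def Complex_eq exp_of_real[symmetric] exp_add[symmetric] power2_eq_square algebra_simps)
    have "(LBINT x. g x t) = (LBINT x. (U x * iexp (t * x)) * (of_real (exp (- \<epsilon> * t\<^sup>2)) * iexp ((- v + 2 * \<epsilon> * \<delta>) * t)))"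
      by (intro Bochner_Integration.integral_cong refl)
         (simp add: g_def exp_add[symmetric] algebra_simps)
    also have "\<dots> = (LBINT x. U x * iexp (t * x)) * (of_real (exp (- \<epsilon> * t\<^sup>2)) * iexp ((- v + 2 * \<epsilon> * \<delta>) * t))"
      by (rule integral_mult_left_zero)
    finally have f: "(LBINT x. g x t) = (LBINT x. U x * iexp (t * x)) *
        (of_real (exp (- \<epsilon> * t\<^sup>2)) * iexp ((- v + 2 * \<epsilon> * \<delta>) * t))" .
    have "H (Complex c t) * exp (of_real \<epsilon> * (Complex c t - of_real b)\<^sup>2) * exp (- Complex c t * of_real v)
        = H (Complex c t) * (exp (of_real \<epsilon> * (Complex c t - of_real b)\<^sup>2) * exp (- Complex c t * of_real v))"
      by (rule mult.assoc)
    then show ?thesis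
      unfolding f e H' by (simp only: mult_ac)
  qed
  have gt: "has_bochner_integral lborel (g x) (U x * of_real (sqrt (pi / \<epsilon>) * exp (- (x - v + 2 * \<epsilon> * \<delta>)\<^sup>2 / (4 * \<epsilon>))))" for x
    unfolding g_def by (intro has_bochner_integral_mult_right gaussian_fourier \<epsilon>)
  have swap: "(LBINT t. LBINT x. g x t) = (LBINT x. LBINT t. g x t)"
  proof (rule lborel_pair.Fubini_integral)
    show "integrable (lborel \<Otimes>\<^sub>M lborel) (\<lambda>(x, t). g x t)"
    proof (rule lborel_pair.Fubini_integrable)
      show "(\<lambda>(x, t). g x t) \<in> borel_measurable (lborel \<Otimes>\<^sub>M lborel)"
        unfolding g_def by measurable
      have "norm (g x t) = norm (U x) * exp (- \<epsilon> * t\<^sup>2)" for x t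
        by (simp add: g_def norm_mult)
      then have "(LBINT t. norm (case (x, t) of (x, t) \<Rightarrow> g x t)) = norm (U x) * (LBINT t. exp (- \<epsilon> * t\<^sup>2))" for x
        by simp
      then show "integrable lborel (\<lambda>x. LBINT t. norm (case (x, t) of (x, t) \<Rightarrow> g x t))"
        using int by simp
      show "AE x in lborel. integrable lborel (\<lambda>t. case (x, t) of (x, t) \<Rightarrow> g x t)"
        using gt by (auto simp: has_bochner_integral_iff)
    qed
  qed
  have "mellin_inv \<epsilon> b H c v = C * (LBINT t. LBINT x. g x t) / of_real (2 * pi)"
    unfolding mellin_inv_def integrand by simp
  also have "\<dots> = C * (LBINT x. U x * of_real (sqrt (pi / \<epsilon>) * exp (- (x - v + 2 * \<epsilon> * \<delta>)\<^sup>2 / (4 * \<epsilon>)))) / of_real (2 * pi)"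
    using gt by (simp add: swap has_bochner_integral_iff)
  also have "(LBINT x. U x * of_real (sqrt (pi / \<epsilon>) * exp (- (x - v + 2 * \<epsilon> * \<delta>)\<^sup>2 / (4 * \<epsilon>))))
     = \<bar>2 * sqrt \<epsilon>\<bar> *\<^sub>R (LBINT r. U ((v - 2 * \<epsilon> * \<delta>) + 2 * sqrt \<epsilon> * r) *
          of_real (sqrt (pi / \<epsilon>) * exp (- ((v - 2 * \<epsilon> * \<delta>) + 2 * sqrt \<epsilon> * r - v + 2 * \<epsilon> * \<delta>)\<^sup>2 / (4 * \<epsilon>))))"
    using \<epsilon> by (intro lborel_integral_real_affine) auto
  also have "(\<lambda>r. U ((v - 2 * \<epsilon> * \<delta>) + 2 * sqrt \<epsilon> * r) *
          complex_of_real (sqrt (pi / \<epsilon>) * exp (- ((v - 2 * \<epsilon> * \<delta>) + 2 * sqrt \<epsilon> * r - v + 2 * \<epsilon> * \<delta>)\<^sup>2 / (4 * \<epsilon>))))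
      = (\<lambda>r. (U (v - 2 * \<epsilon> * \<delta> + 2 * sqrt \<epsilon> * r) * of_real (exp (- r\<^sup>2))) * of_real (sqrt (pi / \<epsilon>)))"
    using \<epsilon> by (simp add: power_mult_distrib fun_eq_iff)
  also have "(LBINT r. (U (v - 2 * \<epsilon> * \<delta> + 2 * sqrt \<epsilon> * r) * of_real (exp (- r\<^sup>2))) * complex_of_real (sqrt (pi / \<epsilon>)))
      = (LBINT r. U (v - 2 * \<epsilon> * \<delta> + 2 * sqrt \<epsilon> * r) * of_real (exp (- r\<^sup>2))) * of_real (sqrt (pi / \<epsilon>))"
    by (rule integral_mult_left_zero)
  also have "C * (\<bar>2 * sqrt \<epsilon>\<bar> *\<^sub>R ((LBINT r. U (v - 2 * \<epsilon> * \<delta> + 2 * sqrt \<epsilon> * r) * of_real (exp (- r\<^sup>2))) *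
       of_real (sqrt (pi / \<epsilon>)))) / of_real (2 * pi)
     = of_real (\<bar>2 * sqrt \<epsilon>\<bar> * sqrt (pi / \<epsilon>) / (2 * pi)) * C *
        (LBINT r. U (v - 2 * \<epsilon> * \<delta> + 2 * sqrt \<epsilon> * r) * of_real (exp (- r\<^sup>2)))"
    by (simp add: scaleR_conv_of_real)
  also have "\<bar>2 * sqrt \<epsilon>\<bar> * sqrt (pi / \<epsilon>) / (2 * pi) = 1 / sqrt pi"
    using \<epsilon> by (simp add: real_sqrt_divide field_simps)
  finally show ?thesis
    by (simp add: C_def \<delta>_def)
qed

text \<open>The Gaussian averages concentrate at v as \<epsilon> tends to 0, where U is continuous;
  K times the Gaussian is the dominating function.\<close>

lemma mellin_inv_tendsto:
  fixes u :: "real \<Rightarrow> complex" and c b v K :: real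
  assumes cont: "continuous_on UNIV u"
    and int: "integrable lborel (\<lambda>x. u x * of_real (exp (c * x)))"
    and bdd: "\<And>x. norm (u x) * exp (c * x) \<le> K"
    and H: "\<And>t. H (Complex c t) = (LBINT x. u x * exp (Complex c t * of_real x))"
  shows "((\<lambda>\<epsilon>. mellin_inv \<epsilon> b H c v) \<longlongrightarrow> u v) (at_right 0)"
proof -
  define U where "U = (\<lambda>x. u x * of_real (exp (c * x)))"
  have U_cont: "continuous_on UNIV U"
    unfolding U_def by (intro continuous_intros cont)
  have U_isCont: "isCont U x" for x
    using U_cont by (simp add: continuous_on_eq_continuous_at)
  have [measurable]: "U \<in> borel_measurable borel"
    using U_cont by (rule borel_measurable_continuous_onI)
  have U_bdd: "norm (U x) \<le> K" for x
    using bdd[of x] by (simp add: U_def norm_mult)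
  have gauss_int: "has_bochner_integral lborel (\<lambda>r. exp (- r\<^sup>2)) (sqrt pi)"
    using has_bochner_integral_even_function[OF gaussian_moment_0] by simp
  define G where "G = (\<lambda>\<epsilon>. LBINT r. U (v - 2 * \<epsilon> * (c - b) + 2 * sqrt \<epsilon> * r) * of_real (exp (- r\<^sup>2)))"
  \<comment> \<open>The limit is taken along \<epsilon> = 1 / T with T tending to infinity, the form
    in which dominated convergence is applied.\<close>
  have "((\<lambda>T. G (inverse T)) \<longlongrightarrow> (LBINT r. U v * of_real (exp (- r\<^sup>2)))) at_top"
    unfolding G_def
  proof (rule integral_dominated_convergence_at_top[where w = "\<lambda>r. K * exp (- r\<^sup>2)"])
    show "integrable lborel (\<lambda>r. K * exp (- r\<^sup>2))"
      using gauss_int by (intro integrable_mult_right) (simp add: has_bochner_integral_iff)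
    show "\<forall>\<^sub>F T in at_top. AE r in lborel.
        norm (U (v - 2 * inverse T * (c - b) + 2 * sqrt (inverse T) * r) * of_real (exp (- r\<^sup>2))) \<le> K * exp (- r\<^sup>2)"
      using U_bdd by (auto simp: norm_mult)
    show "AE r in lborel. ((\<lambda>T. U (v - 2 * inverse T * (c - b) + 2 * sqrt (inverse T) * r) * of_real (exp (- r\<^sup>2)))
        \<longlongrightarrow> U v * of_real (exp (- r\<^sup>2))) at_top"
    proof (rule AE_I2)
      fix r :: real
      have inv: "((\<lambda>T::real. inverse T) \<longlongrightarrow> 0) at_top"
        by (rule tendsto_inverse_0_at_top[OF filterlim_ident])
      have "((\<lambda>T. v - 2 * inverse T * (c - b) + 2 * sqrt (inverse T) * r) \<longlongrightarrow> v - 2 * 0 * (c - b) + 2 * sqrt 0 * r) at_top"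
        by (intro tendsto_intros inv)
      then have "((\<lambda>T. v - 2 * inverse T * (c - b) + 2 * sqrt (inverse T) * r) \<longlongrightarrow> v) at_top"
        by simp
      then show "((\<lambda>T. U (v - 2 * inverse T * (c - b) + 2 * sqrt (inverse T) * r) * of_real (exp (- r\<^sup>2)))
        \<longlongrightarrow> U v * of_real (exp (- r\<^sup>2))) at_top"
        by (intro tendsto_intros isCont_tendsto_compose[OF U_isCont])
    qed
  qed auto
  moreover have "(LBINT r. U v * complex_of_real (exp (- r\<^sup>2))) = U v * of_real (sqrt pi)"
    using gauss_int by (simp add: has_bochner_integral_iff)
  ultimately have "((\<lambda>T. G (inverse T)) \<longlongrightarrow> U v * of_real (sqrt pi)) at_top"
    by (simp only:)
  then have G: "(G \<longlongrightarrow> U v * of_real (sqrt pi)) (at_right 0)"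
    by (simp add: filterlim_at_right_to_top)
  have "((\<lambda>\<epsilon>. of_real (exp (\<epsilon> * (c - b)\<^sup>2 - c * v) / sqrt pi) * G \<epsilon>)
      \<longlongrightarrow> of_real (exp (0 * (c - b)\<^sup>2 - c * v) / sqrt pi) * (U v * of_real (sqrt pi))) (at_right 0)"
    by (intro tendsto_intros G tendsto_of_real) auto
  also have "of_real (exp (0 * (c - b)\<^sup>2 - c * v) / sqrt pi) * (U v * of_real (sqrt pi)) = u v"
    by (simp add: U_def exp_minus)
  finally have "((\<lambda>\<epsilon>. of_real (exp (\<epsilon> * (c - b)\<^sup>2 - c * v) / sqrt pi) * G \<epsilon>) \<longlongrightarrow> u v) (at_right 0)" .
  then show ?thesis
  proof (rule Lim_transform_eventually)
    show "\<forall>\<^sub>F \<epsilon> in at_right 0. of_real (exp (\<epsilon> * (c - b)\<^sup>2 - c * v) / sqrt pi) * G \<epsilon> = mellin_inv \<epsilon> b H c v"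
      using eventually_at_right_less[of 0]
      by eventually_elim (subst mellin_inv_gaussian[OF _ int H], auto simp: G_def U_def)
  qed
qed

section \<open>A beta integral\<close>

lemma integrable_exp_neg_abs:
  assumes "\<eta> > (0::real)"
  shows "integrable lborel (\<lambda>x. exp (- \<eta> * \<bar>x\<bar>))"
proof -
  interpret E: prob_space "density lborel (exponential_density \<eta>)"
    by (rule prob_space_exponential_density[OF assms])
  have "integrable (density lborel (exponential_density \<eta>)) (\<lambda>x. 1 :: real)"
    by simp
  then have int: "integrable lborel (exponential_density \<eta>)"
    using assms by (subst (asm) integrable_density) (auto simp: erlang_density_nonneg)
  then have "integrable lborel (\<lambda>x. exponential_density \<eta> (0 + (-1) * x))"
    by (rule lborel_integrable_real_affine) simp
  with int have "integrable lborel (\<lambda>x. (exponential_density \<eta> x + exponential_density \<eta> (0 + (-1) * x)) / \<eta>)"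
    by (intro integrable_divide Bochner_Integration.integrable_add)
  then show ?thesis
  proof (rule Bochner_Integration.integrable_bound)
    show "AE x in lborel. norm (exp (- \<eta> * \<bar>x\<bar>)) \<le>
        norm ((exponential_density \<eta> x + exponential_density \<eta> (0 + (-1) * x)) / \<eta>)"
      using assms by (intro AE_I2) (auto simp: exponential_density_def abs_if mult.commute)
  qed auto
qed

text \<open>For Re c >= 0 the norm is at least exp x and at least norm c, and the bound is an
  average of the two. The values of c that occur for the poles are purely imaginary.\<close>

lemma norm_exp_add_ge:
  assumes "Re c \<ge> 0"
  shows "norm (of_real (exp x) + c) \<ge> min 1 (norm c) / 2 * (1 + exp x)"
proof -
  have "norm (of_real (exp x) + c) \<ge> exp x"
  proof -
    have "exp x \<le> \<bar>Re (of_real (exp x) + c)\<bar>"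
      using assms by simp
    also have "\<dots> \<le> norm (of_real (exp x) + c)"
      by (rule abs_Re_le_cmod)
    finally show ?thesis .
  qed
  moreover have "norm (of_real (exp x) + c) \<ge> norm c"
    using assms unfolding cmod_def by (intro real_sqrt_le_mono add_right_mono power_mono) auto
  ultimately have "2 * norm (of_real (exp x) + c) \<ge> exp x + norm c"
    by linarith
  moreover have "min 1 (norm c) * (1 + exp x) \<le> exp x + norm c"
  proof -
    have "min 1 (norm c) * exp x \<le> 1 * exp x"
      by (intro mult_right_mono) auto
    moreover have "min 1 (norm c) \<le> norm c"
      by simp
    ultimately show ?thesis
      by (simp only: ring_distribs mult_1_right mult_1_left)
  qed
  ultimately show ?thesis
    by linarith
qed

lemma exp_ratio_bound:
  fixes \<sigma> x :: real
  assumes "0 < \<sigma>" "\<sigma> < 1"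
  shows "exp (\<sigma> * x) / (1 + exp x) \<le> exp (- min \<sigma> (1 - \<sigma>) * \<bar>x\<bar>)"
proof (cases "x \<ge> 0")
  case True
  have "exp (\<sigma> * x) / (1 + exp x) \<le> exp (\<sigma> * x) / exp x"
    by (intro divide_left_mono mult_pos_pos) (auto intro: add_pos_pos)
  also have "\<dots> = exp (- (1 - \<sigma>) * \<bar>x\<bar>)"
    using True by (simp add: exp_diff[symmetric] algebra_simps)
  also have "\<dots> \<le> exp (- min \<sigma> (1 - \<sigma>) * \<bar>x\<bar>)"
    by (subst exp_le_cancel_iff, intro mult_right_mono) auto
  finally show ?thesis .
next
  case False
  have "exp (\<sigma> * x) / (1 + exp x) \<le> exp (\<sigma> * x) / 1"
    by (intro divide_left_mono) (auto intro: add_pos_pos)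
  also have "\<dots> = exp (- \<sigma> * \<bar>x\<bar>)"
    using False by simp
  also have "\<dots> \<le> exp (- min \<sigma> (1 - \<sigma>) * \<bar>x\<bar>)"
    by (subst exp_le_cancel_iff, intro mult_right_mono) auto
  finally show ?thesis .
qed

lemma beta_kernel_bound:
  fixes c s :: complex
  assumes c: "Re c \<ge> 0" "c \<noteq> 0" and s: "0 < Re s" "Re s < 1" and m: "m \<ge> 1"
  shows "norm (exp (s * of_real x) / (of_real (exp x) + c) ^ m)
    \<le> (1 / (min 1 (norm c) / 2) ^ m) * exp (- min (Re s) (1 - Re s) * \<bar>x\<bar>)"
proof -
  define \<kappa> where "\<kappa> = min 1 (norm c) / 2"
  have \<kappa>: "\<kappa> > 0"
    using c by (simp add: \<kappa>_def)
  have "\<kappa> ^ m * (1 + exp x) \<le> \<kappa> ^ m * (1 + exp x) ^ m"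
    using \<kappa> m power_increasing[of 1 m "1 + exp x"] by (intro mult_left_mono) auto
  also have "\<dots> = (\<kappa> * (1 + exp x)) ^ m"
    by (simp add: power_mult_distrib)
  also have "\<dots> \<le> norm (of_real (exp x) + c) ^ m"
    using norm_exp_add_ge[OF c(1), of x] \<kappa> by (intro power_mono) (auto simp: \<kappa>_def)
  finally have "norm (exp (s * of_real x) / (of_real (exp x) + c) ^ m)
      \<le> exp (Re s * x) / (\<kappa> ^ m * (1 + exp x))"
    using \<kappa> unfolding norm_divide norm_power norm_exp_eq_Re
    by (intro frac_le) (auto intro!: mult_pos_pos add_pos_pos)
  also have "\<dots> = (1 / \<kappa> ^ m) * (exp (Re s * x) / (1 + exp x))"
    by simp
  also have "\<dots> \<le> (1 / \<kappa> ^ m) * exp (- min (Re s) (1 - Re s) * \<bar>x\<bar>)"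
    using \<kappa> exp_ratio_bound[OF s, of x] by (intro mult_left_mono) auto
  finally show ?thesis
    by (simp add: \<kappa>_def)
qed

lemma exp_add_nonzero:
  assumes "Re c \<ge> 0"
  shows "of_real (exp x) + c \<noteq> (0 :: complex)"
proof
  assume "of_real (exp x) + c = 0"
  then have "Re (of_real (exp x) + c) = 0"
    by simp
  then show False
    using assms by (simp add: add_pos_nonneg less_imp_neq[symmetric])
qed

lemma beta_kernel_integrable:
  fixes c s :: complex
  assumes c: "Re c \<ge> 0" "c \<noteq> 0" and s: "0 < Re s" "Re s < 1" and m: "m \<ge> 1"
  shows "integrable lborel (\<lambda>x. exp (s * of_real x) / (of_real (exp x) + c) ^ m)"
proof (rule Bochner_Integration.integrable_bound)
  show "integrable lborel (\<lambda>x. (1 / (min 1 (norm c) / 2) ^ m) * exp (- min (Re s) (1 - Re s) * \<bar>x\<bar>))"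
    using s by (intro integrable_mult_right integrable_exp_neg_abs) auto
  show "AE x in lborel. norm (exp (s * of_real x) / (of_real (exp x) + c) ^ m) \<le>
      norm ((1 / (min 1 (norm c) / 2) ^ m) * exp (- min (Re s) (1 - Re s) * \<bar>x\<bar>))"
    using beta_kernel_bound[OF assms] c by (intro AE_I2) (simp add: abs_mult abs_divide power_abs)
qed measurable

lemma beta_kernel_tendsto_0:
  fixes c s :: complex
  assumes c: "Re c \<ge> 0" "c \<noteq> 0" and s: "0 < Re s" "Re s < 1" and m: "m \<ge> 1"
  shows "((\<lambda>x. exp (s * of_real x) / (of_real (exp x) + c) ^ m) \<longlongrightarrow> 0) at_top"
    "((\<lambda>x. exp (s * of_real x) / (of_real (exp x) + c) ^ m) \<longlongrightarrow> 0) at_bot"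
proof -
  define \<eta> where "\<eta> = min (Re s) (1 - Re s)"
  have \<eta>: "\<eta> > 0"
    using s by (simp add: \<eta>_def)
  have "((\<lambda>x. (1 / (min 1 (norm c) / 2) ^ m) * exp (- \<eta> * \<bar>x\<bar>)) \<longlongrightarrow> 0) at_top"
    "((\<lambda>x. (1 / (min 1 (norm c) / 2) ^ m) * exp (- \<eta> * \<bar>x\<bar>)) \<longlongrightarrow> 0) at_bot"
  proof -
    have *: "((\<lambda>x::real. exp (- \<eta> * x)) \<longlongrightarrow> 0) at_top"
      using \<eta> by real_asymp
    have 1: "((\<lambda>x. exp (- \<eta> * \<bar>x\<bar>)) \<longlongrightarrow> 0) at_top" "((\<lambda>x. exp (- \<eta> * \<bar>x\<bar>)) \<longlongrightarrow> 0) at_bot"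
      by (rule filterlim_compose[OF *]; real_asymp)+
    show "((\<lambda>x. (1 / (min 1 (norm c) / 2) ^ m) * exp (- \<eta> * \<bar>x\<bar>)) \<longlongrightarrow> 0) at_top"
      "((\<lambda>x. (1 / (min 1 (norm c) / 2) ^ m) * exp (- \<eta> * \<bar>x\<bar>)) \<longlongrightarrow> 0) at_bot"
      by (rule tendsto_mult_right_zero[OF 1(1)], rule tendsto_mult_right_zero[OF 1(2)])
  qed
  then show "((\<lambda>x. exp (s * of_real x) / (of_real (exp x) + c) ^ m) \<longlongrightarrow> 0) at_top"
    "((\<lambda>x. exp (s * of_real x) / (of_real (exp x) + c) ^ m) \<longlongrightarrow> 0) at_bot"
    using beta_kernel_bound[OF assms] unfolding \<eta>_def
    by (auto elim!: Lim_null_comparison[rotated])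
qed

text \<open>The derivative of exp (s x) / (exp x + c)^m integrates to 0 because the boundary values
  vanish; replacing exp x by (exp x + c) - c expresses it through the kernels of orders m and m +
  1.\<close>

lemma beta_kernel_step:
  fixes c s :: complex
  assumes c: "Re c \<ge> 0" "c \<noteq> 0" and s: "0 < Re s" "Re s < 1" and m: "m \<ge> 1"
  shows "of_nat m * c * (LBINT x. exp (s * of_real x) / (of_real (exp x) + c) ^ Suc m)
    = (of_nat m - s) * (LBINT x. exp (s * of_real x) / (of_real (exp x) + c) ^ m)"
proof -
  let ?K = "\<lambda>m x. exp (s * of_real x) / (of_real (exp x) + c) ^ m"
  define f where "f = (\<lambda>x::real. (s - of_nat m) * ?K m x + of_nat m * c * ?K (Suc m) x)"
  have int: "integrable lborel (?K m)" "integrable lborel (?K (Suc m))"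
    using m by (intro beta_kernel_integrable c s; simp)+
  then have intf: "integrable lborel f"
    unfolding f_def by (intro Bochner_Integration.integrable_add integrable_mult_right)
  have nz: "of_real (exp x) + c \<noteq> 0" for x
    by (rule exp_add_nonzero[OF c(1)])
  have "(LBINT x=-\<infinity>..\<infinity>. f x) = 0 - 0"
  proof (rule interval_integral_FTC_integrable)
    fix x :: real
    have "((\<lambda>z. exp (s * z) / (exp z + c) ^ m) has_field_derivative
        (s * exp (s * of_real x) * (exp (of_real x) + c) ^ m - exp (s * of_real x) *
          (of_nat m * (exp (of_real x) + c) ^ (m - 1) * exp (of_real x))) / ((exp (of_real x) + c) ^ m)\<^sup>2) (at (of_real x))"
      using nz[of x] by (auto intro!: derivative_eq_intros simp: power2_eq_square exp_of_real mult_ac)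
    also have "(s * exp (s * of_real x) * (exp (of_real x) + c) ^ m - exp (s * of_real x) *
          (of_nat m * (exp (of_real x) + c) ^ (m - 1) * exp (of_real x))) / ((exp (of_real x) + c) ^ m)\<^sup>2 = f x"
    proof -
      define w where "w = exp (complex_of_real x) + c"
      have w: "w \<noteq> 0" "of_real (exp x) + c = w"
        using nz[of x] by (simp_all add: w_def exp_of_real)
      obtain n where n: "m = Suc n"
        using m by (cases m) auto
      have ew: "exp (complex_of_real x) = w - c"
        by (simp add: w_def)
      show ?thesis
        unfolding f_def w(2) w_def[symmetric] n ew using w(1)
        by (simp add: power2_eq_square divide_simps) (simp add: algebra_simps)
    qed
    finally have "((\<lambda>z. exp (s * z) / (exp z + c) ^ m) has_field_derivative f x) (at (of_real x))" .
    from has_vector_derivative_real_field[OF this]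
    show "(?K m has_vector_derivative f x) (at x)"
      by (simp add: exp_of_real)
    show "isCont f x"
      unfolding f_def using nz by (intro continuous_intros) auto
  next
    show "set_integrable lborel (einterval (-\<infinity>) \<infinity>) f"
      using intf by (simp add: set_integrable_def)
    show "((?K m \<circ> real_of_ereal) \<longlongrightarrow> 0) (at_right (-\<infinity>))" "((?K m \<circ> real_of_ereal) \<longlongrightarrow> 0) (at_left \<infinity>)"
      using beta_kernel_tendsto_0[OF assms] by (simp_all add: ereal_tendsto_simps1)
  qed auto
  moreover have "(LBINT x=-\<infinity>..\<infinity>. f x) = (LBINT x. f x)"
    by (simp add: interval_lebesgue_integral_def set_lebesgue_integral_def)
  ultimately have "(LBINT x. f x) = 0"
    by simp
  have "(s - of_nat m) * (LBINT x. ?K m x) + of_nat m * c * (LBINT x. ?K (Suc m) x) = 0"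
  proof -
    have "(LBINT x. f x) = (LBINT x. (s - of_nat m) * ?K m x) + (LBINT x. of_nat m * c * ?K (Suc m) x)"
      unfolding f_def by (intro Bochner_Integration.integral_add integrable_mult_right int)
    with \<open>(LBINT x. f x) = 0\<close> show ?thesis
      by (simp only: integral_mult_right_zero)
  qed
  then show ?thesis
    by (simp add: algebra_simps)
qed

text \<open>Shifting x by 2 pi i multiplies the integrand by exp (2 pi i s), and between the two
  lines lies the single pole x = Ln c + i pi, so its residue determines the integral. The coordinate
  \<zeta> = i x makes the lines vertical, as \<open>strip_shift\<close> requires.\<close>

lemma beta_kernel_base:
  fixes c s :: complex
  assumes c: "Re c \<ge> 0" "c \<noteq> 0" and s: "0 < Re s" "Re s < 1"
  shows "(LBINT x. exp (s * of_real x) / (of_real (exp x) + c)) = c powr (s - 1) * Gamma s * Gamma (1 - s)"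
proof -
  define X0 where "X0 = Ln c + \<i> * of_real pi"
  define \<zeta>0 where "\<zeta>0 = \<i> * X0"
  define g where "g = (\<lambda>\<zeta>. exp (s * (- \<i> * \<zeta>)))"
  define h where "h = (\<lambda>\<zeta>. exp (- \<i> * \<zeta>) + c)"
  define f where "f = (\<lambda>\<zeta>. g \<zeta> / h \<zeta>)"
  define I where "I = (LBINT x. exp (s * of_real x) / (of_real (exp x) + c))"
  have int: "integrable lborel (\<lambda>x. exp (s * of_real x) / (of_real (exp x) + c))"
    using beta_kernel_integrable[OF c s, of 1] by simp
  have Im_Ln: "\<bar>Im (Ln c)\<bar> \<le> pi / 2"
    using c Re_Ln_pos_le[of c] by simp
  have exp_X0: "exp X0 = - c"
    using c by (simp add: X0_def exp_add exp_Ln)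
  have \<zeta>0: "Re \<zeta>0 = - Im (Ln c) - pi"
    by (simp add: \<zeta>0_def X0_def)
  have h\<zeta>0: "h \<zeta>0 = 0"
    using exp_X0 by (simp add: h_def \<zeta>0_def)
  \<comment> \<open>The other zeros differ from \<zeta>0 by nonzero multiples of 2 pi; as Im (Ln c)
    is at most pi/2 in absolute value, they stay outside even the widened strip.\<close>
  have zero: "\<zeta> = \<zeta>0" if "h \<zeta> = 0" "- 2 * pi - 1 < Re \<zeta>" "Re \<zeta> < 1" for \<zeta>
  proof -
    have "exp (- \<i> * \<zeta>) = exp X0"
      using that(1) exp_X0 by (simp add: h_def add_eq_0_iff)
    then obtain n :: int where n: "- \<i> * \<zeta> = X0 + (of_int (2 * n) * pi) * \<i>"
      unfolding exp_eq by auto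
    have "Im (- \<i> * \<zeta>) = Im X0 + 2 * of_int n * pi"
      by (subst n) simp
    then have re: "- Re \<zeta> = Im (Ln c) + pi + 2 * of_int n * pi"
      by (simp add: X0_def)
    have "n = 0"
    proof (rule ccontr)
      assume "n \<noteq> 0"
      then consider "n \<ge> 1" | "n \<le> -1"
        by linarith
      then show False
      proof cases
        case 1
        then have "2 * of_int n * pi \<ge> 2 * pi"
          by simp
        then show False
          using re that Im_Ln pi_gt3 by linarith
      next
        case 2
        then have "2 * of_int n * pi \<le> 2 * (-1) * pi"
          by (intro mult_right_mono) auto
        then show False
          using re that Im_Ln pi_gt3 by linarith
      qed
    qed
    then have "\<i> * (- \<i> * \<zeta>) = \<i> * X0"
      using n by simp
    then show ?thesis
      by (simp add: \<zeta>0_def)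
  qed
  have line0: "f (Complex 0 t) = exp (s * of_real t) / (of_real (exp t) + c)" for t
    by (simp add: f_def g_def h_def Complex_eq exp_of_real)
  have line2pi: "f (Complex (- 2 * pi) t) = exp (2 * pi * \<i> * s) * (exp (s * of_real t) / (of_real (exp t) + c))" for t
  proof -
    have eq: "- \<i> * Complex (- 2 * pi) t = of_real t + 2 * pi * \<i>"
      by (simp add: Complex_eq algebra_simps)
    have "exp (s * (of_real t + 2 * pi * \<i>)) = exp (2 * pi * \<i> * s) * exp (s * of_real t)"
      by (simp add: exp_add[symmetric] algebra_simps)
    moreover have "exp (of_real t + 2 * pi * \<i>) = of_real (exp t)"
      by (simp add: exp_add exp_of_real)
    ultimately show ?thesis
      unfolding f_def g_def h_def eq by simp
  qed
  \<comment> \<open>Beyond t0 one of exp t and norm c is at least twice the other, which keeps the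
    denominator away from 0.\<close>
  define t0 where "t0 = \<bar>ln (2 * norm c)\<bar> + \<bar>ln (norm c / 2)\<bar>"
  define C where "C = exp (2 * pi * \<bar>Im s\<bar>)"
  define B where "B = (\<lambda>T::real. C * (2 * exp ((Re s - 1) * T) + 2 / norm c * exp (- Re s * T)))"
  have holo: "f holomorphic_on {s. - 2 * pi - 1 < Re s \<and> Re s < 1} - {\<zeta>0}"
    unfolding f_def g_def h_def
    by (intro holomorphic_intros) (use zero in \<open>auto simp: h_def\<close>)
  have sub: "{\<zeta>0} \<subseteq> {s. - 2 * pi < Re s \<and> Re s < 0}"
    using Im_Ln \<zeta>0 pi_gt3 by auto
  have ints: "integrable lborel (\<lambda>t. f (Complex (- 2 * pi) t))" "integrable lborel (\<lambda>t. f (Complex 0 t))"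
    unfolding line0 line2pi by (rule integrable_mult_right[OF int], rule int)
  have B0: "(B \<longlongrightarrow> 0) at_top"
  proof -
    have "((\<lambda>T::real. exp ((Re s - 1) * T)) \<longlongrightarrow> 0) at_top" "((\<lambda>T::real. exp (- Re s * T)) \<longlongrightarrow> 0) at_top"
      using s by real_asymp+
    then have "(B \<longlongrightarrow> C * (2 * 0 + 2 / norm c * 0)) at_top"
      unfolding B_def by (intro tendsto_intros)
    then show ?thesis
      by simp
  qed
  have bound: "norm (f (Complex \<sigma> t)) \<le> B \<bar>t\<bar>" if \<sigma>: "\<sigma> \<in> {- 2 * pi..0}" and t: "\<bar>t\<bar> \<ge> t0" for \<sigma> t
  proof -
    have "norm (g (Complex \<sigma> t)) = exp (Re s * t + Im s * \<sigma>)"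
      by (simp add: g_def Complex_eq norm_exp_eq_Re algebra_simps)
    also have "Im s * \<sigma> \<le> 2 * pi * \<bar>Im s\<bar>"
    proof -
      have "Im s * \<sigma> \<le> \<bar>Im s\<bar> * \<bar>\<sigma>\<bar>"
        by (metis abs_ge_self abs_mult)
      also have "\<dots> \<le> \<bar>Im s\<bar> * (2 * pi)"
        using \<sigma> by (intro mult_left_mono) auto
      finally show ?thesis
        by (simp add: mult_ac)
    qed
    finally have g_le: "norm (g (Complex \<sigma> t)) \<le> C * exp (Re s * t)"
      by (simp add: C_def exp_add mult_ac)
    have e: "norm (exp (- \<i> * Complex \<sigma> t)) = exp t"
      by (simp add: Complex_eq norm_exp_eq_Re)
    have nc: "norm c > 0"
      using c by simp
    show "norm (f (Complex \<sigma> t)) \<le> B \<bar>t\<bar>"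
    proof (cases "t \<ge> 0")
      case True
      have "ln (2 * norm c) \<le> t"
        using t True by (simp add: t0_def)
      then have "2 * norm c \<le> exp t"
        using nc by (metis exp_le_cancel_iff exp_ln mult_pos_pos zero_less_numeral)
      then have h_ge: "norm (h (Complex \<sigma> t)) \<ge> exp t / 2"
        using norm_triangle_ineq4[of "h (Complex \<sigma> t)" c] e by (simp add: h_def)
      have "norm (f (Complex \<sigma> t)) \<le> C * exp (Re s * t) / (exp t / 2)"
        unfolding f_def norm_divide using g_le h_ge by (intro frac_le) (auto simp: C_def)
      also have "\<dots> = C * (2 * exp ((Re s - 1) * \<bar>t\<bar>))"
        using True by (simp add: left_diff_distrib exp_diff)
      also have "\<dots> \<le> B \<bar>t\<bar>"
        unfolding B_def by (intro mult_left_mono) (auto simp: C_def)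
      finally show ?thesis .
    next
      case False
      have "t \<le> ln (norm c / 2)"
        using t False by (simp add: t0_def)
      then have "exp t \<le> norm c / 2"
        using nc by (metis exp_le_cancel_iff exp_ln half_gt_zero)
      then have h_ge: "norm (h (Complex \<sigma> t)) \<ge> norm c / 2"
        using norm_triangle_ineq4[of "h (Complex \<sigma> t)" "exp (- \<i> * Complex \<sigma> t)"] e by (simp add: h_def)
      have "norm (f (Complex \<sigma> t)) \<le> C * exp (Re s * t) / (norm c / 2)"
        unfolding f_def norm_divide using g_le h_ge nc by (intro frac_le) (auto simp: C_def)
      also have "\<dots> = C * (2 / norm c * exp (- Re s * \<bar>t\<bar>))"
        using False by simp
      also have "\<dots> \<le> B \<bar>t\<bar>"
        unfolding B_def by (intro mult_left_mono) (auto simp: C_def)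
      finally show ?thesis .
    qed
  qed
  have "(LBINT t. f (Complex 0 t)) - (LBINT t. f (Complex (- 2 * pi) t)) = 2 * pi * (\<Sum>\<zeta>\<in>{\<zeta>0}. residue f \<zeta>)"
    by (rule strip_shift[OF _ _ _ holo _ sub ints bound B0]) auto
  also have "(\<Sum>\<zeta>\<in>{\<zeta>0}. residue f \<zeta>) = g \<zeta>0 / (\<i> * c)"
  proof -
    have "residue (\<lambda>\<zeta>. g \<zeta> / h \<zeta>) \<zeta>0 = g \<zeta>0 / (\<i> * c)"
    proof (rule residue_simple_pole_deriv[where s = UNIV])
      show "g holomorphic_on UNIV" "h holomorphic_on UNIV"
        unfolding g_def h_def by (intro holomorphic_intros)+
      have "(h has_field_derivative - \<i> * exp (- \<i> * \<zeta>0)) (at \<zeta>0)"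
        unfolding h_def by (auto intro!: derivative_eq_intros)
      then show "(h has_field_derivative \<i> * c) (at \<zeta>0)"
        using exp_X0 by (simp add: \<zeta>0_def)
    qed (use c h\<zeta>0 in \<open>auto simp: g_def\<close>)
    then show ?thesis
      by (simp add: f_def[abs_def])
  qed
  also have "(LBINT t. f (Complex 0 t)) = I"
    by (simp add: line0 I_def)
  also have "(LBINT t. f (Complex (- 2 * pi) t)) = exp (2 * pi * \<i> * s) * I"
    unfolding line2pi I_def by (rule integral_mult_right_zero)
  also have "g \<zeta>0 = c powr s * exp (\<i> * pi * s)"
    using c by (simp add: g_def \<zeta>0_def X0_def powr_def exp_add ring_distribs mult_ac)
  finally have *: "(1 - exp (2 * pi * \<i> * s)) * I = 2 * pi * (c powr s * exp (\<i> * pi * s)) / (\<i> * c)"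
    by (simp add: algebra_simps)
  define E where "E = exp (\<i> * pi * s)"
  have E0: "E \<noteq> 0"
    by (simp add: E_def)
  have EE: "exp (2 * pi * \<i> * s) = E * E"
    unfolding E_def by (simp add: exp_add[symmetric] algebra_simps)
  have sin: "sin (of_real pi * s) = (E - 1 / E) / (2 * \<i>)"
    by (simp add: sin_exp_eq E_def exp_minus mult_ac inverse_eq_divide)
  have nonint: "s \<notin> \<int>"
  proof
    assume "s \<in> \<int>"
    then obtain n where "s = of_int n"
      by (auto elim: Ints_cases)
    then show False
      using s by auto
  qed
  have "sin (of_real pi * s) \<noteq> 0"
    using nonint by (auto simp: sin_eq_0 mult.commute)
  moreover have EES: "1 - E * E = - (2 * \<i> * E * sin (of_real pi * s))"
  proof -
    have "2 * \<i> * sin (of_real pi * s) = E - 1 / E"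
      unfolding sin by simp
    then have "E * (2 * \<i> * sin (of_real pi * s)) = E * (E - 1 / E)"
      by simp
    also have "\<dots> = E * E - 1"
      using E0 by (simp add: right_diff_distrib)
    finally show ?thesis
      by (simp add: mult_ac)
  qed
  ultimately have E1: "1 - E * E \<noteq> 0"
    using E0 by simp
  have "I = 2 * pi * (c powr s * E) / (\<i> * c) / (1 - E * E)"
  proof -
    have "I * (1 - E * E) = 2 * pi * (c powr s * E) / (\<i> * c)"
      using * unfolding EE E_def[symmetric] by (simp only: mult.commute)
    then show ?thesis
      by (rule nonzero_eq_divide_eq[OF E1, THEN iffD2])
  qed
  also have "\<dots> = c powr s / c * (of_real pi / sin (of_real pi * s))"
  proof -
    have "\<i> * (c * (\<i> * sin (of_real pi * s))) = - (c * sin (of_real pi * s))"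
      by (simp add: algebra_simps)
    then show ?thesis
      unfolding EES using E0 by (simp add: mult.commute[of "of_real pi"])
  qed
  also have "\<dots> = c powr (s - 1) * (Gamma s * Gamma (1 - s))"
    using c by (simp add: powr_diff Gamma_reflection_complex)
  finally show ?thesis
    by (simp add: I_def)
qed

lemma beta_kernel_integral:
  fixes c s :: complex
  assumes c: "Re c \<ge> 0" "c \<noteq> 0" and s: "0 < Re s" "Re s < 1"
  shows "(LBINT x. exp (s * of_real x) / (of_real (exp x) + c) ^ Suc n)
    = c powr (s - of_nat (Suc n)) * Gamma s * Gamma (of_nat (Suc n) - s) / fact n"
proof (induction n)
  case 0
  then show ?case
    using beta_kernel_base[OF assms] by simp
next
  case (Suc n)
  define G where "G = c powr (s - of_nat (Suc n)) * Gamma s * Gamma (of_nat (Suc n) - s) / fact n"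
  define J where "J = (LBINT x. exp (s * of_real x) / (of_real (exp x) + c) ^ Suc (Suc n))"
  have "of_nat (Suc n) * c * J = (of_nat (Suc n) - s) * G"
    using beta_kernel_step[OF assms, of "Suc n"] Suc.IH unfolding J_def G_def by simp
  then have "J = (of_nat (Suc n) - s) * G / (of_nat (Suc n) * c)"
    using c by (metis mult_eq_0_iff nonzero_mult_div_cancel_left of_nat_eq_0_iff old.nat.distinct(2))
  also have "\<dots> = c powr (s - of_nat (Suc n)) / c * Gamma s * ((of_nat (Suc n) - s) * Gamma (of_nat (Suc n) - s)) / fact (Suc n)"
    unfolding G_def by (simp add: divide_simps)
  also have "(of_nat (Suc n) - s) * Gamma (of_nat (Suc n) - s) = Gamma (of_nat (Suc (Suc n)) - s)"
  proof -
    have "of_nat (Suc n) - s \<notin> \<int>\<^sub>\<le>\<^sub>0"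
      using s by (auto elim!: nonpos_Ints_cases simp: complex_eq_iff)
    then show ?thesis
      using Gamma_plus1[of "of_nat (Suc n) - s"] by (simp add: algebra_simps)
  qed
  also have "c powr (s - of_nat (Suc n)) / c = c powr (s - of_nat (Suc (Suc n)))"
    using c powr_diff[of c "s - of_nat (Suc n)" 1] by (simp add: algebra_simps)
  finally show ?case
    by (simp add: J_def)
qed

section \<open>Terminating hypergeometric series and the poles of the period function\<close>

text \<open>The upper parameter - n makes the series a polynomial, so the evaluation is valid for
  every x.\<close>

lemma hypergeo_2F1_terminating:
  "hypergeo_2F1 b (- of_nat n) c x =
     (\<Sum>j\<le>n. pochhammer b j * pochhammer (- of_nat n) j / (pochhammer c j * fact j) * x ^ j)"
proof -
  have "hypergeo_2F1 b (- of_nat n) c x =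
      (\<Sum>j. pochhammer b j * pochhammer (- of_nat n) j / (pochhammer c j * fact j) * x ^ j)"
    by (simp add: hypergeo_2F1_def eval_fps_def)
  also have "\<dots> = (\<Sum>j\<le>n. pochhammer b j * pochhammer (- of_nat n) j / (pochhammer c j * fact j) * x ^ j)"
    by (intro suminf_finite) (auto simp: pochhammer_of_nat_eq_0_lemma)
  finally show ?thesis .
qed

lemma pochhammer_nonzero_nonint:
  assumes "(c :: complex) \<notin> \<int>"
  shows "pochhammer c j \<noteq> 0"
proof
  assume "pochhammer c j = 0"
  then obtain i where "c = - of_nat i"
    by (auto simp: pochhammer_eq_0_iff)
  then have "c \<in> \<int>"
    by simp
  with assms show False
    by simp
qed

text \<open>Expanding x^j = (1 - (1 - x))^j and collecting powers of 1 - x leaves inner sums that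
  the Chu-Vandermonde identity evaluates. Since c is not an integer while b is, no lower Pochhammer
  symbol vanishes.\<close>

lemma hypergeo_2F1_reflect:
  fixes c x :: complex
  assumes c: "c \<notin> \<int>" and b: "b \<in> \<int>"
  shows "hypergeo_2F1 b (- of_nat n) c x =
    pochhammer (c - b) n / pochhammer c n * hypergeo_2F1 b (- of_nat n) (b - of_nat n - c + 1) (1 - x)"
proof -
  let ?P = "\<lambda>a j. pochhammer (a::complex) j"
  have c': "b - of_nat n - c + 1 \<notin> \<int>"
  proof
    assume "b - of_nat n - c + 1 \<in> \<int>"
    then have "b - of_nat n + 1 - (b - of_nat n - c + 1) \<in> \<int>"
      using b by (intro Ints_diff Ints_add) auto
    then show False
      using c by simp
  qed
  define T where "T = (\<lambda>j. ?P b j * ?P (- of_nat n) j / (?P c j * fact j))"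
  have "hypergeo_2F1 b (- of_nat n) c x = (\<Sum>j\<le>n. T j * x ^ j)"
    by (simp add: hypergeo_2F1_terminating T_def)
  also have "\<dots> = (\<Sum>j\<le>n. \<Sum>i\<le>j. T j * (of_nat (j choose i) * (-1) ^ i * (1 - x) ^ i))"
  proof (rule sum.cong[OF refl])
    fix j
    have "x ^ j = (- (1 - x) + 1) ^ j"
      by simp
    also have "\<dots> = (\<Sum>i\<le>j. of_nat (j choose i) * (- (1 - x)) ^ i * 1 ^ (j - i))"
      by (rule binomial_ring)
    also have "\<dots> = (\<Sum>i\<le>j. of_nat (j choose i) * (-1) ^ i * (1 - x) ^ i)"
      by (intro sum.cong refl) (simp only: power_minus[of "1 - x"] power_one mult_1_right mult.assoc)
    finally show "T j * x ^ j = (\<Sum>i\<le>j. T j * (of_nat (j choose i) * (-1) ^ i * (1 - x) ^ i))"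
      by (simp add: sum_distrib_left)
  qed
  also have "\<dots> = (\<Sum>i\<le>n. \<Sum>j\<in>{i..n}. T j * (of_nat (j choose i) * (-1) ^ i * (1 - x) ^ i))"
    by (subst sum.Sigma, simp, simp, subst sum.Sigma, simp, simp,
        rule sum.reindex_bij_witness[of _ "\<lambda>(i, j). (j, i)" "\<lambda>(i, j). (j, i)"]) auto
  also have "\<dots> = (\<Sum>i\<le>n. ?P (c - b) n / ?P c n *
      (?P b i * ?P (- of_nat n) i / (?P (b - of_nat n - c + 1) i * fact i) * (1 - x) ^ i))"
  proof (rule sum.cong[OF refl])
    fix i assume "i \<in> {..n}"
    then have i: "i \<le> n"
      by simp
    have "(\<Sum>j\<in>{i..n}. T j * (of_nat (j choose i) * (-1) ^ i * (1 - x) ^ i))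
        = (\<Sum>m\<in>{0..n - i}. T (m + i) * (of_nat ((m + i) choose i) * (-1) ^ i * (1 - x) ^ i))"
      using i sum.shift_bounds_cl_nat_ivl[of "\<lambda>j. T j * (of_nat (j choose i) * (-1) ^ i * (1 - x) ^ i)" 0 i "n - i"]
      by simp
    also have "\<dots> = (\<Sum>m\<in>{0..n - i}. ((-1) ^ i * (1 - x) ^ i * ?P b i * ?P (- of_nat n) i / (?P c i * fact i)) *
        (?P (b + of_nat i) m * ?P (- of_nat (n - i)) m / (of_nat (fact m) * ?P (c + of_nat i) m)))"
    proof (rule sum.cong[OF refl])
      fix m
      have "of_nat ((m + i) choose i) / (fact (m + i) :: complex) = 1 / (fact i * fact m)"
        by (subst binomial_fact) (simp_all add: field_simps)
      then have ch: "of_nat ((m + i) choose i) = (fact (m + i) :: complex) / (fact i * fact m)"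
        by (simp add: field_simps)
      have "- of_nat n + of_nat i = - (of_nat (n - i) :: complex)"
        using i by (simp add: of_nat_diff)
      then have p: "?P b (m + i) = ?P b i * ?P (b + of_nat i) m"
        "?P c (m + i) = ?P c i * ?P (c + of_nat i) m"
        "?P (- of_nat n) (m + i) = ?P (- of_nat n) i * ?P (- of_nat (n - i)) m"
        by (simp_all add: add.commute[of m i] pochhammer_product' del: of_nat_diff)
      show "T (m + i) * (of_nat ((m + i) choose i) * (-1) ^ i * (1 - x) ^ i)
        = ((-1) ^ i * (1 - x) ^ i * ?P b i * ?P (- of_nat n) i / (?P c i * fact i)) *
        (?P (b + of_nat i) m * ?P (- of_nat (n - i)) m / (of_nat (fact m) * ?P (c + of_nat i) m))"
        unfolding T_def p ch by (simp add: mult_ac)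
    qed
    also have "\<dots> = ((-1) ^ i * (1 - x) ^ i * ?P b i * ?P (- of_nat n) i / (?P c i * fact i)) *
        (\<Sum>m\<in>{0..n - i}. ?P (b + of_nat i) m * ?P (- of_nat (n - i)) m / (of_nat (fact m) * ?P (c + of_nat i) m))"
      by (simp add: sum_distrib_left)
    also have "(\<Sum>m\<in>{0..n - i}. ?P (b + of_nat i) m * ?P (- of_nat (n - i)) m / (of_nat (fact m) * ?P (c + of_nat i) m))
        = ?P (c + of_nat i - (b + of_nat i)) (n - i) / ?P (c + of_nat i) (n - i)"
    proof (rule Vandermonde_pochhammer, rule ballI)
      fix l
      have "c \<noteq> - of_nat l - of_nat i"
        using c by (metis Ints_diff Ints_minus Ints_of_nat)
      then show "c + of_nat i \<noteq> - of_nat l"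
        by (simp add: algebra_simps add_eq_0_iff2)
    qed
    \<comment> \<open>The last i factors of (c - b)_n, read backwards, are up to sign the factors of
      (b - n - c + 1)_i.\<close>
    also have "?P (c + of_nat i - (b + of_nat i)) (n - i) = (-1) ^ i * ?P (c - b) n / ?P (b - of_nat n - c + 1) i"
    proof -
      have "?P (c - b) n = ?P (c - b) (n - i) * ?P (c - b + of_nat (n - i)) i"
        using pochhammer_product[of "n - i" n "c - b"] i by simp
      also have "c - b + of_nat (n - i) = (c - b + of_nat n - 1) - of_nat i + 1"
        using i by (simp add: of_nat_diff)
      also have "?P ((c - b + of_nat n - 1) - of_nat i + 1) i = (-1) ^ i * ?P (- (c - b + of_nat n - 1)) i"
        by (rule pochhammer_minus')
      also have "- (c - b + of_nat n - 1) = b - of_nat n - c + 1"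
        by simp
      finally have "?P (c - b) n = ?P (c - b) (n - i) * ((-1) ^ i * ?P (b - of_nat n - c + 1) i)" .
      then show ?thesis
        using pochhammer_nonzero_nonint[OF c', of i] by (simp add: field_simps flip: power_add)
    qed
    also have "?P (c + of_nat i) (n - i) = ?P c n / ?P c i"
      using pochhammer_product[OF i, of c] pochhammer_nonzero_nonint[OF c, of i] by simp
    finally show "(\<Sum>j\<in>{i..n}. T j * (of_nat (j choose i) * (-1) ^ i * (1 - x) ^ i)) = ?P (c - b) n / ?P c n *
      (?P b i * ?P (- of_nat n) i / (?P (b - of_nat n - c + 1) i * fact i) * (1 - x) ^ i)"
      using pochhammer_nonzero_nonint[OF c, of i] by (simp add: field_simps flip: power_add)
  qed
  finally show ?thesis
    by (simp add: hypergeo_2F1_terminating sum_distrib_left)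
qed

text \<open>The lower Pochhammer symbol (s - k + 1)_j cancels against factors of \<Gamma>(k - s) and
  leaves \<Gamma>(k - j - s), the Gamma factor of the beta integral of order k - j. In this form the
  series matches the partial fractions of the pole kernel term by term.\<close>

lemma Beta_hypergeo_2F1_expand:
  fixes s x :: complex
  assumes s: "s \<notin> \<int>" and k: "k = Suc n"
  shows "Beta s (of_nat k - s) * hypergeo_2F1 (of_nat k) (- of_nat n) (s - of_nat k + 1) x
    = (\<Sum>j\<le>n. of_nat ((n + j) choose j) / fact (n - j) * (Gamma s * Gamma (of_nat (k - j) - s)) * x ^ j)"
  unfolding hypergeo_2F1_terminating sum_distrib_left
proof (rule sum.cong[OF refl])
  fix j assume "j \<in> {..n}"
  then have j: "j \<le> n"
    by simp
  have nonint: "of_nat (k - j) - s \<notin> \<int>"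
  proof
    assume "of_nat (k - j) - s \<in> \<int>"
    from Ints_diff[OF Ints_of_nat[of "k - j"] this] show False
      using s by simp
  qed
  then have npI: "of_nat (k - j) - s \<notin> \<int>\<^sub>\<le>\<^sub>0"
    using nonpos_Ints_Int by blast
  have "pochhammer (of_nat (k - j) - s) j = Gamma (of_nat (k - j) - s + of_nat j) / Gamma (of_nat (k - j) - s)"
    by (rule pochhammer_Gamma[OF npI])
  also have "of_nat (k - j) - s + of_nat j = of_nat k - s"
    using j k by (simp add: of_nat_diff)
  finally have G: "Gamma (of_nat k - s) = pochhammer (of_nat (k - j) - s) j * Gamma (of_nat (k - j) - s)"
    using npI by (simp add: Gamma_eq_zero_iff field_simps)
  have p1: "pochhammer (s - of_nat k + 1) j = (-1) ^ j * pochhammer (of_nat (k - j) - s) j"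
    using pochhammer_minus[of "of_nat k - s - 1" j] j k by (simp add: of_nat_diff algebra_simps)
  have p2: "pochhammer (- of_nat n) j = (-1) ^ j * (fact n / fact (n - j) :: complex)"
  proof -
    have "pochhammer (- of_nat n) j = (-1) ^ j * (pochhammer (of_nat (n - j) + 1) j :: complex)"
      using pochhammer_minus[of "of_nat n :: complex" j] j by (simp add: of_nat_diff algebra_simps)
    also have "(pochhammer (of_nat (n - j) + 1) j :: complex) = fact n / fact (n - j)"
    proof -
      have "(pochhammer 1 n :: complex) = pochhammer 1 (n - j) * pochhammer (1 + of_nat (n - j)) j"
        using pochhammer_product[of "n - j" n "1 :: complex"] j by simp
      then show ?thesis
        by (simp add: pochhammer_fact[symmetric] add.commute field_simps)
    qed
    finally show ?thesis .
  qed
  have p3: "(pochhammer (of_nat k) j :: complex) / fact j = of_nat ((n + j) choose j)"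
  proof -
    have "(pochhammer 1 (n + j) :: complex) = pochhammer 1 n * pochhammer (1 + of_nat n) j"
      by (rule pochhammer_product')
    then have "(pochhammer (of_nat k) j :: complex) = fact (n + j) / fact n"
      by (simp add: pochhammer_fact[symmetric] k add.commute field_simps)
    then show ?thesis
      by (subst binomial_fact) (simp_all add: field_simps)
  qed
  have nz: "pochhammer (of_nat (k - j) - s) j \<noteq> 0"
    by (rule pochhammer_nonzero_nonint[OF nonint])
  have B: "Beta s (of_nat k - s) = Gamma s * Gamma (of_nat k - s) / fact n"
    using Gamma_fact[of n, where ?'a = complex] by (simp add: Beta_def k)
  have "Beta s (of_nat k - s) *
      (pochhammer (of_nat k) j * pochhammer (- of_nat n) j / (pochhammer (s - of_nat k + 1) j * fact j) * x ^ j)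
    = Beta s (of_nat k - s) *
      ((pochhammer (of_nat k) j / fact j) * pochhammer (- of_nat n) j / pochhammer (s - of_nat k + 1) j * x ^ j)"
    by simp
  also have "\<dots> = of_nat ((n + j) choose j) / fact (n - j) * (Gamma s * Gamma (of_nat (k - j) - s)) * x ^ j"
    unfolding p3 B G p1 p2 using nz by (simp add: field_simps)
  finally show "Beta s (of_nat k - s) *
      (pochhammer (of_nat k) j * pochhammer (- of_nat n) j / (pochhammer (s - of_nat k + 1) j * fact j) * x ^ j)
    = of_nat ((n + j) choose j) / fact (n - j) * (Gamma s * Gamma (of_nat (k - j) - s)) * x ^ j" .
qed

text \<open>\<open>hypergeo_2F1_reflect\<close> moves the argument to 1 - x and the lower parameter
  to s - k + 1; Euler's reflection formula for \<Gamma>(s - k) \<Gamma>(k - s + 1) supplies the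
  sign. Both halves of the right-hand side of the functional equation then involve one and the same
  function.\<close>

lemma Beta_hypergeo_2F1_reflect:
  fixes s x :: complex
  assumes s: "s \<notin> \<int>" and k: "k = Suc n"
  shows "Beta (2 * of_nat k - s) (s - of_nat k) * hypergeo_2F1 (of_nat k) (- of_nat n) (of_nat k - s + 1) x
    = (-1) ^ k * (Beta s (of_nat k - s) * hypergeo_2F1 (of_nat k) (- of_nat n) (s - of_nat k + 1) (1 - x))"
proof -
  have nonint: "of_int m - s \<notin> \<int>" for m
  proof
    assume "of_int m - s \<in> \<int>"
    from Ints_diff[OF Ints_of_int[of m] this] show False
      using s by simp
  qed
  have c: "of_nat k - s + 1 \<notin> \<int>"
    using nonint[of "int k + 1"] by (simp add: algebra_simps)
  have 1: "1 - s \<notin> \<int>"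
    using nonint[of 1] by simp
  have eq: "hypergeo_2F1 (of_nat k) (- of_nat n) (of_nat k - s + 1) x
    = pochhammer (1 - s) n / pochhammer (of_nat k - s + 1) n *
        hypergeo_2F1 (of_nat k) (- of_nat n) (s - of_nat k + 1) (1 - x)"
    using hypergeo_2F1_reflect[OF c, of "of_nat k" n x] by (simp add: k algebra_simps)
  have np: "z \<notin> \<int>\<^sub>\<le>\<^sub>0" if "z \<notin> \<int>" for z :: complex
    using that by (auto elim!: nonpos_Ints_cases)
  have G1: "Gamma (2 * of_nat k - s) = pochhammer (of_nat k - s + 1) n * Gamma (of_nat k - s + 1)"
  proof -
    have "pochhammer (of_nat k - s + 1) n = Gamma (of_nat k - s + 1 + of_nat n) / Gamma (of_nat k - s + 1)"
      by (rule pochhammer_Gamma[OF np[OF c]])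
    also have "of_nat k - s + 1 + of_nat n = 2 * of_nat k - s"
      by (simp add: k)
    finally show ?thesis
      using np[OF c] by (simp add: Gamma_eq_zero_iff field_simps)
  qed
  have G2: "Gamma (of_nat k - s) = pochhammer (1 - s) n * Gamma (1 - s)"
  proof -
    have "pochhammer (1 - s) n = Gamma (1 - s + of_nat n) / Gamma (1 - s)"
      by (rule pochhammer_Gamma[OF np[OF 1]])
    also have "1 - s + of_nat n = of_nat k - s"
      by (simp add: k)
    finally show ?thesis
      using np[OF 1] by (simp add: Gamma_eq_zero_iff field_simps)
  qed
  have refl: "Gamma (s - of_nat k) * Gamma (of_nat k - s + 1) = (-1) ^ k * (Gamma s * Gamma (1 - s))"
  proof -
    have "Gamma (s - of_nat k) * Gamma (1 - (s - of_nat k)) = of_real pi / sin (of_real pi * (s - of_nat k))"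
      by (rule Gamma_reflection_complex)
    also have "sin (of_real pi * (s - of_nat k)) = (-1) ^ k * sin (of_real pi * s)"
    proof (induction k)
      case (Suc k)
      have "sin (of_real pi * (s - of_nat (Suc k))) = sin (of_real pi * (s - of_nat k) - of_real pi)"
        by (simp add: algebra_simps)
      also have "\<dots> = - sin (of_real pi * (s - of_nat k))"
        by (simp add: sin_diff flip: sin_of_real cos_of_real)
      finally show ?case
        using Suc by simp
    qed simp
    also have "of_real pi / ((-1) ^ k * sin (of_real pi * s)) = (-1) ^ k * (of_real pi / sin (of_real pi * s))"
      by (cases "even k") simp_all
    finally show ?thesis
      by (simp add: Gamma_reflection_complex algebra_simps)
  qed
  have nz: "pochhammer (of_nat k - s + 1) n \<noteq> 0"
    by (rule pochhammer_nonzero_nonint[OF c])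
  define X where "X = hypergeo_2F1 (of_nat k) (- of_nat n) (s - of_nat k + 1) (1 - x)"
  have "Beta (2 * of_nat k - s) (s - of_nat k) * (pochhammer (1 - s) n / pochhammer (of_nat k - s + 1) n * X)
    = (pochhammer (1 - s) n * (Gamma (s - of_nat k) * Gamma (of_nat k - s + 1))) / Gamma (of_nat k) * X"
    using nz by (simp add: Beta_def G1)
  also have "\<dots> = (-1) ^ k * (Beta s (of_nat k - s) * X)"
    unfolding refl Beta_def G2 by simp
  finally show ?thesis
    unfolding eq X_def[symmetric] .
qed

text \<open>For probabilities p and q, the j-th term is the chance that one of two outcomes occurs
  for the (n + 1)-st time after exactly j occurrences of the other; one of them must win.
  Algebraically, each of the two sums is one half of the binomial expansion of (p + q)^(2n +
  1).\<close>

lemma complementary_power_sum: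
  fixes p q :: complex
  assumes "p + q = 1"
  shows "(\<Sum>j\<le>n. of_nat ((n + j) choose j) * (p ^ j * q ^ Suc n + q ^ j * p ^ Suc n)) = 1"
proof -
  have half: "(\<Sum>j\<le>n. of_nat ((n + j) choose j) * (x ^ j * y ^ Suc n)) =
      (\<Sum>j\<le>n. of_nat ((2 * n + 1) choose j) * x ^ j * y ^ (2 * n + 1 - j))" if xy: "x + y = 1" for x y :: complex
  proof -
    have "(\<Sum>j\<le>n. (of_nat n + of_nat (Suc n) gchoose j) * x ^ j * y ^ (n - j))
        = (\<Sum>j\<le>n. (of_nat j + of_nat (Suc n) - 1 gchoose j) * x ^ j)"
      using gbinomial_partial_sum_poly_xpos[of n "of_nat (Suc n)" x y] by (simp only: xy power_one mult_1_right)
    also have "\<dots> = (\<Sum>j\<le>n. of_nat ((n + j) choose j) * x ^ j)"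
    proof (rule sum.cong[OF refl])
      fix j
      have "of_nat j + of_nat (Suc n) - 1 = (of_nat (n + j) :: complex)"
        by simp
      then show "(of_nat j + of_nat (Suc n) - 1 gchoose j) * x ^ j = of_nat ((n + j) choose j) * x ^ j"
        by (simp only: binomial_gbinomial)
    qed
    finally have "(\<Sum>j\<le>n. of_nat ((n + j) choose j) * x ^ j) * y ^ Suc n
        = (\<Sum>j\<le>n. (of_nat n + of_nat (Suc n) gchoose j) * x ^ j * y ^ (n - j)) * y ^ Suc n"
      by simp
    also have "\<dots> = (\<Sum>j\<le>n. of_nat ((2 * n + 1) choose j) * x ^ j * y ^ (2 * n + 1 - j))"
      unfolding sum_distrib_right
    proof (rule sum.cong[OF refl])
      fix j assume "j \<in> {..n}"
      then have "2 * n + 1 - j = (n - j) + Suc n"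
        by simp
      then have "y ^ (2 * n + 1 - j) = y ^ (n - j) * y ^ Suc n"
        by (simp only: power_add)
      moreover have "of_nat n + of_nat (Suc n) = (of_nat (2 * n + 1) :: complex)"
        by simp
      ultimately show "(of_nat n + of_nat (Suc n) gchoose j) * x ^ j * y ^ (n - j) * y ^ Suc n
          = of_nat ((2 * n + 1) choose j) * x ^ j * y ^ (2 * n + 1 - j)"
        by (simp only: binomial_gbinomial mult.assoc)
    qed
    finally show ?thesis
      by (simp add: sum_distrib_right mult.assoc)
  qed
  let ?g = "\<lambda>j. of_nat ((2 * n + 1) choose j) * p ^ j * q ^ (2 * n + 1 - j)"
  have "(\<Sum>j\<le>n. of_nat ((n + j) choose j) * (p ^ j * q ^ Suc n + q ^ j * p ^ Suc n))
     = (\<Sum>j\<le>n. of_nat ((n + j) choose j) * (p ^ j * q ^ Suc n)) +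
       (\<Sum>j\<le>n. of_nat ((n + j) choose j) * (q ^ j * p ^ Suc n))"
    by (simp add: ring_distribs sum.distrib)
  also have "\<dots> = (\<Sum>j\<le>n. ?g j) + (\<Sum>j\<le>n. of_nat ((2 * n + 1) choose j) * q ^ j * p ^ (2 * n + 1 - j))"
    using half[of p q] half[of q p] assms by (simp add: add.commute)
  also have "(\<Sum>j\<le>n. of_nat ((2 * n + 1) choose j) * q ^ j * p ^ (2 * n + 1 - j)) = (\<Sum>j\<in>{Suc n..2 * n + 1}. ?g j)"
    by (rule sum.reindex_bij_witness[of _ "\<lambda>j. 2 * n + 1 - j" "\<lambda>j. 2 * n + 1 - j"])
       (auto simp: mult_ac binomial_symmetric[symmetric])
  also have "(\<Sum>j\<le>n. ?g j) + (\<Sum>j\<in>{Suc n..2 * n + 1}. ?g j) = (\<Sum>j\<le>2 * n + 1. ?g j)"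
  proof -
    have "{..2 * n + 1} = {..n} \<union> {Suc n..2 * n + 1}"
      by auto
    then show ?thesis
      by (simp only:) (rule sum.union_disjoint[symmetric], auto)
  qed
  also have "\<dots> = (p + q) ^ (2 * n + 1)"
    by (rule binomial_ring[symmetric])
  finally show ?thesis
    by (simp add: assms)
qed


section \<open>Partial fractions and Mellin transform of the pole terms\<close>

definition pole_kernel :: "nat \<Rightarrow> real \<Rightarrow> real \<Rightarrow> complex \<Rightarrow> complex" where
  "pole_kernel k \<alpha> \<beta> z = of_real (\<alpha> - \<beta>) ^ k / ((z - of_real \<alpha>) ^ k * (z - of_real \<beta>) ^ k)"

text \<open>With A = \<alpha> - z, B = z - \<beta> and \<Delta> = A + B, multiply \<Delta>^k / (A^k
  B^k) by the complementary power sum at A / \<Delta> and B / \<Delta>: each product cancels one of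
  the two denominators. The orientation of A and B gives both a positive real part on the imaginary
  axis when \<alpha> > 0 > \<beta>.\<close>

lemma pole_kernel_partial_fractions:
  fixes \<alpha> \<beta> :: real and z :: complex
  assumes ab: "\<alpha> \<noteq> \<beta>" and z: "z \<noteq> of_real \<alpha>" "z \<noteq> of_real \<beta>" and k: "k = Suc n"
  shows "pole_kernel k \<alpha> \<beta> z = (-1) ^ k * (\<Sum>j\<le>n. of_nat ((n + j) choose j) *
    (1 / of_real (\<alpha> - \<beta>) ^ j * (1 / (of_real \<alpha> - z) ^ (k - j) + 1 / (z - of_real \<beta>) ^ (k - j))))"
proof -
  define \<Delta> where "\<Delta> = complex_of_real (\<alpha> - \<beta>)"
  define A B where "A = of_real \<alpha> - z" and "B = z - of_real \<beta>"
  have nz: "\<Delta> \<noteq> 0" "A \<noteq> 0" "B \<noteq> 0"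
    using assms by (auto simp: \<Delta>_def A_def B_def)
  have "A / \<Delta> + B / \<Delta> = 1"
    using nz by (simp add: add_divide_distrib[symmetric]) (simp add: A_def B_def \<Delta>_def)
  then have one: "(\<Sum>j\<le>n. of_nat ((n + j) choose j) * ((A / \<Delta>) ^ j * (B / \<Delta>) ^ k + (B / \<Delta>) ^ j * (A / \<Delta>) ^ k)) = 1"
    unfolding k by (rule complementary_power_sum)
  have m1: "(z - of_real \<alpha>) ^ k = (-1) ^ k * A ^ k"
    by (simp add: A_def flip: power_mult_distrib)
  have "pole_kernel k \<alpha> \<beta> z = (-1) ^ k * (\<Delta> ^ k / (A ^ k * B ^ k))"
    unfolding pole_kernel_def m1 \<Delta>_def[symmetric] B_def[symmetric]
    by (cases "even k") simp_all
  also have "\<Delta> ^ k / (A ^ k * B ^ k) = \<Delta> ^ k / (A ^ k * B ^ k) *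
      (\<Sum>j\<le>n. of_nat ((n + j) choose j) * ((A / \<Delta>) ^ j * (B / \<Delta>) ^ k + (B / \<Delta>) ^ j * (A / \<Delta>) ^ k))"
    by (simp only: one mult_1_right)
  also have "\<dots> = (\<Sum>j\<le>n. of_nat ((n + j) choose j) * (1 / \<Delta> ^ j * (1 / A ^ (k - j) + 1 / B ^ (k - j))))"
    unfolding sum_distrib_left
  proof (rule sum.cong[OF refl])
    fix j assume "j \<in> {..n}"
    then obtain i where i: "k = j + i"
      unfolding k by (metis atMost_iff le_Suc_eq le_iff_add)
    show "\<Delta> ^ k / (A ^ k * B ^ k) * (of_nat ((n + j) choose j) * ((A / \<Delta>) ^ j * (B / \<Delta>) ^ k + (B / \<Delta>) ^ j * (A / \<Delta>) ^ k))
        = of_nat ((n + j) choose j) * (1 / \<Delta> ^ j * (1 / A ^ (k - j) + 1 / B ^ (k - j)))"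
    proof -
      have "\<Delta> ^ k / (A ^ k * B ^ k) * ((A / \<Delta>) ^ j * (B / \<Delta>) ^ k + (B / \<Delta>) ^ j * (A / \<Delta>) ^ k)
          = 1 / \<Delta> ^ j * (1 / A ^ i + 1 / B ^ i)"
        using nz unfolding i by (simp add: power_divide power_add divide_simps) (simp add: algebra_simps)
      then have "of_nat ((n + j) choose j) * (\<Delta> ^ k / (A ^ k * B ^ k) * ((A / \<Delta>) ^ j * (B / \<Delta>) ^ k + (B / \<Delta>) ^ j * (A / \<Delta>) ^ k))
          = of_nat ((n + j) choose j) * (1 / \<Delta> ^ j * (1 / A ^ (k - j) + 1 / B ^ (k - j)))"
        using i by (simp only: diff_add_inverse)
      then show ?thesis
        by (simp only: mult.left_commute)
    qed
  qed
  finally show ?thesis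
    by (simp only: A_def B_def \<Delta>_def)
qed

lemma pow_branch_ii: "pow_branch \<i> s = exp (s * (\<i> * of_real pi / 2))"
  by (simp add: pow_branch_def log_branch_def)

lemma pow_branch_pos: "\<alpha> > 0 \<Longrightarrow> pow_branch (of_real \<alpha>) w = exp (w * of_real (ln \<alpha>))"
  by (simp add: pow_branch_def log_branch_def Ln_of_real)

lemma pow_branch_neg:
  assumes "\<beta> < 0"
  shows "pow_branch (of_real \<beta>) w = exp (w * (of_real (ln (- \<beta>)) - \<i> * of_real pi))"
proof -
  have "Ln (of_real \<beta>) = Ln (- of_real (- \<beta>))"
    by simp
  also have "\<dots> = of_real (ln (- \<beta>)) + \<i> * of_real pi"
    using assms Ln_of_real[of "- \<beta>"] by (subst Ln_minus) auto
  finally show ?thesis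
    using assms by (simp add: pow_branch_def log_branch_def algebra_simps)
qed

lemma exp_half_pi_power: "exp (of_nat m * (\<i> * of_real pi / 2)) = \<i> ^ m"
proof -
  have "exp (of_nat m * (\<i> * of_real pi / 2)) = exp (\<i> * of_real pi / 2) ^ m"
    by (rule exp_of_nat_mult)
  also have "exp (\<i> * of_real pi / 2) = \<i>"
    using exp_Ln[of \<i>] by simp
  finally show ?thesis .
qed

lemma Ln_imaginary_pos: "\<tau> > 0 \<Longrightarrow> Ln (\<i> * of_real \<tau>) = of_real (ln \<tau>) + \<i> * of_real pi / 2"
  using Ln_times_of_real[of \<tau> \<i>] by (simp add: mult.commute Ln_of_real)

lemma Ln_imaginary_neg: "\<tau> > 0 \<Longrightarrow> Ln (- \<i> * of_real \<tau>) = of_real (ln \<tau>) - \<i> * of_real pi / 2"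
  using Ln_times_of_real[of \<tau> "- \<i>"] by (simp add: mult.commute Ln_of_real)

text \<open>Taking out - i leaves the beta kernel with c = i \<alpha>. The resulting i^m and the
  argument pi/2 of c in c^(s - m) combine to i^s.\<close>

lemma pole_part_upper:
  fixes \<alpha> :: real and s :: complex
  assumes \<alpha>: "\<alpha> > 0" and s: "0 < Re s" "Re s < 1" and m: "m = Suc l"
  defines "K \<equiv> \<lambda>x. exp (s * of_real x) / (of_real \<alpha> - \<i> * of_real (exp x)) ^ m"
  shows "integrable lborel K"
    "(LBINT x. K x) = pow_branch \<i> s * exp ((s - of_nat m) * of_real (ln \<alpha>)) * (Gamma s * Gamma (of_nat m - s)) / fact l"
proof -
  define c where "c = \<i> * complex_of_real \<alpha>"
  have c: "Re c \<ge> 0" "c \<noteq> 0"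
    using \<alpha> by (auto simp: c_def)
  have K: "K = (\<lambda>x. \<i> ^ m * (exp (s * of_real x) / (of_real (exp x) + c) ^ m))"
  proof
    fix x
    have "of_real \<alpha> - \<i> * of_real (exp x) = - \<i> * (of_real (exp x) + c)"
      by (simp add: c_def algebra_simps)
    moreover have inv: "1 / (- \<i>) ^ m = \<i> ^ m"
      by (simp flip: power_one_over)
    ultimately show "K x = \<i> ^ m * (exp (s * of_real x) / (of_real (exp x) + c) ^ m)"
      unfolding K_def inv[symmetric] by (simp only: power_mult_distrib) simp
  qed
  show "integrable lborel K"
    unfolding K using m by (intro integrable_mult_right beta_kernel_integrable c s) auto
  have "(LBINT x. K x) = \<i> ^ m * (LBINT x. exp (s * of_real x) / (of_real (exp x) + c) ^ m)"
    unfolding K by (rule integral_mult_right_zero)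
  also have "\<dots> = \<i> ^ m * (c powr (s - of_nat m) * Gamma s * Gamma (of_nat m - s) / fact l)"
    unfolding m using beta_kernel_integral[OF c s, of l] by simp
  also have "c powr (s - of_nat m) = exp ((s - of_nat m) * (of_real (ln \<alpha>) + \<i> * of_real pi / 2))"
    using c \<alpha> by (simp add: powr_def c_def Ln_imaginary_pos)
  finally have eq: "(LBINT x. K x) = \<i> ^ m * exp ((s - of_nat m) * (of_real (ln \<alpha>) + \<i> * of_real pi / 2)) *
      (Gamma s * Gamma (of_nat m - s)) / fact l"
    by simp
  have "\<i> ^ m * exp ((s - of_nat m) * (of_real (ln \<alpha>) + \<i> * of_real pi / 2))
      = pow_branch \<i> s * exp ((s - of_nat m) * of_real (ln \<alpha>))"
    unfolding exp_half_pi_power[symmetric] pow_branch_ii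
    by (simp only: exp_add[symmetric]) (simp add: algebra_simps diff_divide_distrib)
  then show "(LBINT x. K x) = pow_branch \<i> s * exp ((s - of_nat m) * of_real (ln \<alpha>)) * (Gamma s * Gamma (of_nat m - s)) / fact l"
    unfolding eq by simp
qed

text \<open>Here c = i \<beta> has argument - pi/2, so the analogous computation ends in
  i^(-s).\<close>

lemma pole_part_lower:
  fixes \<beta> :: real and s :: complex
  assumes \<beta>: "\<beta> < 0" and s: "0 < Re s" "Re s < 1" and m: "m = Suc l"
  defines "K \<equiv> \<lambda>x. exp (s * of_real x) / (\<i> * of_real (exp x) - of_real \<beta>) ^ m"
  shows "integrable lborel K"
    "(LBINT x. K x) = pow_branch \<i> (- s) * exp ((s - of_nat m) * of_real (ln (- \<beta>))) * (Gamma s * Gamma (of_nat m - s)) / fact l"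
proof -
  define c where "c = - \<i> * complex_of_real (- \<beta>)"
  have c: "Re c \<ge> 0" "c \<noteq> 0"
    using \<beta> by (auto simp: c_def)
  have K: "K = (\<lambda>x. (- \<i>) ^ m * (exp (s * of_real x) / (of_real (exp x) + c) ^ m))"
  proof
    fix x
    have "\<i> * of_real (exp x) - of_real \<beta> = \<i> * (of_real (exp x) + c)"
      by (simp add: c_def algebra_simps)
    moreover have inv: "1 / \<i> ^ m = (- \<i>) ^ m"
      by (simp flip: power_one_over)
    ultimately show "K x = (- \<i>) ^ m * (exp (s * of_real x) / (of_real (exp x) + c) ^ m)"
      unfolding K_def inv[symmetric] by (simp only: power_mult_distrib) simp
  qed
  show "integrable lborel K"
    unfolding K using m by (intro integrable_mult_right beta_kernel_integrable c s) auto
  have "(LBINT x. K x) = (- \<i>) ^ m * (LBINT x. exp (s * of_real x) / (of_real (exp x) + c) ^ m)"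
    unfolding K by (rule integral_mult_right_zero)
  also have "\<dots> = (- \<i>) ^ m * (c powr (s - of_nat m) * Gamma s * Gamma (of_nat m - s) / fact l)"
    unfolding m using beta_kernel_integral[OF c s, of l] by simp
  also have "c powr (s - of_nat m) = exp ((s - of_nat m) * (of_real (ln (- \<beta>)) - \<i> * of_real pi / 2))"
    using c \<beta> Ln_imaginary_neg[of "- \<beta>"] by (simp add: powr_def c_def)
  also have "(- \<i>) ^ m = exp (- (of_nat m * (\<i> * of_real pi / 2)))"
    unfolding exp_minus exp_half_pi_power by (simp flip: power_inverse)
  finally have eq: "(LBINT x. K x) = exp (- (of_nat m * (\<i> * of_real pi / 2))) *
      exp ((s - of_nat m) * (of_real (ln (- \<beta>)) - \<i> * of_real pi / 2)) *
      (Gamma s * Gamma (of_nat m - s)) / fact l"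
    by simp
  have "exp (- (of_nat m * (\<i> * of_real pi / 2))) * exp ((s - of_nat m) * (of_real (ln (- \<beta>)) - \<i> * of_real pi / 2))
      = pow_branch \<i> (- s) * exp ((s - of_nat m) * of_real (ln (- \<beta>)))"
    unfolding pow_branch_ii by (simp only: exp_add[symmetric]) (simp add: algebra_simps diff_divide_distrib)
  then show "(LBINT x. K x) = pow_branch \<i> (- s) * exp ((s - of_nat m) * of_real (ln (- \<beta>))) * (Gamma s * Gamma (of_nat m - s)) / fact l"
    unfolding eq by simp
qed

text \<open>Partial fractions reduce the kernel to powers of orders 1, ..., k with known beta
  integrals; order 1 confines s to 0 < Re s < 1. The sums over j reassemble to terminating
  hypergeometric series at \<xi> and 1 - \<xi>, and the reflection formula brings 1 - \<xi> back to
  \<xi>.\<close>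

lemma pole_kernel_mellin:
  fixes \<alpha> \<beta> :: real and s :: complex
  assumes ab: "\<alpha> > 0" "\<beta> < 0" and s: "0 < Re s" "Re s < 1" and k: "k \<ge> 1"
  shows "(LBINT x. pole_kernel k \<alpha> \<beta> (\<i> * of_real (exp x)) * exp (s * of_real x)) =
    pow_branch \<i> s *
      (pow_branch (of_real \<alpha>) (s - of_nat k) * Beta (2 * of_nat k - s) (s - of_nat k) *
         hypergeo_2F1 (of_nat k) (1 - of_nat k) (of_nat k - s + 1) (of_real (\<beta> / (\<beta> - \<alpha>)))
       + pow_branch (of_real \<beta>) (s - of_nat k) * Beta s (of_nat k - s) *
         hypergeo_2F1 (of_nat k) (1 - of_nat k) (s - of_nat k + 1) (of_real (\<beta> / (\<beta> - \<alpha>))))"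
proof -
  obtain n where n: "k = Suc n"
    using k by (cases k) auto
  define \<xi> where "\<xi> = \<beta> / (\<beta> - \<alpha>)"
  have \<xi>: "\<xi> = - \<beta> / (\<alpha> - \<beta>)" "1 - \<xi> = \<alpha> / (\<alpha> - \<beta>)"
    using ab by (auto simp: \<xi>_def divide_simps) (simp_all add: algebra_simps)
  have s_int: "s \<notin> \<int>"
  proof
    assume "s \<in> \<int>"
    then obtain m where "s = of_int m"
      by (auto elim: Ints_cases)
    then show False
      using s by auto
  qed
  define K1 where "K1 = (\<lambda>m x. exp (s * of_real x) / (of_real \<alpha> - \<i> * of_real (exp x)) ^ m)"
  define K2 where "K2 = (\<lambda>m x. exp (s * of_real x) / (\<i> * of_real (exp x) - of_real \<beta>) ^ m)"
  define E1 where "E1 = exp ((s - of_nat k) * of_real (ln \<alpha>))"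
  define E2 where "E2 = exp ((s - of_nat k) * of_real (ln (- \<beta>)))"
  define C where "C = (\<lambda>j. of_nat ((n + j) choose j) * (1 / of_real (\<alpha> - \<beta>) ^ j) :: complex)"
  define G where "G = (\<lambda>j. Gamma s * Gamma (of_nat (k - j) - s))"
  have integrand: "pole_kernel k \<alpha> \<beta> (\<i> * of_real (exp x)) * exp (s * of_real x) =
      (-1) ^ k * (\<Sum>j\<le>n. C j * (K1 (k - j) x + K2 (k - j) x))" for x
  proof -
    have "\<i> * complex_of_real (exp x) \<noteq> of_real r" for r
      by (auto simp: complex_eq_iff)
    then have "pole_kernel k \<alpha> \<beta> (\<i> * of_real (exp x)) = (-1) ^ k * (\<Sum>j\<le>n. of_nat ((n + j) choose j) *
      (1 / of_real (\<alpha> - \<beta>) ^ j * (1 / (of_real \<alpha> - \<i> * of_real (exp x)) ^ (k - j) +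
        1 / (\<i> * of_real (exp x) - of_real \<beta>) ^ (k - j))))"
      using ab n by (intro pole_kernel_partial_fractions) auto
    then show ?thesis
      by (simp add: sum_distrib_right mult.assoc C_def K1_def K2_def ring_distribs)
  qed
  have int: "integrable lborel (K1 (k - j))" "integrable lborel (K2 (k - j))"
    and I1: "(LBINT x. K1 (k - j) x) = pow_branch \<i> s * (E1 * of_real \<alpha> ^ j) * G j / fact (n - j)"
    and I2: "(LBINT x. K2 (k - j) x) = pow_branch \<i> (- s) * (E2 * of_real (- \<beta>) ^ j) * G j / fact (n - j)"
    if j: "j \<le> n" for j
  proof -
    have m: "k - j = Suc (n - j)"
      using j n by simp
    show "integrable lborel (K1 (k - j))" "integrable lborel (K2 (k - j))"
      unfolding K1_def K2_def using pole_part_upper(1)[OF ab(1) s m] pole_part_lower(1)[OF ab(2) s m] by simp_all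
    \<comment> \<open>Lowering the exponent from k to k - j releases r^j, which together with
      (\<alpha> - \<beta>)^(-j) forms a power of \<xi> or of 1 - \<xi>.\<close>
    have pw: "exp ((s - of_nat (k - j)) * of_real (ln r)) = exp ((s - of_nat k) * of_real (ln r)) * of_real r ^ j"
      if r: "r > 0" for r
    proof -
      have "of_real r ^ j = exp (of_nat j * complex_of_real (ln r))"
        using r by (simp add: exp_of_nat_mult exp_of_real)
      then show ?thesis
        using j n by (simp add: exp_add[symmetric] of_nat_diff algebra_simps)
    qed
    show "(LBINT x. K1 (k - j) x) = pow_branch \<i> s * (E1 * of_real \<alpha> ^ j) * G j / fact (n - j)"
      using pole_part_upper(2)[OF ab(1) s m] pw[OF ab(1)] unfolding K1_def E1_def G_def by simp
    show "(LBINT x. K2 (k - j) x) = pow_branch \<i> (- s) * (E2 * of_real (- \<beta>) ^ j) * G j / fact (n - j)"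
      using pole_part_lower(2)[OF ab(2) s m] pw[of "- \<beta>"] ab unfolding K2_def E2_def G_def by simp
  qed
  \<comment> \<open>Apart from the powers of \<alpha> and \<beta>, the second half of the bracket is
    H at \<xi>, and the first is, by reflection, (-1)^k times H at 1 - \<xi>.\<close>
  define H where "H = (\<lambda>x. Beta s (of_nat k - s) * hypergeo_2F1 (of_nat k) (- of_nat n) (s - of_nat k + 1) x)"
  have H: "H x = (\<Sum>j\<le>n. of_nat ((n + j) choose j) / fact (n - j) * G j * x ^ j)" for x
    unfolding H_def G_def by (rule Beta_hypergeo_2F1_expand[OF s_int n])
  have "(LBINT x. pole_kernel k \<alpha> \<beta> (\<i> * of_real (exp x)) * exp (s * of_real x))
      = (-1) ^ k * (LBINT x. \<Sum>j\<le>n. C j * (K1 (k - j) x + K2 (k - j) x))"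
    unfolding integrand by (rule integral_mult_right_zero)
  also have "(LBINT x. \<Sum>j\<le>n. C j * (K1 (k - j) x + K2 (k - j) x))
      = (\<Sum>j\<le>n. LBINT x. C j * (K1 (k - j) x + K2 (k - j) x))"
    by (intro Bochner_Integration.integral_sum integrable_mult_right Bochner_Integration.integrable_add int) auto
  also have "\<dots> = (\<Sum>j\<le>n. C j * ((LBINT x. K1 (k - j) x) + (LBINT x. K2 (k - j) x)))"
    using int by (intro sum.cong refl) simp
  also have "\<dots> = (\<Sum>j\<le>n. pow_branch \<i> s * E1 * (of_nat ((n + j) choose j) / fact (n - j) * G j * of_real (1 - \<xi>) ^ j) +
      pow_branch \<i> (- s) * E2 * (of_nat ((n + j) choose j) / fact (n - j) * G j * of_real \<xi> ^ j))"
  proof (rule sum.cong[OF refl])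
    fix j assume "j \<in> {..n}"
    then have j: "j \<le> n"
      by simp
    have e1: "complex_of_real (1 - \<xi>) ^ j = of_real \<alpha> ^ j / of_real (\<alpha> - \<beta>) ^ j"
      by (simp only: \<xi>(2) of_real_divide power_divide)
    have e2: "complex_of_real \<xi> ^ j = of_real (- \<beta>) ^ j / of_real (\<alpha> - \<beta>) ^ j"
      by (simp only: \<xi>(1) of_real_divide power_divide)
    show "C j * ((LBINT x. K1 (k - j) x) + (LBINT x. K2 (k - j) x)) =
      pow_branch \<i> s * E1 * (of_nat ((n + j) choose j) / fact (n - j) * G j * of_real (1 - \<xi>) ^ j) +
      pow_branch \<i> (- s) * E2 * (of_nat ((n + j) choose j) / fact (n - j) * G j * of_real \<xi> ^ j)"
      unfolding I1[OF j] I2[OF j] e1 e2 C_def by (simp add: add_divide_distrib ring_distribs mult_ac)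
  qed
  also have "\<dots> = pow_branch \<i> s * E1 * H (of_real (1 - \<xi>)) + pow_branch \<i> (- s) * E2 * H (of_real \<xi>)"
    unfolding H by (simp add: sum.distrib sum_distrib_left)
  finally have main: "(LBINT x. pole_kernel k \<alpha> \<beta> (\<i> * of_real (exp x)) * exp (s * of_real x)) =
      (-1) ^ k * (pow_branch \<i> s * E1 * H (of_real (1 - \<xi>)) + pow_branch \<i> (- s) * E2 * H (of_real \<xi>))" .
  have n1: "1 - of_nat k = - (of_nat n :: complex)"
    by (simp add: n)
  have R1: "Beta (2 * of_nat k - s) (s - of_nat k) * hypergeo_2F1 (of_nat k) (- of_nat n) (of_nat k - s + 1) (of_real \<xi>)
      = (-1) ^ k * H (of_real (1 - \<xi>))"
    using Beta_hypergeo_2F1_reflect[OF s_int n, of "of_real \<xi>"] by (simp add: H_def)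
  \<comment> \<open>The choice of branch matters here: with arg \<beta> = - pi, the factor exp (- i
    pi s) inside \<beta>^(s - k) turns i^s into the i^(-s) of
    \<open>pole_part_lower\<close>.\<close>
  have R2: "pow_branch \<i> s * pow_branch (of_real \<beta>) (s - of_nat k) = (-1) ^ k * (pow_branch \<i> (- s) * E2)"
  proof -
    have "(-1) ^ k = exp (of_nat k * (\<i> * of_real pi))"
      by (simp add: exp_of_nat_mult exp_pi_i')
    then show ?thesis
      unfolding pow_branch_ii pow_branch_neg[OF ab(2)] E2_def
      by (simp only: exp_add[symmetric]) (simp add: algebra_simps)
  qed
  have "pow_branch \<i> s *
      (pow_branch (of_real \<alpha>) (s - of_nat k) * Beta (2 * of_nat k - s) (s - of_nat k) *
         hypergeo_2F1 (of_nat k) (1 - of_nat k) (of_nat k - s + 1) (of_real \<xi>)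
       + pow_branch (of_real \<beta>) (s - of_nat k) * Beta s (of_nat k - s) *
         hypergeo_2F1 (of_nat k) (1 - of_nat k) (s - of_nat k + 1) (of_real \<xi>))
     = pow_branch \<i> s * E1 * (Beta (2 * of_nat k - s) (s - of_nat k) * hypergeo_2F1 (of_nat k) (- of_nat n) (of_nat k - s + 1) (of_real \<xi>))
       + (pow_branch \<i> s * pow_branch (of_real \<beta>) (s - of_nat k)) * H (of_real \<xi>)"
    unfolding n1 H_def E1_def pow_branch_pos[OF ab(1)] by (simp add: algebra_simps)
  also have "\<dots> = (-1) ^ k * (pow_branch \<i> s * E1 * H (of_real (1 - \<xi>)) + pow_branch \<i> (- s) * E2 * H (of_real \<xi>))"
    unfolding R1 R2 by (simp add: algebra_simps)
  finally show ?thesis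
    unfolding main \<xi>_def ..
qed

section \<open>Exponential series and Dirichlet series\<close>

text \<open>The inequality t <= exp t at t = \<theta> w / c, raised to the power c.\<close>

lemma powr_exp_bound:
  fixes w c \<theta> :: real
  assumes "w > 0" "c > 0" "\<theta> > 0"
  shows "w powr c * exp (- \<theta> * w) \<le> (c / \<theta>) powr c"
proof -
  have "\<theta> * w / c \<le> exp (\<theta> * w / c)"
    using exp_ge_add_one_self[of "\<theta> * w / c"] by linarith
  then have "w \<le> (c / \<theta>) * exp (\<theta> * w / c)"
    using assms by (simp add: field_simps)
  then have "w powr c \<le> ((c / \<theta>) * exp (\<theta> * w / c)) powr c"
    using assms by (intro powr_mono2) auto
  also have "\<dots> = (c / \<theta>) powr c * exp (\<theta> * w)"
  proof -
    have "exp (\<theta> * w / c) powr c = exp (\<theta> * w)"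
      using assms by (simp add: powr_def)
    then show ?thesis
      using assms powr_mult[of "c / \<theta>" "exp (\<theta> * w / c)" c] by simp
  qed
  finally show ?thesis
    by (simp add: exp_minus field_simps)
qed

text \<open>Euler's integral under the substitution t = exp x, where t^(s - 1) dt becomes exp (s x)
  dx.\<close>

lemma gamma_exp_integral_1:
  fixes s :: complex
  assumes s: "Re s > 0"
  shows "has_bochner_integral lborel (\<lambda>x. of_real (exp (- exp x)) * exp (s * of_real x)) (Gamma s)"
proof -
  define f where "f = (\<lambda>t::real. complex_of_real t powr (s - 1) / of_real (exp t))"
  define h where "h = (\<lambda>x::real. of_real (exp (- exp x)) * exp (s * of_real x))"
  have range: "range (exp :: real \<Rightarrow> real) = {0<..}"
    by (auto simp: image_iff) (metis exp_ln)
  have "f absolutely_integrable_on {0<..}"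
    unfolding f_def by (rule absolutely_integrable_Gamma_integral'[OF s])
  moreover have "integral {0<..} f = Gamma s"
    unfolding f_def using Gamma_integral_complex'[OF s] by (rule integral_unique)
  moreover have "(\<lambda>x. \<bar>exp x\<bar> *\<^sub>R f (exp x)) = h"
  proof
    fix x :: real
    have "complex_of_real (exp x) powr (s - 1) = exp ((s - 1) * of_real x)"
      by (simp add: powr_def Ln_of_real)
    then show "\<bar>exp x\<bar> *\<^sub>R f (exp x) = h x"
      unfolding f_def h_def
      by (simp add: scaleR_conv_of_real exp_minus field_simps exp_diff exp_of_real)
  qed
  moreover have "inj (exp :: real \<Rightarrow> real)"
    by (simp add: inj_def)
  ultimately have h: "h absolutely_integrable_on UNIV" "integral UNIV h = Gamma s"
    using has_absolute_integral_change_of_variables_real[of UNIV exp exp f "Gamma s"]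
    by (auto simp: range intro!: derivative_eq_intros)
  have meas: "h \<in> borel_measurable lborel"
    unfolding h_def by measurable
  have "integrable lebesgue h"
    using h(1) by (simp add: set_integrable_def)
  then have int: "integrable lborel h"
    using integrable_completion[OF meas] by simp
  moreover have "(LBINT x. h x) = Gamma s"
    using integral_lborel[OF int] h(2) by simp
  ultimately show ?thesis
    by (simp add: has_bochner_integral_iff h_def)
qed

lemma gamma_exp_integral:
  fixes s :: complex and A :: real
  assumes s: "Re s > 0" and A: "A > 0"
  shows "has_bochner_integral lborel (\<lambda>x. of_real (exp (- A * exp x)) * exp (s * of_real x)) (of_real A powr (- s) * Gamma s)"
proof -
  have "has_bochner_integral lborel
      (\<lambda>x. of_real (exp (- exp (ln A + 1 * x))) * exp (s * of_real (ln A + 1 * x))) (Gamma s /\<^sub>R \<bar>1\<bar>)"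
    using gamma_exp_integral_1[OF s] by (subst (asm) lborel_has_bochner_integral_real_affine_iff[where c = 1 and t = "ln A"]) auto
  then have "has_bochner_integral lborel
      (\<lambda>x. of_real A powr (- s) * (of_real (exp (- exp (ln A + 1 * x))) * exp (s * of_real (ln A + 1 * x))))
      (of_real A powr (- s) * (Gamma s /\<^sub>R \<bar>1\<bar>))"
    by (rule has_bochner_integral_mult_right)
  moreover have "of_real A powr (- s) * (of_real (exp (- exp (ln A + 1 * x))) * exp (s * of_real (ln A + 1 * x)))
      = of_real (exp (- A * exp x)) * exp (s * of_real x)" for x
  proof -
    have "of_real A powr (- s) = exp (- s * of_real (ln A))"
      using A by (simp add: powr_def Ln_of_real)
    then have eq1: "of_real A powr (- s) * exp (s * of_real (ln A + 1 * x)) = exp (s * of_real x)"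
      by (simp add: exp_add[symmetric] algebra_simps)
    have eq2: "exp (- exp (ln A + 1 * x)) = exp (- A * exp x)"
      using A by (simp add: exp_add)
    show ?thesis
      by (simp only: eq2 mult.left_commute[of "of_real A powr (- s)"] eq1)
  qed
  ultimately show ?thesis
    by simp
qed

definition exp_series :: "(nat \<Rightarrow> complex) \<Rightarrow> real \<Rightarrow> complex \<Rightarrow> complex" where
  "exp_series a \<omega> z = (\<Sum>n. a (Suc n) * exp (\<i> * of_real (\<omega> * real (Suc n)) * z))"

context
  fixes a :: "nat \<Rightarrow> complex" and \<omega> c :: real
  assumes \<omega>: "\<omega> > 0" and c: "c > 0"
    and summ: "summable (\<lambda>n. norm (a (Suc n)) * real (Suc n) powr (- c))"
begin

text \<open>With \<theta> = \<omega> y this converts absolute convergence of the Dirichlet series at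
  the real point c into a bound for F(iy) by a multiple of y^(-c), for every y > 0.\<close>

lemma exp_term_bound:
  assumes "\<theta> > 0"
  shows "norm (a (Suc n)) * exp (- \<theta> * real (Suc n)) \<le>
    norm (a (Suc n)) * real (Suc n) powr (- c) * (c / \<theta>) powr c"
proof -
  have "real (Suc n) powr (- c) * (real (Suc n) powr c * exp (- \<theta> * real (Suc n))) \<le> real (Suc n) powr (- c) * (c / \<theta>) powr c"
    using powr_exp_bound[of "real (Suc n)" c \<theta>] c assms by (intro mult_left_mono) auto
  moreover have "real (Suc n) powr (- c) * real (Suc n) powr c = 1"
    by (subst powr_add[symmetric]) simp
  ultimately have "exp (- \<theta> * real (Suc n)) \<le> real (Suc n) powr (- c) * (c / \<theta>) powr c"
    by (simp only: mult.assoc[symmetric] mult_1_left)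
  then show ?thesis
    unfolding mult.assoc by (rule mult_left_mono) simp
qed

lemma summable_exp_terms:
  assumes "\<theta> > 0"
  shows "summable (\<lambda>n. norm (a (Suc n)) * exp (- \<theta> * real (Suc n)))"
  using exp_term_bound[OF assms]
  by (intro summable_comparison_test'[OF summable_mult2[OF summ], of 0]) auto

lemma exp_series_sums:
  assumes "Im z > 0"
  shows "(\<lambda>n. a (Suc n) * exp (\<i> * of_real (\<omega> * real (Suc n)) * z)) sums exp_series a \<omega> z"
proof -
  have "norm (a (Suc n) * exp (\<i> * of_real (\<omega> * real (Suc n)) * z)) =
      norm (a (Suc n)) * exp (- (\<omega> * Im z) * real (Suc n))" for n
    by (simp add: norm_mult norm_exp_eq_Re algebra_simps)
  then have "summable (\<lambda>n. norm (a (Suc n) * exp (\<i> * of_real (\<omega> * real (Suc n)) * z)))"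
    using summable_exp_terms[of "\<omega> * Im z"] \<omega> assms by simp
  then show ?thesis
    unfolding exp_series_def by (rule summable_sums[OF summable_norm_cancel])
qed

text \<open>In the variable exp (i \<omega> z) the function is a power series with constant term 0
  that converges on the unit disc.\<close>

lemma exp_series_holomorphic: "exp_series a \<omega> holomorphic_on {z. Im z > 0}"
proof -
  define b where "b = (\<lambda>n. if n = 0 then 0 else a n)"
  define P where "P = (\<lambda>q. \<Sum>n. b n * q ^ n)"
  have sums: "(\<lambda>n. b n * q ^ n) sums P q" if q: "norm q < 1" for q
  proof (cases "q = 0")
    case True
    have "(\<lambda>n. b n * q ^ n) = (\<lambda>n. 0)"
      using True by (auto simp: b_def fun_eq_iff)
    then show ?thesis
      unfolding P_def by (metis summable_sums summable_zero)
  next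
    case False
    define \<theta> where "\<theta> = - ln (norm q)"
    have "\<theta> > 0"
      using q False by (simp add: \<theta>_def)
    have "norm (b (Suc n) * q ^ Suc n) = norm (a (Suc n)) * exp (- \<theta> * real (Suc n))" for n
    proof -
      have "norm q ^ Suc n = exp (- \<theta> * real (Suc n))"
      proof -
        have "norm q = exp (- \<theta>)"
          using False by (simp add: \<theta>_def)
        then have "norm q ^ Suc n = exp (of_nat (Suc n) * (- \<theta>))"
          by (simp only: exp_of_nat_mult)
        then show ?thesis
          by (simp only: mult.commute)
      qed
      then show ?thesis
        by (simp add: b_def norm_mult norm_power del: power_Suc of_nat_Suc)
    qed
    then have "summable (\<lambda>n. norm (b (Suc n) * q ^ Suc n))"
      using summable_exp_terms[OF \<open>\<theta> > 0\<close>] by simp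
    then have "summable (\<lambda>n. norm (b n * q ^ n))"
      by (subst (asm) summable_Suc_iff)
    then show ?thesis
      unfolding P_def by (rule summable_sums[OF summable_norm_cancel])
  qed
  have holoP: "P holomorphic_on ball 0 1"
    using sums by (intro power_series_holomorphic[of 0 1 b]) auto
  have "(\<lambda>z. P (exp (\<i> * of_real \<omega> * z))) holomorphic_on {z. Im z > 0}"
  proof (rule holomorphic_on_compose_gen[of _ _ P, unfolded o_def, OF _ holoP])
    show "(\<lambda>z. exp (\<i> * of_real \<omega> * z)) holomorphic_on {z. Im z > 0}"
      by (intro holomorphic_intros)
    show "(\<lambda>z. exp (\<i> * of_real \<omega> * z)) ` {z. Im z > 0} \<subseteq> ball 0 1"
      using \<omega> by (auto simp: norm_exp_eq_Re)
  qed
  moreover have "P (exp (\<i> * of_real \<omega> * z)) = exp_series a \<omega> z" if "z \<in> {z. Im z > 0}" for z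
  proof -
    have z: "Im z > 0"
      using that by simp
    define q where "q = exp (\<i> * of_real \<omega> * z)"
    have q: "norm q < 1"
      using \<omega> z by (simp add: q_def norm_exp_eq_Re)
    have "(\<lambda>n. b (Suc n) * q ^ Suc n) sums (P q - b 0 * q ^ 0)"
      using sums[OF q] by (subst sums_Suc_iff) auto
    moreover have "b (Suc n) * q ^ Suc n = a (Suc n) * exp (\<i> * of_real (\<omega> * real (Suc n)) * z)" for n
    proof -
      have "q ^ Suc n = exp (of_nat (Suc n) * (\<i> * of_real \<omega> * z))"
        unfolding q_def by (rule exp_of_nat_mult[symmetric])
      also have "of_nat (Suc n) * (\<i> * of_real \<omega> * z) = \<i> * of_real (\<omega> * real (Suc n)) * z"
        by (simp add: algebra_simps)
      finally show ?thesis
        by (simp add: b_def)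
    qed
    moreover have "P q - b 0 * q ^ 0 = P q"
      by (simp add: b_def)
    ultimately have "(\<lambda>n. a (Suc n) * exp (\<i> * of_real (\<omega> * real (Suc n)) * z)) sums P q"
      by (simp only:)
    then show ?thesis
      using exp_series_sums[OF z] sums_unique2 by (simp add: q_def)
  qed
  ultimately show ?thesis
    using holomorphic_cong[of "{z. Im z > 0}" "{z. Im z > 0}" "\<lambda>z. P (exp (\<i> * of_real \<omega> * z))" "exp_series a \<omega>"] by simp
qed

lemma exp_series_imaginary:
  "a (Suc n) * exp (\<i> * of_real (\<omega> * real (Suc n)) * (\<i> * of_real (exp x)))
     = a (Suc n) * of_real (exp (- (\<omega> * real (Suc n)) * exp x))"
proof -
  have "\<i> * of_real (\<omega> * real (Suc n)) * (\<i> * of_real (exp x)) = complex_of_real (- (\<omega> * real (Suc n)) * exp x)"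
    by (simp add: algebra_simps)
  then show ?thesis
    by (simp only: exp_of_real)
qed

lemma exp_series_bounded:
  "norm (exp_series a \<omega> (\<i> * of_real (exp x))) * exp (c * x) \<le>
    (\<Sum>n. norm (a (Suc n)) * real (Suc n) powr (- c)) * (c / \<omega>) powr c"
proof -
  define \<theta> where "\<theta> = \<omega> * exp x"
  have \<theta>: "\<theta> > 0"
    using \<omega> by (simp add: \<theta>_def)
  have nrm: "norm (a (Suc n) * exp (\<i> * of_real (\<omega> * real (Suc n)) * (\<i> * of_real (exp x)))) =
      norm (a (Suc n)) * exp (- \<theta> * real (Suc n))" for n
    unfolding exp_series_imaginary by (simp add: norm_mult \<theta>_def algebra_simps)
  have sm: "summable (\<lambda>n. norm (a (Suc n) * exp (\<i> * of_real (\<omega> * real (Suc n)) * (\<i> * of_real (exp x)))))"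
    unfolding nrm by (rule summable_exp_terms[OF \<theta>])
  have "norm (exp_series a \<omega> (\<i> * of_real (exp x))) \<le> (\<Sum>n. norm (a (Suc n)) * exp (- \<theta> * real (Suc n)))"
    unfolding exp_series_def using summable_norm[OF sm] unfolding nrm .
  also have "\<dots> \<le> (\<Sum>n. norm (a (Suc n)) * real (Suc n) powr (- c) * (c / \<theta>) powr c)"
    by (intro suminf_le exp_term_bound \<theta> summable_exp_terms summable_mult2 summ)
  also have "\<dots> = (\<Sum>n. norm (a (Suc n)) * real (Suc n) powr (- c)) * (c / \<theta>) powr c"
    by (rule suminf_mult2[symmetric, OF summ])
  also have "(c / \<theta>) powr c = (c / \<omega>) powr c * exp (- (c * x))"
  proof -
    have "c / \<theta> = (c / \<omega>) * exp (- x)"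
      by (simp add: \<theta>_def exp_minus divide_inverse)
    moreover have "exp (- x) powr c = exp (- (c * x))"
      by (simp add: powr_def)
    ultimately show ?thesis
      using c \<omega> powr_mult[of "c / \<omega>" "exp (- x)" c] by simp
  qed
  finally have "norm (exp_series a \<omega> (\<i> * of_real (exp x))) * exp (c * x) \<le>
      ((\<Sum>n. norm (a (Suc n)) * real (Suc n) powr (- c)) * ((c / \<omega>) powr c * exp (- (c * x)))) * exp (c * x)"
    by (intro mult_right_mono) auto
  moreover have "exp (- (c * x)) * exp (c * x) = 1"
    by (simp add: exp_minus)
  ultimately show ?thesis
    by (simp only: mult.assoc mult_1_right)
qed

text \<open>Each term is a Gamma integral. The exchange of sum and integral rests on the integrals
  of the norms, which are Gamma integrals at the real point c and add up to a multiple of the series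
  assumed summable.\<close>

lemma exp_series_mellin:
  assumes s: "Re s = c"
  shows "integrable lborel (\<lambda>x. exp_series a \<omega> (\<i> * of_real (exp x)) * exp (s * of_real x))"
    "(LBINT x. exp_series a \<omega> (\<i> * of_real (exp x)) * exp (s * of_real x)) =
       of_real \<omega> powr (- s) * Gamma s * (\<Sum>n. a (Suc n) * of_nat (Suc n) powr (- s))"
proof -
  define A where "A = (\<lambda>n. \<omega> * real (Suc n))"
  have A: "A n > 0" for n
    using \<omega> by (simp add: A_def)
  define f where "f = (\<lambda>n x. a (Suc n) * (of_real (exp (- A n * exp x)) * exp (s * of_real x)))"
  have hb: "has_bochner_integral lborel (f n) (a (Suc n) * (of_real (A n) powr (- s) * Gamma s))" for n
    unfolding f_def by (intro has_bochner_integral_mult_right gamma_exp_integral A) (use s c in simp)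
  have eq: "exp_series a \<omega> (\<i> * of_real (exp x)) * exp (s * of_real x) = (\<Sum>n. f n x)" for x
  proof -
    have "exp_series a \<omega> (\<i> * of_real (exp x)) * exp (s * of_real x) =
        (\<Sum>n. a (Suc n) * exp (\<i> * of_real (\<omega> * real (Suc n)) * (\<i> * of_real (exp x)))) * exp (s * of_real x)"
      by (simp add: exp_series_def)
    also have "\<dots> = (\<Sum>n. a (Suc n) * exp (\<i> * of_real (\<omega> * real (Suc n)) * (\<i> * of_real (exp x))) * exp (s * of_real x))"
      using exp_series_sums[of "\<i> * of_real (exp x)"] by (intro suminf_mult2) (auto simp: sums_iff)
    finally show ?thesis
      unfolding exp_series_imaginary by (simp add: f_def A_def mult.assoc)
  qed
  have norm_f: "norm (f n x) = norm (a (Suc n)) * (exp (- A n * exp x) * exp (c * x))" for n x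
    by (simp add: f_def norm_mult norm_exp_eq_Re s)
  have real_int: "has_bochner_integral lborel (\<lambda>x. exp (- A n * exp x) * exp (c * x)) (A n powr (- c) * Gamma c)" for n
  proof -
    have "has_bochner_integral lborel (\<lambda>x. complex_of_real (exp (- A n * exp x) * exp (c * x)))
        (of_real (A n) powr (- of_real c) * Gamma (of_real c))"
    proof -
      have "of_real (exp (- A n * exp x)) * exp (of_real c * of_real x) = complex_of_real (exp (- A n * exp x) * exp (c * x))" for x
        using exp_of_real[of "c * x", where ?'a = complex] by simp
      then show ?thesis
        using gamma_exp_integral[of "of_real c" "A n"] c A[of n] by simp
    qed
    also have "of_real (A n) powr (- of_real c) * Gamma (of_real c) = complex_of_real (A n powr (- c) * Gamma c)"
      using A[of n] powr_of_real[of "A n" "- c"] by (simp add: Gamma_complex_of_real)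
    finally have *: "has_bochner_integral lborel (\<lambda>x. complex_of_real (exp (- A n * exp x) * exp (c * x)))
        (complex_of_real (A n powr (- c) * Gamma c))" .
    have "has_bochner_integral lborel (\<lambda>x. Re (complex_of_real (exp (- A n * exp x) * exp (c * x))))
        (Re (complex_of_real (A n powr (- c) * Gamma c)))"
      using * by (rule has_bochner_integral_bounded_linear[OF bounded_linear_Re])
    then show ?thesis
      by simp
  qed
  have int_norm: "(LBINT x. norm (f n x)) = norm (a (Suc n)) * real (Suc n) powr (- c) * (\<omega> powr (- c) * Gamma c)" for n
  proof -
    have "(LBINT x. norm (f n x)) = norm (a (Suc n)) * (A n powr (- c) * Gamma c)"
      unfolding norm_f using real_int[of n] by (simp add: has_bochner_integral_iff)
    also have "A n powr (- c) = \<omega> powr (- c) * real (Suc n) powr (- c)"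
      using \<omega> by (simp add: A_def powr_mult)
    finally show ?thesis
      by simp
  qed
  have fi: "integrable lborel (f n)" for n
    using hb by (auto simp: has_bochner_integral_iff)
  have ae: "AE x in lborel. summable (\<lambda>n. norm (f n x))"
  proof (rule AE_I2)
    fix x :: real
    have "summable (\<lambda>n. norm (a (Suc n)) * exp (- (\<omega> * exp x) * real (Suc n)) * exp (c * x))"
      using \<omega> by (intro summable_mult2 summable_exp_terms) simp
    then show "summable (\<lambda>n. norm (f n x))"
      unfolding norm_f by (simp add: A_def mult_ac)
  qed
  have sm: "summable (\<lambda>n. LBINT x. norm (f n x))"
    unfolding int_norm by (intro summable_mult2 summ)
  show "integrable lborel (\<lambda>x. exp_series a \<omega> (\<i> * of_real (exp x)) * exp (s * of_real x))"
    unfolding eq by (rule integrable_suminf[OF fi ae sm])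
  have "(LBINT x. \<Sum>n. f n x) = (\<Sum>n. LBINT x. f n x)"
    by (rule integral_suminf[OF fi ae sm])
  also have "\<dots> = (\<Sum>n. (a (Suc n) * of_nat (Suc n) powr (- s)) * (of_real \<omega> powr (- s) * Gamma s))"
  proof (rule suminf_cong)
    fix n
    have "of_real (A n) powr (- s) = of_real \<omega> powr (- s) * of_nat (Suc n) powr (- s)"
      using \<omega> powr_times_real[of "of_real \<omega>" "of_nat (Suc n)" "- s"] by (simp add: A_def)
    then show "(LBINT x. f n x) = (a (Suc n) * of_nat (Suc n) powr (- s)) * (of_real \<omega> powr (- s) * Gamma s)"
      using hb[of n] by (simp add: has_bochner_integral_iff)
  qed
  also have "\<dots> = (\<Sum>n. a (Suc n) * of_nat (Suc n) powr (- s)) * (of_real \<omega> powr (- s) * Gamma s)"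
  proof (rule suminf_mult2[symmetric])
    have "norm (of_nat (Suc n) powr (- s)) = real (Suc n) powr (- c)" for n
      using s norm_powr_real_powr[of "of_nat (Suc n)" "- s"] by simp
    then have "summable (\<lambda>n. norm (a (Suc n) * of_nat (Suc n) powr (- s)))"
      using summ by (simp add: norm_mult)
    then show "summable (\<lambda>n. a (Suc n) * of_nat (Suc n) powr (- s))"
      by (rule summable_norm_cancel)
  qed
  finally show "(LBINT x. exp_series a \<omega> (\<i> * of_real (exp x)) * exp (s * of_real x)) =
       of_real \<omega> powr (- s) * Gamma s * (\<Sum>n. a (Suc n) * of_nat (Suc n) powr (- s))"
    unfolding eq by (simp add: mult_ac)
qed

end

section \<open>Moving the contour\<close>

lemma integrable_gaussian:
  assumes "\<epsilon> > (0::real)"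
  shows "integrable lborel (\<lambda>t. exp (- \<epsilon> * t\<^sup>2))"
proof -
  have "integrable lborel (\<lambda>t. complex_of_real (exp (- \<epsilon> * t\<^sup>2)) * iexp (0 * t))"
    using gaussian_fourier[OF assms, of 0] by (simp only: has_bochner_integral_iff)
  then have "integrable lborel (\<lambda>t. norm (complex_of_real (exp (- \<epsilon> * t\<^sup>2)) * iexp (0 * t)))"
    by (rule integrable_norm)
  then show ?thesis
    by simp
qed

context
  fixes H :: "complex \<Rightarrow> complex"
  assumes holo: "H holomorphic_on (- \<int>)"
    and bdd: "\<And>\<sigma>\<^sub>1 \<sigma>\<^sub>2 t\<^sub>0. t\<^sub>0 > 0 \<Longrightarrow> bounded (H ` lacunary_strip \<sigma>\<^sub>1 \<sigma>\<^sub>2 t\<^sub>0)"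
begin

lemma not_Int_Complex: "\<sigma> \<notin> \<int> \<Longrightarrow> Complex \<sigma> t \<notin> \<int>"
  by (auto elim!: Ints_cases simp: complex_eq_iff)

lemma continuous_on_vertical_line:
  assumes "\<sigma> \<notin> \<int>"
  shows "continuous_on UNIV (\<lambda>t. H (Complex \<sigma> t))"
proof -
  have "continuous_on (- \<int>) H"
    using holo by (rule holomorphic_on_imp_continuous_on)
  then show ?thesis
    by (rule continuous_on_compose2)
       (use not_Int_Complex[OF assms] in \<open>auto simp: Complex_eq intro!: continuous_intros\<close>)
qed

lemma bounded_vertical_line:
  assumes "\<sigma> \<notin> \<int>"
  obtains K where "\<And>t. norm (H (Complex \<sigma> t)) \<le> K"
proof -
  obtain K1 where K1: "\<And>s. s \<in> lacunary_strip \<sigma> \<sigma> 1 \<Longrightarrow> norm (H s) \<le> K1"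
    using bdd[of 1 \<sigma> \<sigma>] by (auto simp: bounded_iff)
  have "compact ((\<lambda>t. H (Complex \<sigma> t)) ` {-1..1})"
    by (intro compact_continuous_image continuous_on_subset[OF continuous_on_vertical_line[OF assms]]) auto
  then obtain K2 where K2: "\<And>t. t \<in> {-1..1} \<Longrightarrow> norm (H (Complex \<sigma> t)) \<le> K2"
    using compact_imp_bounded by (fastforce simp: bounded_iff)
  show ?thesis
  proof (rule that)
    fix t
    show "norm (H (Complex \<sigma> t)) \<le> max K1 K2"
    proof (cases "\<bar>t\<bar> \<ge> 1")
      case True
      then show ?thesis
        using K1[of "Complex \<sigma> t"] by (simp add: lacunary_strip_def)
    next
      case False
      then have "t \<in> {-1..1}"
        by auto
      then show ?thesis
        using K2[of t] by simp
    qed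
  qed
qed

lemma norm_mellin_weight:
  "norm (exp (of_real \<epsilon> * (Complex \<sigma> t - of_real b)\<^sup>2) * exp (- Complex \<sigma> t * of_real v)) =
     exp (\<epsilon> * (\<sigma> - b)\<^sup>2 - \<sigma> * v) * exp (- \<epsilon> * t\<^sup>2)"
  by (simp add: norm_mult norm_exp_eq_Re Complex_eq power2_eq_square exp_add[symmetric] algebra_simps)

lemma mellin_inv_integrable:
  assumes \<sigma>: "\<sigma> \<notin> \<int>" and \<epsilon>: "\<epsilon> > 0"
  shows "integrable lborel (\<lambda>t. H (Complex \<sigma> t) * exp (of_real \<epsilon> * (Complex \<sigma> t - of_real b)\<^sup>2) *
      exp (- Complex \<sigma> t * of_real v))"
proof -
  obtain K where K: "\<And>t. norm (H (Complex \<sigma> t)) \<le> K"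
    using bounded_vertical_line[OF \<sigma>] by blast
  let ?C = "K * exp (\<epsilon> * (\<sigma> - b)\<^sup>2 - \<sigma> * v)"
  show ?thesis
  proof (rule Bochner_Integration.integrable_bound)
    show "integrable lborel (\<lambda>t. ?C * exp (- \<epsilon> * t\<^sup>2))"
      by (intro integrable_mult_right integrable_gaussian \<epsilon>)
    have "continuous_on UNIV (\<lambda>t. H (Complex \<sigma> t) * exp (of_real \<epsilon> * (Complex \<sigma> t - of_real b)\<^sup>2) *
        exp (- Complex \<sigma> t * of_real v))"
      by (intro continuous_on_mult continuous_on_vertical_line \<sigma>) (auto simp: Complex_eq intro!: continuous_intros)
    then show "(\<lambda>t. H (Complex \<sigma> t) * exp (of_real \<epsilon> * (Complex \<sigma> t - of_real b)\<^sup>2) *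
        exp (- Complex \<sigma> t * of_real v)) \<in> borel_measurable lborel"
      using borel_measurable_continuous_onI by simp
    show "AE t in lborel. norm (H (Complex \<sigma> t) * exp (of_real \<epsilon> * (Complex \<sigma> t - of_real b)\<^sup>2) *
        exp (- Complex \<sigma> t * of_real v)) \<le> norm (?C * exp (- \<epsilon> * t\<^sup>2))"
    proof (rule AE_I2)
      fix t
      have "norm (H (Complex \<sigma> t) * exp (of_real \<epsilon> * (Complex \<sigma> t - of_real b)\<^sup>2) * exp (- Complex \<sigma> t * of_real v))
          = norm (H (Complex \<sigma> t)) * (exp (\<epsilon> * (\<sigma> - b)\<^sup>2 - \<sigma> * v) * exp (- \<epsilon> * t\<^sup>2))"
        by (simp only: mult.assoc norm_mult[of "H _"] norm_mellin_weight)
      also have "\<dots> \<le> K * (exp (\<epsilon> * (\<sigma> - b)\<^sup>2 - \<sigma> * v) * exp (- \<epsilon> * t\<^sup>2))"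
        by (intro mult_right_mono K) auto
      also have "\<dots> \<le> norm (?C * exp (- \<epsilon> * t\<^sup>2))"
        by (simp add: mult.assoc)
      finally show "norm (H (Complex \<sigma> t) * exp (of_real \<epsilon> * (Complex \<sigma> t - of_real b)\<^sup>2) *
        exp (- Complex \<sigma> t * of_real v)) \<le> norm (?C * exp (- \<epsilon> * t\<^sup>2))" .
    qed
  qed
qed

text \<open>The limit r n is the residue of H at n, and 0 where H has a finite limit, so one formula
  covers all integers in between. The weight is entire and only multiplies r n by its value at
  n.\<close>

lemma mellin_inv_shift:
  fixes r :: "int \<Rightarrow> complex"
  assumes lim: "\<And>n. ((\<lambda>s. H s * (s - of_int n)) \<longlongrightarrow> r n) (at (of_int n))"
    and \<sigma>: "\<sigma>\<^sub>1 \<notin> \<int>" "\<sigma>\<^sub>2 \<notin> \<int>" "\<sigma>\<^sub>1 < \<sigma>\<^sub>2" and \<epsilon>: "\<epsilon> > 0"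
  shows "mellin_inv \<epsilon> b H \<sigma>\<^sub>2 v - mellin_inv \<epsilon> b H \<sigma>\<^sub>1 v =
    (\<Sum>n\<in>{n. \<sigma>\<^sub>1 < of_int n \<and> of_int n < \<sigma>\<^sub>2}. r n * of_real (exp (\<epsilon> * (of_int n - b)\<^sup>2 - of_int n * v)))"
proof -
  define w :: "complex \<Rightarrow> complex" where "w = (\<lambda>s. exp (of_real \<epsilon> * (s - of_real b)\<^sup>2) * exp (- s * of_real v))"
  define f where "f = (\<lambda>s. H s * w s)"
  define N where "N = {n::int. \<sigma>\<^sub>1 < of_int n \<and> of_int n < \<sigma>\<^sub>2}"
  define P where "P = (of_int ` N :: complex set)"
  have "N \<subseteq> {\<lfloor>\<sigma>\<^sub>1\<rfloor>..\<lceil>\<sigma>\<^sub>2\<rceil>}"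
    by (auto simp: N_def) (linarith+)
  then have fin: "finite N"
    by (rule finite_subset) simp
  have w_holo: "w holomorphic_on A" for A
    unfolding w_def by (intro holomorphic_intros)
  have f_eq: "f (Complex \<sigma> t) = H (Complex \<sigma> t) * exp (of_real \<epsilon> * (Complex \<sigma> t - of_real b)\<^sup>2) *
      exp (- Complex \<sigma> t * of_real v)" for \<sigma> t
    by (simp add: f_def w_def mult.assoc)
  obtain K where K: "\<And>s. s \<in> lacunary_strip \<sigma>\<^sub>1 \<sigma>\<^sub>2 1 \<Longrightarrow> norm (H s) \<le> K"
    using bdd[of 1 \<sigma>\<^sub>1 \<sigma>\<^sub>2] by (auto simp: bounded_iff)
  \<comment> \<open>An upper bound, uniform over the strip, for the weight without its factor exp (-
    \<epsilon> t^2).\<close>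
  define D where "D = exp (\<epsilon> * (\<bar>\<sigma>\<^sub>1\<bar> + \<bar>\<sigma>\<^sub>2\<bar> + \<bar>b\<bar>)\<^sup>2 + (\<bar>\<sigma>\<^sub>1\<bar> + \<bar>\<sigma>\<^sub>2\<bar>) * \<bar>v\<bar>)"
  define B where "B = (\<lambda>T. \<bar>K\<bar> * (D * exp (- \<epsilon> * T\<^sup>2)))"
  \<comment> \<open>The open strip reaches to the neighbouring integers and not beyond, so it
    contains no integer outside N.\<close>
  have fl: "of_int \<lfloor>\<sigma>\<^sub>1\<rfloor> < \<sigma>\<^sub>1" "\<sigma>\<^sub>2 < of_int \<lceil>\<sigma>\<^sub>2\<rceil>"
    using \<sigma> by (metis Ints_of_int floor_correct le_less, metis Ints_of_int ceiling_correct le_less)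
  have f_holo: "f holomorphic_on {s. of_int \<lfloor>\<sigma>\<^sub>1\<rfloor> < Re s \<and> Re s < of_int \<lceil>\<sigma>\<^sub>2\<rceil>} - P"
    unfolding f_def
  proof (intro holomorphic_on_mult w_holo)
    have "{s. of_int \<lfloor>\<sigma>\<^sub>1\<rfloor> < Re s \<and> Re s < of_int \<lceil>\<sigma>\<^sub>2\<rceil>} - P \<subseteq> - \<int>"
    proof
      fix s assume s: "s \<in> {s. of_int \<lfloor>\<sigma>\<^sub>1\<rfloor> < Re s \<and> Re s < of_int \<lceil>\<sigma>\<^sub>2\<rceil>} - P"
      show "s \<in> - \<int>"
      proof
        assume "s \<in> \<int>"
        then obtain n where n: "s = of_int n"
          by (auto elim: Ints_cases)
        then have "\<lfloor>\<sigma>\<^sub>1\<rfloor> < n" "n < \<lceil>\<sigma>\<^sub>2\<rceil>"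
          using s by auto
        then have "n \<in> N"
          by (simp add: N_def floor_less_iff less_ceiling_iff)
        then show False
          using s n by (auto simp: P_def)
      qed
    qed
    then show "H holomorphic_on {s. of_int \<lfloor>\<sigma>\<^sub>1\<rfloor> < Re s \<and> Re s < of_int \<lceil>\<sigma>\<^sub>2\<rceil>} - P"
      by (rule holomorphic_on_subset[OF holo])
  qed
  have sub: "P \<subseteq> {s. \<sigma>\<^sub>1 < Re s \<and> Re s < \<sigma>\<^sub>2}"
    by (auto simp: P_def N_def)
  have ints: "integrable lborel (\<lambda>t. f (Complex \<sigma>\<^sub>1 t))" "integrable lborel (\<lambda>t. f (Complex \<sigma>\<^sub>2 t))"
    unfolding f_eq by (rule mellin_inv_integrable[OF \<sigma>(1) \<epsilon>], rule mellin_inv_integrable[OF \<sigma>(2) \<epsilon>])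
  have bound: "norm (f (Complex \<sigma> t)) \<le> B \<bar>t\<bar>" if st: "\<sigma> \<in> {\<sigma>\<^sub>1..\<sigma>\<^sub>2}" "1 \<le> \<bar>t\<bar>" for \<sigma> t
  proof -
    have "norm (f (Complex \<sigma> t)) = norm (H (Complex \<sigma> t)) * (exp (\<epsilon> * (\<sigma> - b)\<^sup>2 - \<sigma> * v) * exp (- \<epsilon> * t\<^sup>2))"
      by (simp only: f_def w_def norm_mult[of "H _"] norm_mellin_weight)
    also have "\<dots> \<le> \<bar>K\<bar> * (D * exp (- \<epsilon> * t\<^sup>2))"
    proof (intro mult_mono)
      show "norm (H (Complex \<sigma> t)) \<le> \<bar>K\<bar>"
        using K[of "Complex \<sigma> t"] st by (simp add: lacunary_strip_def)
      have "\<bar>\<sigma> - b\<bar> \<le> \<bar>\<sigma>\<^sub>1\<bar> + \<bar>\<sigma>\<^sub>2\<bar> + \<bar>b\<bar>"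
        using st by auto
      then have "(\<sigma> - b)\<^sup>2 \<le> (\<bar>\<sigma>\<^sub>1\<bar> + \<bar>\<sigma>\<^sub>2\<bar> + \<bar>b\<bar>)\<^sup>2"
        by (metis abs_ge_zero abs_le_square_iff abs_of_nonneg add_nonneg_nonneg)
      then have "\<epsilon> * (\<sigma> - b)\<^sup>2 \<le> \<epsilon> * (\<bar>\<sigma>\<^sub>1\<bar> + \<bar>\<sigma>\<^sub>2\<bar> + \<bar>b\<bar>)\<^sup>2"
        using \<epsilon> by simp
      moreover have "- \<sigma> * v \<le> (\<bar>\<sigma>\<^sub>1\<bar> + \<bar>\<sigma>\<^sub>2\<bar>) * \<bar>v\<bar>"
      proof -
        have "- \<sigma> * v \<le> \<bar>\<sigma>\<bar> * \<bar>v\<bar>"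
          by (metis abs_ge_self abs_minus_cancel abs_mult)
        also have "\<dots> \<le> (\<bar>\<sigma>\<^sub>1\<bar> + \<bar>\<sigma>\<^sub>2\<bar>) * \<bar>v\<bar>"
          using st by (intro mult_right_mono) auto
        finally show ?thesis .
      qed
      ultimately show "exp (\<epsilon> * (\<sigma> - b)\<^sup>2 - \<sigma> * v) \<le> D"
        unfolding D_def by simp
    qed (auto simp: D_def)
    finally show ?thesis
      by (simp add: B_def)
  qed
  have B0: "(B \<longlongrightarrow> 0) at_top"
  proof -
    have "((\<lambda>T::real. exp (- \<epsilon> * T\<^sup>2)) \<longlongrightarrow> 0) at_top"
      using \<epsilon> by real_asymp
    then show ?thesis
      unfolding B_def by (intro tendsto_mult_right_zero)
  qed
  have "(LBINT t. f (Complex \<sigma>\<^sub>2 t)) - (LBINT t. f (Complex \<sigma>\<^sub>1 t)) = 2 * pi * (\<Sum>s\<in>P. residue f s)"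
    by (rule strip_shift[OF fl(1) \<sigma>(3) fl(2) f_holo _ sub ints bound B0]) (simp add: P_def fin)
  also have "(\<Sum>s\<in>P. residue f s) = (\<Sum>n\<in>N. residue f (of_int n))"
    unfolding P_def by (subst sum.reindex) (auto simp: inj_on_def)
  also have "\<dots> = (\<Sum>n\<in>N. r n * of_real (exp (\<epsilon> * (of_int n - b)\<^sup>2 - of_int n * v)))"
  proof (rule sum.cong[OF refl])
    fix n :: int
    have "residue f (of_int n) = r n * w (of_int n)"
    proof (rule residue_simple'[of "ball (of_int n) 1"])
      show "f holomorphic_on ball (of_int n) 1 - {of_int n}"
        unfolding f_def
      proof (intro holomorphic_on_mult w_holo holomorphic_on_subset[OF holo] subsetI)
        fix s :: complex assume s: "s \<in> ball (of_int n) 1 - {of_int n}"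
        show "s \<in> - \<int>"
        proof
          assume "s \<in> \<int>"
          then obtain m where m: "s = of_int m"
            by (auto elim: Ints_cases)
          have "norm (of_int n - of_int m :: complex) < 1"
            using s m by (simp add: dist_norm)
          then have "\<bar>n - m\<bar> < 1"
            by (metis norm_of_int of_int_diff of_int_less_1_iff of_int_abs)
          then show False
            using s m by simp
        qed
      qed
      have "isCont w (of_int n)"
        using w_holo[of UNIV] holomorphic_on_imp_continuous_on[of w UNIV]
        by (simp add: continuous_on_eq_continuous_at)
      then have "((\<lambda>s. (H s * (s - of_int n)) * w s) \<longlongrightarrow> r n * w (of_int n)) (at (of_int n))"
        by (intro tendsto_mult lim) (simp add: isCont_def)
      then show "((\<lambda>s. f s * (s - of_int n)) \<longlongrightarrow> r n * w (of_int n)) (at (of_int n))"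
        by (simp add: f_def mult_ac)
    qed auto
    also have "w (of_int n) = of_real (exp (\<epsilon> * (of_int n - b)\<^sup>2 - of_int n * v))"
      by (simp add: w_def exp_of_real[symmetric] exp_add[symmetric])
    finally show "residue f (of_int n) = r n * of_real (exp (\<epsilon> * (of_int n - b)\<^sup>2 - of_int n * v))" .
  qed
  finally show ?thesis
    unfolding mellin_inv_def f_eq[symmetric] N_def by (simp add: diff_divide_distrib[symmetric])
qed

end

text \<open>The substitution t -> - t realizes s -> 2b - s. The Gaussian is unchanged, and y^(-s) =
  y^(-2b) (1/y)^(-(2b - s)), which is the exchange of y and 1/y.\<close>

lemma mellin_inv_reflect:
  fixes H :: "complex \<Rightarrow> complex"
  shows "mellin_inv \<epsilon> b (\<lambda>s. H (2 * of_real b - s)) \<sigma> v = of_real (exp (- 2 * b * v)) * mellin_inv \<epsilon> b H (2 * b - \<sigma>) (- v)"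
proof -
  define g where "g = (\<lambda>t. H (Complex (2 * b - \<sigma>) t) * exp (of_real \<epsilon> * (Complex (2 * b - \<sigma>) t - of_real b)\<^sup>2) *
      exp (- Complex (2 * b - \<sigma>) t * of_real (- v)))"
  have "H (2 * of_real b - Complex \<sigma> t) * exp (of_real \<epsilon> * (Complex \<sigma> t - of_real b)\<^sup>2) * exp (- Complex \<sigma> t * of_real v)
      = of_real (exp (- 2 * b * v)) * g (0 + (-1) * t)" for t
  proof -
    have 1: "2 * of_real b - Complex \<sigma> t = Complex (2 * b - \<sigma>) (0 + (-1) * t)"
      by (simp add: complex_eq_iff)
    have 2: "(Complex \<sigma> t - of_real b)\<^sup>2 = (Complex (2 * b - \<sigma>) (0 + (-1) * t) - of_real b)\<^sup>2"
      by (simp add: Complex_eq power2_eq_square algebra_simps)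
    have 3: "exp (- Complex \<sigma> t * of_real v) =
        of_real (exp (- 2 * b * v)) * exp (- Complex (2 * b - \<sigma>) (0 + (-1) * t) * of_real (- v))"
      by (simp add: Complex_eq exp_of_real[symmetric] exp_add[symmetric] algebra_simps)
    show ?thesis
      unfolding 1 2 3 g_def by (simp only: mult_ac)
  qed
  then have "mellin_inv \<epsilon> b (\<lambda>s. H (2 * of_real b - s)) \<sigma> v = of_real (exp (- 2 * b * v)) * (LBINT t. g (0 + (-1) * t)) / of_real (2 * pi)"
    unfolding mellin_inv_def by simp
  also have "(LBINT t. g (0 + (-1) * t)) = (LBINT t. g t)"
    using lborel_integral_real_affine[of "-1" g 0] by simp
  finally show ?thesis
    by (simp add: mellin_inv_def g_def)
qed

text \<open>Both sides are inverted on Re s = 1/2. There \<Phi>(s) is moved to Re s = c, where its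
  inverse transform is u(v); \<Phi>(2k - s) is an inverse transform of \<Phi> on Re s = 2k - 1/2 at
  - v and is moved to c as well. The residues picked up are exponentials in v with integer
  frequencies, a Laurent polynomial in exp v.\<close>

lemma mellin_functional_equation:
  fixes \<Phi> :: "complex \<Rightarrow> complex" and r :: "int \<Rightarrow> complex" and k :: nat and c :: real
  assumes holo: "\<Phi> holomorphic_on (- \<int>)"
    and bdd: "\<And>\<sigma>\<^sub>1 \<sigma>\<^sub>2 t\<^sub>0. t\<^sub>0 > 0 \<Longrightarrow> bounded (\<Phi> ` lacunary_strip \<sigma>\<^sub>1 \<sigma>\<^sub>2 t\<^sub>0)"
    and lim: "\<And>n. ((\<lambda>s. \<Phi> s * (s - of_int n)) \<longlongrightarrow> r n) (at (of_int n))"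
    and k: "k \<ge> 1" and c: "c > 2 * real k" "c \<notin> \<int>"
    and u: "continuous_on UNIV u" "integrable lborel (\<lambda>x. u x * of_real (exp (c * x)))"
      "\<And>x. norm (u x) * exp (c * x) \<le> K"
      "\<And>t. \<Phi> (Complex c t) = (LBINT x. u x * exp (Complex c t * of_real x))"
    and q: "continuous_on UNIV q" "integrable lborel (\<lambda>x. q x * of_real (exp (1 / 2 * x)))"
      "\<And>x. norm (q x) * exp (1 / 2 * x) \<le> K'"
      "\<And>t. \<Phi> (2 * of_nat k - Complex (1 / 2) t) + \<Phi> (Complex (1 / 2) t) =
             - (LBINT x. q x * exp (Complex (1 / 2) t * of_real x))"
  shows "\<exists>N \<rho>. finite N \<and> (\<forall>v. u v + of_real (exp (- 2 * real k * v)) * u (- v) + q v =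
           (\<Sum>n\<in>N. \<rho> n * of_real (exp (real_of_int n * v))))"
proof -
  define \<sigma> where "\<sigma> = 1 / (2::real)"
  have half: "\<sigma> \<notin> \<int>"
  proof
    assume "\<sigma> \<in> \<int>"
    then obtain n where "1 / (2::real) = of_int n"
      unfolding \<sigma>_def by (auto elim: Ints_cases)
    then have "real_of_int (2 * n) = 1"
      by simp
    then have "2 * n = 1"
      by linarith
    then show False
      by presburger
  qed
  have half': "2 * real k - \<sigma> \<notin> \<int>"
  proof
    assume "2 * real k - \<sigma> \<in> \<int>"
    then have "2 * real k - (2 * real k - \<sigma>) \<in> \<int>"
      by (intro Ints_diff Ints_mult) auto
    then show False
      using half by simp
  qed
  \<comment> \<open>The integers crossed when the lines \<sigma> and 2k - \<sigma> are moved to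
    c.\<close>
  define N1 where "N1 = {n::int. \<sigma> < of_int n \<and> of_int n < c}"
  define N2 where "N2 = {n::int. 2 * real k - \<sigma> < of_int n \<and> of_int n < c}"
  have fin: "finite N1" "finite N2"
  proof -
    have "N1 \<subseteq> {0..\<lceil>c\<rceil>}" "N2 \<subseteq> {0..\<lceil>c\<rceil>}"
      using k by (auto simp: N1_def N2_def \<sigma>_def) (linarith+)
    then show "finite N1" "finite N2"
      by (auto intro: finite_subset)
  qed
  define S1 where "S1 = (\<lambda>\<epsilon> v. \<Sum>n\<in>N1. r n * of_real (exp (\<epsilon> * (of_int n - real k)\<^sup>2 - of_int n * v)))"
  define S2 where "S2 = (\<lambda>\<epsilon> v. \<Sum>n\<in>N2. r n * of_real (exp (\<epsilon> * (of_int n - real k)\<^sup>2 - of_int n * v)))"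
  have main: "u v - S1 0 v + of_real (exp (- 2 * real k * v)) * (u (- v) - S2 0 (- v)) = - q v" for v
  proof -
    have lim_u: "((\<lambda>\<epsilon>. mellin_inv \<epsilon> (real k) \<Phi> c x) \<longlongrightarrow> u x) (at_right 0)" for x
      by (rule mellin_inv_tendsto[OF u])
    have lim_q: "((\<lambda>\<epsilon>. mellin_inv \<epsilon> (real k) (\<lambda>s. \<Phi> (2 * of_nat k - s) + \<Phi> s) \<sigma> v) \<longlongrightarrow> - q v) (at_right 0)"
    proof (rule mellin_inv_tendsto[where u = "\<lambda>x. - q x"])
      show "continuous_on UNIV (\<lambda>x. - q x)"
        using q(1) by (intro continuous_intros)
      show "integrable lborel (\<lambda>x. - q x * complex_of_real (exp (\<sigma> * x)))"
        using q(2) by (simp add: \<sigma>_def)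
      show "norm (- q x) * exp (\<sigma> * x) \<le> K'" for x
        using q(3)[of x] by (simp add: \<sigma>_def)
      show "\<Phi> (2 * of_nat k - Complex \<sigma> t) + \<Phi> (Complex \<sigma> t) = (LBINT x. - q x * exp (Complex \<sigma> t * of_real x))" for t
        using q(4)[of t] by (simp add: \<sigma>_def)
    qed
    have ev: "mellin_inv \<epsilon> (real k) (\<lambda>s. \<Phi> (2 * of_nat k - s) + \<Phi> s) \<sigma> v
        = mellin_inv \<epsilon> (real k) \<Phi> c v - S1 \<epsilon> v +
          of_real (exp (- 2 * real k * v)) * (mellin_inv \<epsilon> (real k) \<Phi> c (- v) - S2 \<epsilon> (- v))"
      if \<epsilon>: "\<epsilon> > 0" for \<epsilon>
    proof -
      have shift1: "mellin_inv \<epsilon> (real k) \<Phi> c v - mellin_inv \<epsilon> (real k) \<Phi> \<sigma> v = S1 \<epsilon> v"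
        unfolding S1_def N1_def using c k
        by (intro mellin_inv_shift holo bdd lim half \<epsilon>) (auto simp: \<sigma>_def)
      have shift2: "mellin_inv \<epsilon> (real k) \<Phi> c (- v) - mellin_inv \<epsilon> (real k) \<Phi> (2 * real k - \<sigma>) (- v) = S2 \<epsilon> (- v)"
        unfolding S2_def N2_def using c k
        by (intro mellin_inv_shift holo bdd lim half' \<epsilon>) (auto simp: \<sigma>_def)
      have refl: "mellin_inv \<epsilon> (real k) (\<lambda>s. \<Phi> (2 * of_nat k - s)) \<sigma> v =
          of_real (exp (- 2 * real k * v)) * mellin_inv \<epsilon> (real k) \<Phi> (2 * real k - \<sigma>) (- v)"
        using mellin_inv_reflect[of \<epsilon> "real k" \<Phi> \<sigma> v] by simp
      define W where "W = (\<lambda>t. exp (of_real \<epsilon> * (Complex \<sigma> t - of_real (real k))\<^sup>2))"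
      define W' where "W' = (\<lambda>t. exp (- Complex \<sigma> t * of_real v))"
      have int1: "integrable lborel (\<lambda>t. \<Phi> (Complex \<sigma> t) * W t * W' t)"
        unfolding W_def W'_def by (rule mellin_inv_integrable[OF holo bdd half \<epsilon>])
      have holo': "(\<lambda>s. \<Phi> (2 * of_nat k - s)) holomorphic_on (- \<int>)"
      proof (rule holomorphic_on_compose_gen[of _ _ \<Phi>, unfolded o_def, OF _ holo])
        show "(\<lambda>s. 2 * of_nat k - s) ` (- \<int> :: complex set) \<subseteq> - \<int>"
        proof safe
          fix s :: complex assume "s \<notin> \<int>" "2 * of_nat k - s \<in> \<int>"
          from Ints_diff[OF _ this(2), of "2 * of_nat k"] this(1) show False
            by (simp add: Ints_mult)
        qed
      qed (auto intro!: holomorphic_intros)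
      have bdd': "bounded ((\<lambda>s. \<Phi> (2 * of_nat k - s)) ` lacunary_strip \<sigma>\<^sub>1 \<sigma>\<^sub>2 t\<^sub>0)" if t0: "t\<^sub>0 > 0" for \<sigma>\<^sub>1 \<sigma>\<^sub>2 t\<^sub>0
      proof (rule bounded_subset[OF bdd[OF t0, of "2 * real k - \<sigma>\<^sub>2" "2 * real k - \<sigma>\<^sub>1"]])
        show "(\<lambda>s. \<Phi> (2 * of_nat k - s)) ` lacunary_strip \<sigma>\<^sub>1 \<sigma>\<^sub>2 t\<^sub>0 \<subseteq>
            \<Phi> ` lacunary_strip (2 * real k - \<sigma>\<^sub>2) (2 * real k - \<sigma>\<^sub>1) t\<^sub>0"
          by (auto simp: lacunary_strip_def)
      qed
      have int2: "integrable lborel (\<lambda>t. \<Phi> (2 * of_nat k - Complex \<sigma> t) * W t * W' t)"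
        unfolding W_def W'_def by (rule mellin_inv_integrable[OF holo' bdd' half \<epsilon>])
      have "mellin_inv \<epsilon> (real k) (\<lambda>s. \<Phi> (2 * of_nat k - s) + \<Phi> s) \<sigma> v =
          (LBINT t. \<Phi> (2 * of_nat k - Complex \<sigma> t) * W t * W' t + \<Phi> (Complex \<sigma> t) * W t * W' t) / of_real (2 * pi)"
        unfolding mellin_inv_def W_def W'_def by (simp only: ring_distribs)
      also have "\<dots> = mellin_inv \<epsilon> (real k) (\<lambda>s. \<Phi> (2 * of_nat k - s)) \<sigma> v + mellin_inv \<epsilon> (real k) \<Phi> \<sigma> v"
        using int1 int2 by (simp add: mellin_inv_def W_def W'_def add_divide_distrib)
      finally have add: "mellin_inv \<epsilon> (real k) (\<lambda>s. \<Phi> (2 * of_nat k - s) + \<Phi> s) \<sigma> v =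
          mellin_inv \<epsilon> (real k) (\<lambda>s. \<Phi> (2 * of_nat k - s)) \<sigma> v + mellin_inv \<epsilon> (real k) \<Phi> \<sigma> v" .
      have e1: "mellin_inv \<epsilon> (real k) \<Phi> \<sigma> v = mellin_inv \<epsilon> (real k) \<Phi> c v - S1 \<epsilon> v"
        using shift1 by (simp add: algebra_simps)
      have e2: "mellin_inv \<epsilon> (real k) \<Phi> (2 * real k - \<sigma>) (- v) = mellin_inv \<epsilon> (real k) \<Phi> c (- v) - S2 \<epsilon> (- v)"
        using shift2 by (simp add: algebra_simps)
      show ?thesis
        unfolding add refl e1 e2 by simp
    qed
    have "((\<lambda>\<epsilon>. mellin_inv \<epsilon> (real k) \<Phi> c v - S1 \<epsilon> v +
          of_real (exp (- 2 * real k * v)) * (mellin_inv \<epsilon> (real k) \<Phi> c (- v) - S2 \<epsilon> (- v)))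
        \<longlongrightarrow> u v - S1 0 v + of_real (exp (- 2 * real k * v)) * (u (- v) - S2 0 (- v))) (at_right 0)"
      unfolding S1_def S2_def by (intro tendsto_intros lim_u)
    moreover have "((\<lambda>\<epsilon>. mellin_inv \<epsilon> (real k) \<Phi> c v - S1 \<epsilon> v +
          of_real (exp (- 2 * real k * v)) * (mellin_inv \<epsilon> (real k) \<Phi> c (- v) - S2 \<epsilon> (- v))) \<longlongrightarrow> - q v) (at_right 0)"
    proof (rule Lim_transform_eventually[OF lim_q])
      show "\<forall>\<^sub>F \<epsilon> in at_right 0. mellin_inv \<epsilon> (real k) (\<lambda>s. \<Phi> (2 * of_nat k - s) + \<Phi> s) \<sigma> v =
          mellin_inv \<epsilon> (real k) \<Phi> c v - S1 \<epsilon> v +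
          of_real (exp (- 2 * real k * v)) * (mellin_inv \<epsilon> (real k) \<Phi> c (- v) - S2 \<epsilon> (- v))"
        using eventually_at_right_less[of 0] by eventually_elim (rule ev)
    qed
    ultimately show ?thesis
      using tendsto_unique trivial_limit_at_right_real by blast
  qed
  \<comment> \<open>A residue at n enters with exp (- n v) through the direct shift and with exp (-
    2k v) exp (n v) through the reflected one; hence the exponents - n and n - 2k. The two summands
    of \<rho> allow for exponents in both sets.\<close>
  define M1 where "M1 = uminus ` N1"
  define M2 where "M2 = (\<lambda>n. n - 2 * int k) ` N2"
  define \<rho> where "\<rho> = (\<lambda>m. (if m \<in> M1 then r (- m) else 0) + (if m \<in> M2 then r (m + 2 * int k) else 0))"
  have "u v + of_real (exp (- 2 * real k * v)) * u (- v) + q v = (\<Sum>m\<in>M1 \<union> M2. \<rho> m * of_real (exp (real_of_int m * v)))" for v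
  proof -
    have finM: "finite M1" "finite M2"
      using fin by (auto simp: M1_def M2_def)
    have "S1 0 v = (\<Sum>m\<in>M1. r (- m) * of_real (exp (real_of_int m * v)))"
      unfolding S1_def M1_def by (subst sum.reindex) (auto simp: inj_on_def)
    also have "\<dots> = (\<Sum>m\<in>M1 \<union> M2. if m \<in> M1 then r (- m) * of_real (exp (real_of_int m * v)) else 0)"
      using finM by (intro sum.mono_neutral_cong_left) auto
    finally have s1: "S1 0 v = (\<Sum>m\<in>M1 \<union> M2. if m \<in> M1 then r (- m) * of_real (exp (real_of_int m * v)) else 0)" .
    have "of_real (exp (- 2 * real k * v)) * S2 0 (- v) = (\<Sum>n\<in>N2. r n * of_real (exp (real_of_int (n - 2 * int k) * v)))"
      unfolding S2_def sum_distrib_left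
    proof (rule sum.cong[OF refl])
      fix n
      have "exp (- 2 * real k * v) * exp (0 * (of_int n - real k)\<^sup>2 - of_int n * (- v)) = exp (real_of_int (n - 2 * int k) * v)"
        by (simp add: exp_add[symmetric] algebra_simps)
      then show "of_real (exp (- 2 * real k * v)) * (r n * complex_of_real (exp (0 * (of_int n - real k)\<^sup>2 - of_int n * (- v))))
          = r n * of_real (exp (real_of_int (n - 2 * int k) * v))"
        by (simp only: of_real_mult[symmetric] mult.left_commute[of _ "r n"])
    qed
    also have "\<dots> = (\<Sum>m\<in>M2. r (m + 2 * int k) * of_real (exp (real_of_int m * v)))"
      unfolding M2_def by (subst sum.reindex) (auto simp: inj_on_def)
    also have "\<dots> = (\<Sum>m\<in>M1 \<union> M2. if m \<in> M2 then r (m + 2 * int k) * of_real (exp (real_of_int m * v)) else 0)"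
      using finM by (intro sum.mono_neutral_cong_left) auto
    finally have s2: "of_real (exp (- 2 * real k * v)) * S2 0 (- v) =
        (\<Sum>m\<in>M1 \<union> M2. if m \<in> M2 then r (m + 2 * int k) * of_real (exp (real_of_int m * v)) else 0)" .
    have "u v + of_real (exp (- 2 * real k * v)) * u (- v) + q v = S1 0 v + of_real (exp (- 2 * real k * v)) * S2 0 (- v)"
      using main[of v] by (simp add: algebra_simps)
    also have "\<dots> = (\<Sum>m\<in>M1 \<union> M2. \<rho> m * of_real (exp (real_of_int m * v)))"
      unfolding s1 s2 sum.distrib[symmetric] by (intro sum.cong refl) (simp add: \<rho>_def ring_distribs)
    finally show ?thesis .
  qed
  moreover have "finite (M1 \<union> M2)"
    using fin by (simp add: M1_def M2_def)
  ultimately show ?thesis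
    by blast
qed

section \<open>The Laurent part of the period function\<close>

lemma power_int_imaginary_tendsto_0:
  assumes "n > (0::int)"
  shows "((\<lambda>y. (\<i> * complex_of_real y) powi n) \<longlongrightarrow> 0) (at_right 0)"
proof -
  obtain m where m: "n = int m" "m > 0"
    using assms by (metis of_nat_0_less_iff zero_less_imp_eq_int)
  have "((\<lambda>y. (\<i> * complex_of_real y) ^ m) \<longlongrightarrow> (\<i> * complex_of_real 0) ^ m) (at_right 0)"
    by (intro tendsto_intros)
  then show ?thesis
    using m by (simp add: zero_power)
qed

lemma bigo_1_mult_tendsto_0:
  fixes f g :: "real \<Rightarrow> complex"
  assumes "f \<in> O[F](\<lambda>_. 1)" "(g \<longlongrightarrow> 0) F"
  shows "((\<lambda>y. g y * f y) \<longlongrightarrow> 0) F"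
proof -
  obtain B where B: "eventually (\<lambda>y. norm (f y) \<le> B) F"
    using assms(1) by (auto elim!: landau_o.bigE)
  have "((\<lambda>y. norm (g y) * B) \<longlongrightarrow> 0) F"
    using assms(2) by (intro tendsto_mult_left_zero tendsto_norm_zero)
  then show ?thesis
    by (rule Lim_null_comparison[rotated])
       (use B in eventually_elim, auto simp: norm_mult intro!: mult_left_mono)
qed

lemma tendsto_imp_bigo_1: "(f \<longlongrightarrow> (l :: complex)) F \<Longrightarrow> f \<in> O[F](\<lambda>_. 1)"
  by (rule bigoI_tendsto[where c = l]) auto

text \<open>Multiplying by z^(-m), where m is the smallest among the negative exponents with nonzero
  coefficient, leaves \<sigma> m in the limit z -> 0, while boundedness forces the limit 0.\<close>

lemma laurent_sum_bounded_imp: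
  fixes \<sigma> :: "int \<Rightarrow> complex"
  assumes fin: "finite M"
    and O1: "(\<lambda>y. \<Sum>n\<in>M. \<sigma> n * (\<i> * complex_of_real y) powi n) \<in> O[at_right 0](\<lambda>_. 1)"
    and n: "n \<in> M" "n < 0"
  shows "\<sigma> n = 0"
proof (rule ccontr)
  assume "\<sigma> n \<noteq> 0"
  define B where "B = {n\<in>M. n < 0 \<and> \<sigma> n \<noteq> 0}"
  have B: "finite B" "B \<noteq> {}"
    using fin n \<open>\<sigma> n \<noteq> 0\<close> by (auto simp: B_def)
  define m where "m = Min B"
  have mB: "m \<in> B" and m_min: "\<And>i. i \<in> B \<Longrightarrow> m \<le> i"
    using B by (auto simp: m_def)
  have m: "m \<in> M" "m < 0" "\<sigma> m \<noteq> 0"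
    using mB by (auto simp: B_def)
  let ?z = "\<lambda>y. \<i> * complex_of_real y"
  have lim0: "((\<lambda>y. ?z y powi (- m) * (\<Sum>n\<in>M. \<sigma> n * ?z y powi n)) \<longlongrightarrow> 0) (at_right 0)"
    using m by (intro bigo_1_mult_tendsto_0[OF O1] power_int_imaginary_tendsto_0) auto
  have "((\<lambda>y. \<Sum>n\<in>M. \<sigma> n * (?z y powi (- m) * ?z y powi n)) \<longlongrightarrow> (\<Sum>n\<in>M. if n = m then \<sigma> m else 0)) (at_right 0)"
  proof (rule tendsto_sum)
    fix i assume i: "i \<in> M"
    have ev: "eventually (\<lambda>y. \<sigma> i * ?z y powi (i - m) = \<sigma> i * (?z y powi (- m) * ?z y powi i)) (at_right 0)"
      using eventually_at_right_less[of 0]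
      by eventually_elim (auto simp: power_int_add[symmetric] algebra_simps)
    show "((\<lambda>y. \<sigma> i * (?z y powi (- m) * ?z y powi i)) \<longlongrightarrow> (if i = m then \<sigma> m else 0)) (at_right 0)"
    proof (cases "i = m \<or> \<sigma> i = 0 \<or> i < m")
      case True
      then consider "i = m" | "\<sigma> i = 0" "i \<noteq> m" | "i < m" "\<sigma> i \<noteq> 0"
        by blast
      then show ?thesis
      proof cases
        case 1
        have "eventually (\<lambda>y. \<sigma> i * (?z y powi (- m) * ?z y powi i) = \<sigma> m) (at_right 0)"
          using ev by eventually_elim (metis 1 diff_self power_int_0_right mult_1_right)
        then show ?thesis
          using 1 by (simp add: tendsto_eventually)
      next
        case 2
        then show ?thesis
          by simp
      next
        case 3
        then have "i \<in> B"
          using i m by (auto simp: B_def)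
        then show ?thesis
          using m_min[of i] 3 by simp
      qed
    next
      case False
      then have "i - m > 0"
        by simp
      then have "((\<lambda>y. \<sigma> i * ?z y powi (i - m)) \<longlongrightarrow> \<sigma> i * 0) (at_right 0)"
        by (intro tendsto_intros power_int_imaginary_tendsto_0)
      then have "((\<lambda>y. \<sigma> i * (?z y powi (- m) * ?z y powi i)) \<longlongrightarrow> \<sigma> i * 0) (at_right 0)"
        by (rule Lim_transform_eventually[OF _ ev])
      then show ?thesis
        using False by simp
    qed
  qed
  also have "(\<Sum>n\<in>M. if n = m then \<sigma> m else 0) = \<sigma> m"
    using fin m by simp
  also have "(\<lambda>y. \<Sum>n\<in>M. \<sigma> n * (?z y powi (- m) * ?z y powi n)) = (\<lambda>y. ?z y powi (- m) * (\<Sum>n\<in>M. \<sigma> n * ?z y powi n))"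
    by (simp add: sum_distrib_left mult_ac)
  finally have "\<sigma> m = 0"
    using lim0 tendsto_unique trivial_limit_at_right_real by blast
  with m show False
    by simp
qed

text \<open>Since \<lambda> - 1/z = (-1/z) (1 - \<lambda> z), the expression is (-1)^n times the
  difference quotient at 0 of (1 - \<lambda> z)^n. The translation thus gains one power of z, and
  for \<lambda> nonzero the leading coefficient vanishes only at n = 0.\<close>

lemma power_int_difference_tendsto:
  fixes lam :: real and n :: int
  shows "((\<lambda>y. (\<i> * complex_of_real y) powi (n - 1) *
      ((of_real lam - 1 / (\<i> * of_real y)) powi n - (- 1 / (\<i> * of_real y)) powi n))
    \<longlongrightarrow> - ((- 1) powi n * of_int n * of_real lam)) (at_right 0)"
proof -
  let ?z = "\<lambda>y. \<i> * complex_of_real y"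
  define f where "f = (\<lambda>z::complex. (1 - of_real lam * z) powi n)"
  have "(f has_field_derivative of_int n * (1 - of_real lam * 0) powi (n - 1) * (- of_real lam)) (at 0)"
    unfolding f_def by (auto intro!: derivative_eq_intros)
  then have "((\<lambda>z. (f z - f 0) / z) \<longlongrightarrow> - (of_int n * of_real lam)) (at 0)"
    by (simp add: has_field_derivative_iff)
  moreover have "filterlim ?z (at 0) (at_right 0)"
    unfolding filterlim_at
    by (auto intro!: tendsto_eq_intros eventually_at_right_less simp: eventually_at_filter)
  ultimately have "((\<lambda>y. (f (?z y) - f 0) / ?z y) \<longlongrightarrow> - (of_int n * of_real lam)) (at_right 0)"
    by (rule filterlim_compose)
  then have lim: "((\<lambda>y. (- 1) powi n * ((f (?z y) - f 0) / ?z y)) \<longlongrightarrow> (- 1) powi n * - (of_int n * of_real lam)) (at_right 0)"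
    by (intro tendsto_intros)
  have "((\<lambda>y. ?z y powi (n - 1) * ((of_real lam - 1 / ?z y) powi n - (- 1 / ?z y) powi n))
      \<longlongrightarrow> (- 1) powi n * - (of_int n * of_real lam)) (at_right 0)"
  proof (rule Lim_transform_eventually[OF lim])
    show "\<forall>\<^sub>F y in at_right 0. (- 1) powi n * ((f (?z y) - f 0) / ?z y) =
        ?z y powi (n - 1) * ((of_real lam - 1 / ?z y) powi n - (- 1 / ?z y) powi n)"
      using eventually_at_right_less[of 0]
    proof eventually_elim
      case (elim y)
      define z where "z = ?z y"
      have z: "z \<noteq> 0"
        using elim by (simp add: z_def)
      have "of_real lam - 1 / z = (- 1 / z) * (1 - of_real lam * z)"
        using z by (simp add: field_simps)
      then have 1: "(of_real lam - 1 / z) powi n = (- 1 / z) powi n * f z"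
        by (simp only: power_int_mult_distrib f_def)
      have 2: "z powi (n - 1) * (- 1 / z) powi n = (- 1) powi n / z"
      proof -
        have "z powi (n - 1) = z powi n / z"
          using z by (simp add: power_int_diff)
        moreover have "(- 1 / z) powi n = (- 1) powi n / z powi n"
          by (rule power_int_divide_distrib)
        ultimately show ?thesis
          using z by simp
      qed
      have "z powi (n - 1) * ((of_real lam - 1 / z) powi n - (- 1 / z) powi n)
          = (z powi (n - 1) * (- 1 / z) powi n) * (f z - 1)"
        unfolding 1 by (simp only: right_diff_distrib mult.assoc mult_1_right)
      also have "\<dots> = (- 1) powi n * ((f z - f 0) / z)"
        unfolding 2 by (simp add: f_def)
      finally show ?case
        unfolding z_def by (rule sym)
    qed
  qed
  then show ?thesis
    by (simp add: mult.assoc)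
qed

text \<open>By \<open>power_int_difference_tendsto\<close> the n-th difference with its weight
  factor has order z^(1 - n - 2k), unbounded for n > 1 - 2k. The largest offending exponent
  dominates; the term n = 0 is a difference of equal constants.\<close>

lemma laurent_difference_bounded_imp:
  fixes \<rho> :: "int \<Rightarrow> complex" and lam :: real and k :: nat
  assumes fin: "finite M" and lam0: "lam \<noteq> 0"
    and O1: "(\<lambda>y. (\<i> * complex_of_real y) powi (- 2 * int k) *
        (\<Sum>n\<in>M. \<rho> n * ((of_real lam - 1 / (\<i> * of_real y)) powi n - (- 1 / (\<i> * of_real y)) powi n)))
      \<in> O[at_right 0](\<lambda>_. 1)"
    and n: "n \<in> M" "n \<noteq> 0" "n > 1 - 2 * int k"
  shows "\<rho> n = 0"
proof (rule ccontr)
  assume "\<rho> n \<noteq> 0"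
  define B where "B = {n\<in>M. n \<noteq> 0 \<and> n > 1 - 2 * int k \<and> \<rho> n \<noteq> 0}"
  have B: "finite B" "B \<noteq> {}"
    using fin n \<open>\<rho> n \<noteq> 0\<close> by (auto simp: B_def)
  define m where "m = Max B"
  have mB: "m \<in> B" and m_max: "\<And>i. i \<in> B \<Longrightarrow> i \<le> m"
    using B by (auto simp: m_def)
  have m: "m \<in> M" "m \<noteq> 0" "m > 1 - 2 * int k" "\<rho> m \<noteq> 0"
    using mB by (auto simp: B_def)
  let ?z = "\<lambda>y. \<i> * complex_of_real y"
  let ?D = "\<lambda>n y. (of_real lam - 1 / ?z y) powi n - (- 1 / ?z y) powi n"
  define L where "L = - ((- 1) powi m * of_int m * complex_of_real lam)"
  have L: "L \<noteq> 0"
    using m lam0 by (simp add: L_def power_int_eq_0_iff)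
  have "((\<lambda>y. ?z y powi (m - 1 + 2 * int k) * (?z y powi (- 2 * int k) * (\<Sum>n\<in>M. \<rho> n * ?D n y))) \<longlongrightarrow> 0) (at_right 0)"
    using m by (intro bigo_1_mult_tendsto_0[OF O1] power_int_imaginary_tendsto_0) auto
  then have lim0: "((\<lambda>y. \<Sum>n\<in>M. \<rho> n * (?z y powi (m - 1) * ?D n y)) \<longlongrightarrow> 0) (at_right 0)"
  proof (rule Lim_transform_eventually)
    show "\<forall>\<^sub>F y in at_right 0. ?z y powi (m - 1 + 2 * int k) * (?z y powi (- 2 * int k) * (\<Sum>n\<in>M. \<rho> n * ?D n y)) =
        (\<Sum>n\<in>M. \<rho> n * (?z y powi (m - 1) * ?D n y))"
      using eventually_at_right_less[of 0]
    proof eventually_elim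
      case (elim y)
      then have "?z y powi (m - 1 + 2 * int k) * ?z y powi (- 2 * int k) = ?z y powi (m - 1)"
        by (subst power_int_add[symmetric]) auto
      then have "?z y powi (m - 1 + 2 * int k) * (?z y powi (- 2 * int k) * (\<Sum>n\<in>M. \<rho> n * ?D n y))
          = ?z y powi (m - 1) * (\<Sum>n\<in>M. \<rho> n * ?D n y)"
        by (simp only: mult.assoc[symmetric])
      also have "\<dots> = (\<Sum>n\<in>M. \<rho> n * (?z y powi (m - 1) * ?D n y))"
        unfolding sum_distrib_left by (intro sum.cong refl) (simp only: mult_ac)
      finally show ?case .
    qed
  qed
  have "((\<lambda>y. \<Sum>n\<in>M. \<rho> n * (?z y powi (m - 1) * ?D n y)) \<longlongrightarrow> (\<Sum>n\<in>M. if n = m then \<rho> m * L else 0)) (at_right 0)"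
  proof (rule tendsto_sum)
    fix i assume i: "i \<in> M"
    show "((\<lambda>y. \<rho> i * (?z y powi (m - 1) * ?D i y)) \<longlongrightarrow> (if i = m then \<rho> m * L else 0)) (at_right 0)"
    proof (cases "i = m")
      case True
      then show ?thesis
        using tendsto_mult[OF tendsto_const[of "\<rho> m"] power_int_difference_tendsto[of m lam]]
        by (simp add: L_def)
    next
      case False
      show ?thesis
      proof (cases "\<rho> i = 0 \<or> i = 0")
        case True
        then show ?thesis
          using False by auto
      next
        case nz: False
        have "i < m"
        proof (rule ccontr)
          assume "\<not> i < m"
          then have "i \<in> B"
            using i m nz False by (auto simp: B_def)
          then show False
            using m_max[of i] \<open>\<not> i < m\<close> False by simp
        qed
        have "((\<lambda>y. \<rho> i * (?z y powi (m - i) * (?z y powi (i - 1) * ?D i y)))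
            \<longlongrightarrow> \<rho> i * (0 * - ((- 1) powi i * of_int i * of_real lam))) (at_right 0)"
          using \<open>i < m\<close> by (intro tendsto_mult tendsto_const power_int_imaginary_tendsto_0 power_int_difference_tendsto) auto
        then have "((\<lambda>y. \<rho> i * (?z y powi (m - i) * (?z y powi (i - 1) * ?D i y))) \<longlongrightarrow> 0) (at_right 0)"
          by simp
        then have "((\<lambda>y. \<rho> i * (?z y powi (m - 1) * ?D i y)) \<longlongrightarrow> 0) (at_right 0)"
        proof (rule Lim_transform_eventually)
          show "\<forall>\<^sub>F y in at_right 0. \<rho> i * (?z y powi (m - i) * (?z y powi (i - 1) * ?D i y)) = \<rho> i * (?z y powi (m - 1) * ?D i y)"
            using eventually_at_right_less[of 0]
          proof eventually_elim
            case (elim y)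
            then have "?z y powi (m - i) * ?z y powi (i - 1) = ?z y powi (m - 1)"
              by (subst power_int_add[symmetric]) auto
            then show ?case
              by (simp only: mult.assoc[symmetric])
          qed
        qed
        then show ?thesis
          using False by simp
      qed
    qed
  qed
  also have "(\<Sum>n\<in>M. if n = m then \<rho> m * L else 0) = \<rho> m * L"
    using fin m by simp
  finally have "\<rho> m * L = 0"
    using lim0 tendsto_unique trivial_limit_at_right_real by blast
  with m L show False
    by simp
qed

text \<open>\<open>den j\<close> is the factor of automorphy of U^j, U = S T, and
  \<open>den (Suc j) / den j\<close> is U^j z. Periodicity gives F|U = F|T, hence q|U^j = F|U^(j+1)
  - F|U^j, and the sum telescopes.\<close>

lemma period_cocycle:
  fixes F q :: "complex \<Rightarrow> complex" and p k :: nat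
  assumes p: "p \<ge> 3"
    and F_per: "\<And>z. Im z > 0 \<Longrightarrow> F (z + of_real (hecke_lambda p)) = F z"
    and F_T: "\<And>z. Im z > 0 \<Longrightarrow> z powi (- 2 * int k) * F (- 1 / z) = F z + q z"
    and z: "Im z > 0"
  defines "den \<equiv> \<lambda>j::nat. of_real (sin_ratio p (int j)) * z - of_real (sin_ratio p (int j - 1))"
  shows "(\<Sum>j<p. den j powi (- 2 * int k) * q (den (Suc j) / den j)) = 0"
proof -
  have den0: "den 0 = 1" "den 1 = z"
    using p by (simp_all add: den_def)
  have rec: "den (Suc (Suc j)) = of_real (hecke_lambda p) * den (Suc j) - den j" for j
  proof -
    have a: "sin_ratio p (int (Suc (Suc j))) = hecke_lambda p * sin_ratio p (int (Suc j)) - sin_ratio p (int j)"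
      using sin_ratio_rec[OF p, of "int (Suc j)"] by (simp add: algebra_simps)
    have b: "sin_ratio p (int (Suc (Suc j)) - 1) = hecke_lambda p * sin_ratio p (int (Suc j) - 1) - sin_ratio p (int j - 1)"
      using sin_ratio_rec[OF p, of "int j"] by (simp add: algebra_simps)
    show ?thesis
      unfolding den_def a b by (simp add: algebra_simps)
  qed
  have inv: "den j \<noteq> 0 \<and> Im (den (Suc j) / den j) > 0" for j
  proof (induction j)
    case 0
    then show ?case
      using z den0 by simp
  next
    case (Suc j)
    define w where "w = den (Suc j) / den j"
    have w: "Im w > 0" "w \<noteq> 0"
      using Suc by (auto simp: w_def)
    have nz: "den (Suc j) \<noteq> 0"
      using w Suc by (auto simp: w_def)
    have "den (Suc (Suc j)) / den (Suc j) = of_real (hecke_lambda p) - 1 / w"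
      using nz Suc by (simp add: rec w_def field_simps)
    moreover have "Im (- 1 / w) > 0"
      using w by (simp add: Im_divide sum_power2_gt_zero_iff complex_eq_iff)
    ultimately show ?case
      using nz by simp
  qed
  define \<psi> where "\<psi> = (\<lambda>j. den j powi (- 2 * int k) * F (den (Suc j) / den j))"
  have step: "\<psi> (Suc j) - \<psi> j = den j powi (- 2 * int k) * q (den (Suc j) / den j)" for j
  proof -
    define w where "w = den (Suc j) / den j"
    have w: "Im w > 0" "w \<noteq> 0" and nz: "den j \<noteq> 0" "den (Suc j) \<noteq> 0"
      using inv[of j] inv[of "Suc j"] by (auto simp: w_def)
    have dw: "den (Suc j) = den j * w"
      using nz by (simp add: w_def)
    have quot: "den (Suc (Suc j)) / den (Suc j) = - 1 / w + of_real (hecke_lambda p)"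
      using nz by (simp add: rec w_def field_simps)
    have "Im (- 1 / w) > 0"
      using w by (simp add: Im_divide sum_power2_gt_zero_iff complex_eq_iff)
    then have "\<psi> (Suc j) = den (Suc j) powi (- 2 * int k) * F (- 1 / w)"
      unfolding \<psi>_def quot by (simp only: F_per)
    also have "\<dots> = den j powi (- 2 * int k) * (w powi (- 2 * int k) * F (- 1 / w))"
      unfolding dw power_int_mult_distrib by (simp only: mult.assoc)
    also have "\<dots> = den j powi (- 2 * int k) * (F w + q w)"
      by (simp only: F_T[OF w(1)])
    finally show ?thesis
      by (simp add: \<psi>_def w_def algebra_simps)
  qed
  have "(\<Sum>j<p. den j powi (- 2 * int k) * q (den (Suc j) / den j)) = (\<Sum>j<p. \<psi> (Suc j) - \<psi> j)"
    by (simp only: step)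
  also have "\<dots> = \<psi> p - \<psi> 0"
    by (rule sum_lessThan_telescope)
  also have "\<psi> p = \<psi> 0"
  proof -
    \<comment> \<open>U^p = -1: numerator and denominator both change sign, which the even weight
      does not see.\<close>
    have "sin_ratio p (1 + int p) = -1"
      using sin_ratio_p_plus_1[OF p] by (simp add: add.commute)
    then have "den p = -1" "den (Suc p) = - z"
      using p by (simp_all add: den_def)
    then show ?thesis
      using den0 by (simp add: \<psi>_def power_int_minus)
  qed
  finally show ?thesis
    by simp
qed

text \<open>The difference of the U and T relations removes every exponent n > 1 - 2k except 0. The
  T relation pairs n with -n - 2k and so removes n < -2k. There remain 0 and -2k, with opposite
  coefficients, and 1 - 2k, whose partner -1 is already excluded unless k = 1, where the two
  coincide and the coefficient stays free.\<close>

lemma laurent_part_form: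
  fixes F q h :: "complex \<Rightarrow> complex" and p k :: nat and \<rho> :: "int \<Rightarrow> complex" and N :: "int set"
  defines "lam \<equiv> hecke_lambda p"
  assumes p: "p \<ge> 3" and k: "k \<ge> 1"
    and F_per: "\<And>z. Im z > 0 \<Longrightarrow> F (z + of_real lam) = F z"
    and F_T: "\<And>z. Im z > 0 \<Longrightarrow> z powi (- 2 * int k) * F (- 1 / z) = F z + q z"
    and fin: "finite N" and q: "\<And>z. q z = h z + (\<Sum>n\<in>N. \<rho> n * z powi n)"
    and q_cont: "\<And>j. 2 \<le> j \<Longrightarrow> j < p \<Longrightarrow> isCont q (of_real (sin_ratio p (int j) / sin_ratio p (int j - 1)))"
    and h1: "(\<lambda>y. h (\<i> * of_real y)) \<in> O[at_right 0](\<lambda>_. 1)"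
    and h2: "(\<lambda>y. (\<i> * of_real y) powi (- 2 * int k) * h (- 1 / (\<i> * of_real y))) \<in> O[at_right 0](\<lambda>_. 1)"
    and h3: "(\<lambda>y. (\<i> * of_real y) powi (- 2 * int k) * h (of_real lam - 1 / (\<i> * of_real y))) \<in> O[at_right 0](\<lambda>_. 1)"
  shows "\<exists>\<nu> \<eta>. \<forall>z. z \<noteq> 0 \<longrightarrow>
    (\<Sum>n\<in>N. \<rho> n * z powi n) = \<nu> * (1 - z powi (- 2 * int k)) + (if k = 1 then \<eta> * z powi (- 1) else 0)"
proof -
  have lam0: "lam \<noteq> 0"
    using hecke_lambda_pos[OF p] by (simp add: lam_def)
  \<comment> \<open>The index set is made closed under n -> -n - 2k and includes the exceptional
    exponents; \<open>r\<close> extends the coefficients by 0.\<close>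
  define M where "M = N \<union> (\<lambda>n. - n - 2 * int k) ` N \<union> {0, - 1, - 2 * int k, 1 - 2 * int k}"
  define r where "r = (\<lambda>n. if n \<in> N then \<rho> n else 0)"
  have finM: "finite M"
    using fin by (simp add: M_def)
  have M_refl: "- n - 2 * int k \<in> M" if "n \<in> M" for n
    using that by (auto simp: M_def image_iff)
  define g where "g = (\<lambda>z. \<Sum>n\<in>M. r n * z powi n)"
  have g: "(\<Sum>n\<in>N. \<rho> n * z powi n) = g z" for z
    unfolding g_def r_def using finM by (intro sum.mono_neutral_cong_left) (auto simp: M_def)
  have q: "q z = h z + g z" for z
    by (simp add: q g)
  let ?z = "\<lambda>y. \<i> * complex_of_real y"
  have qT: "z powi (- 2 * int k) * q (- 1 / z) + q z = 0" if z: "Im z > 0" for z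
  proof -
    have z0: "z \<noteq> 0"
      using z by auto
    have "Im (- 1 / z) > 0"
      using z z0 by (simp add: Im_divide sum_power2_gt_zero_iff complex_eq_iff)
    from F_T[OF this] have "(- 1 / z) powi (- 2 * int k) * F z = F (- 1 / z) + q (- 1 / z)"
      using z0 by simp
    then have "z powi (- 2 * int k) * ((- 1 / z) powi (- 2 * int k) * F z) = z powi (- 2 * int k) * (F (- 1 / z) + q (- 1 / z))"
      by simp
    moreover have "z powi (- 2 * int k) * (- 1 / z) powi (- 2 * int k) = 1"
    proof -
      have "z * (- 1 / z) = - 1"
        using z0 by simp
      then have "z powi (- 2 * int k) * (- 1 / z) powi (- 2 * int k) = (- 1) powi (- 2 * int k)"
        by (metis power_int_mult_distrib)
      also have "\<dots> = 1"
        by (simp add: power_int_minus)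
      finally show ?thesis .
    qed
    ultimately have "F z = z powi (- 2 * int k) * F (- 1 / z) + z powi (- 2 * int k) * q (- 1 / z)"
      by (simp add: mult.assoc[symmetric] ring_distribs)
    then show ?thesis
      using F_T[OF z] by (simp add: algebra_simps)
  qed
  have O_q: "(\<lambda>y. q (?z y) + ?z y powi (- 2 * int k) * q (of_real lam - 1 / ?z y)) \<in> O[at_right 0](\<lambda>_. 1)"
  proof -
    define den where "den = (\<lambda>y j. of_real (sin_ratio p (int j)) * ?z y - complex_of_real (sin_ratio p (int j - 1)))"
    \<comment> \<open>For 2 <= j < p the point U^j z tends to a cusp at which q is continuous, and
      \<open>den\<close> tends to a nonzero number, so these terms are bounded.\<close>
    have rest: "(\<lambda>y. \<Sum>j\<in>{2..<p}. den y j powi (- 2 * int k) * q (den y (Suc j) / den y j)) \<in> O[at_right 0](\<lambda>_. 1)"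
    proof (rule big_sum_in_bigo)
      fix j assume "j \<in> {2..<p}"
      then have j: "2 \<le> j" "j < p"
        by auto
      have s: "sin_ratio p (int j - 1) \<noteq> 0"
        using sin_ratio_ge_1[OF p, of "int j - 1"] j by auto
      have d1: "((\<lambda>y. den y j) \<longlongrightarrow> - of_real (sin_ratio p (int j - 1))) (at_right 0)"
        unfolding den_def by (auto intro!: tendsto_eq_intros)
      have d2: "((\<lambda>y. den y (Suc j)) \<longlongrightarrow> - of_real (sin_ratio p (int j))) (at_right 0)"
        unfolding den_def by (auto intro!: tendsto_eq_intros)
      have "((\<lambda>y. den y (Suc j) / den y j) \<longlongrightarrow> of_real (sin_ratio p (int j) / sin_ratio p (int j - 1))) (at_right 0)"
        using tendsto_divide[OF d2 d1] s by simp
      then have A: "((\<lambda>y. q (den y (Suc j) / den y j)) \<longlongrightarrow> q (of_real (sin_ratio p (int j) / sin_ratio p (int j - 1)))) (at_right 0)"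
        by (rule isCont_tendsto_compose[OF q_cont[OF j]])
      have B: "((\<lambda>y. den y j powi (- 2 * int k)) \<longlongrightarrow> (- of_real (sin_ratio p (int j - 1))) powi (- 2 * int k)) (at_right 0)"
        using s by (intro tendsto_power_int d1) auto
      show "(\<lambda>y. den y j powi (- 2 * int k) * q (den y (Suc j) / den y j)) \<in> O[at_right 0](\<lambda>_. 1)"
        by (rule tendsto_imp_bigo_1[OF tendsto_mult[OF B A]])
    qed
    have "eventually (\<lambda>y. q (?z y) + ?z y powi (- 2 * int k) * q (of_real lam - 1 / ?z y) =
        - (\<Sum>j\<in>{2..<p}. den y j powi (- 2 * int k) * q (den y (Suc j) / den y j))) (at_right 0)"
      using eventually_at_right_less[of 0]
    proof eventually_elim
      case (elim y)
      let ?t = "\<lambda>j. den y j powi (- 2 * int k) * q (den y (Suc j) / den y j)"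
      have Im: "Im (?z y) > 0" and z0: "?z y \<noteq> 0"
        using elim by auto
      have "(\<Sum>j<p. ?t j) = 0"
        unfolding den_def by (rule period_cocycle[OF p F_per[unfolded lam_def] F_T Im])
      moreover have "{..<p} = {0, 1} \<union> {2..<p}"
        using p by auto
      ultimately have "?t 0 + ?t 1 + (\<Sum>j\<in>{2..<p}. ?t j) = 0"
        by (simp add: sum.union_disjoint add.assoc)
      moreover have "den y 0 = 1" "den y 1 = ?z y" "den y 2 = of_real lam * ?z y - 1"
        using p sin_ratio_rec[OF p, of 1] by (simp_all add: den_def lam_def)
      moreover have "(of_real lam * ?z y - 1) / ?z y = of_real lam - 1 / ?z y"
        using z0 by (simp add: field_simps)
      ultimately show ?case
        by (simp add: numeral_2_eq_2 add_eq_0_iff2)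
    qed
    from landau_o.big.in_cong[OF this] show ?thesis
      using rest by simp
  qed
  have O_T: "(\<lambda>y. q (?z y) + ?z y powi (- 2 * int k) * q (- 1 / ?z y)) \<in> O[at_right 0](\<lambda>_. 1)"
  proof -
    have "eventually (\<lambda>y. q (?z y) + ?z y powi (- 2 * int k) * q (- 1 / ?z y) = 0) (at_right 0)"
      using eventually_at_right_less[of 0]
      by eventually_elim (subst add.commute, rule qT, simp)
    from landau_o.big.in_cong[OF this] show ?thesis
      by simp
  qed
  \<comment> \<open>In the difference of the two relations q itself drops out and the terms with h
    are bounded; what stays is the Laurent part at \<lambda> - 1/z minus that at -1/z, with the
    weight factor.\<close>
  have zero: "r n = 0" if n: "n \<in> M" "n \<noteq> 0" "n > 1 - 2 * int k" for n
  proof (rule laurent_difference_bounded_imp[OF finM lam0 _ n])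
    have "(\<lambda>y. (q (?z y) + ?z y powi (- 2 * int k) * q (of_real lam - 1 / ?z y)) -
        (q (?z y) + ?z y powi (- 2 * int k) * q (- 1 / ?z y)) -
        (?z y powi (- 2 * int k) * h (of_real lam - 1 / ?z y)) + (?z y powi (- 2 * int k) * h (- 1 / ?z y)))
        \<in> O[at_right 0](\<lambda>_. 1)"
      by (intro sum_in_bigo O_q O_T h2 h3)
    then show "(\<lambda>y. ?z y powi (- 2 * int k) * (\<Sum>n\<in>M. r n * ((of_real lam - 1 / ?z y) powi n - (- 1 / ?z y) powi n)))
        \<in> O[at_right 0](\<lambda>_. 1)"
      by (simp add: q g_def sum_subtractf algebra_simps)
  qed
  \<comment> \<open>The coefficient of z^n in g + g|T.\<close>
  define \<sigma> where "\<sigma> = (\<lambda>n. r n + (- 1) powi n * r (- n - 2 * int k))"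
  have \<sigma>: "\<sigma> n = 0" if n: "n \<in> M" "n < 0" for n
  proof (rule laurent_sum_bounded_imp[OF finM _ n])
    have "(\<lambda>y. (q (?z y) + ?z y powi (- 2 * int k) * q (- 1 / ?z y)) - h (?z y) - (?z y powi (- 2 * int k) * h (- 1 / ?z y)))
        \<in> O[at_right 0](\<lambda>_. 1)"
      by (intro sum_in_bigo O_T h1 h2)
    then have *: "(\<lambda>y. g (?z y) + ?z y powi (- 2 * int k) * g (- 1 / ?z y)) \<in> O[at_right 0](\<lambda>_. 1)"
      by (simp add: q algebra_simps)
    have "eventually (\<lambda>y. (\<Sum>n\<in>M. \<sigma> n * ?z y powi n) = g (?z y) + ?z y powi (- 2 * int k) * g (- 1 / ?z y)) (at_right 0)"
      using eventually_at_right_less[of 0]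
    proof eventually_elim
      case (elim y)
      define z where "z = ?z y"
      have z: "z \<noteq> 0"
        using elim by (simp add: z_def)
      have "z powi (- 2 * int k) * g (- 1 / z) = (\<Sum>n\<in>M. r n * ((- 1) powi n * z powi (- n - 2 * int k)))"
        unfolding g_def sum_distrib_left
      proof (rule sum.cong[OF refl])
        fix n
        have e1: "(- 1 / z) powi n = (- 1) powi n * z powi (- n)"
        proof -
          have "(- 1 / z) powi n = (- 1) powi n / z powi n"
            by (rule power_int_divide_distrib)
          then show ?thesis
            by (simp only: power_int_minus divide_inverse)
        qed
        have e2: "z powi (- n - 2 * int k) = z powi (- 2 * int k) * z powi (- n)"
          using z by (subst power_int_add[symmetric]) (auto simp: algebra_simps)
        show "z powi (- 2 * int k) * (r n * (- 1 / z) powi n) = r n * ((- 1) powi n * z powi (- n - 2 * int k))"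
          unfolding e1 e2 by (simp only: mult_ac)
      qed
      also have "\<dots> = (\<Sum>n\<in>M. (- 1) powi n * r (- n - 2 * int k) * z powi n)"
      proof (rule sum.reindex_bij_witness[of _ "\<lambda>n. - n - 2 * int k" "\<lambda>n. - n - 2 * int k"])
        fix n assume "n \<in> M"
        have "(- 1 :: complex) powi (- n - 2 * int k) = (- 1) powi n"
        proof (cases "even n")
          case True
          then show ?thesis
            by (simp add: power_int_minus_left)
        next
          case False
          then show ?thesis
            by (simp add: power_int_minus_left)
        qed
        then show "(- 1) powi (- n - 2 * int k) * r (- (- n - 2 * int k) - 2 * int k) * z powi (- n - 2 * int k)
            = r n * ((- 1) powi n * z powi (- n - 2 * int k))"
          by simp
      qed (auto intro: M_refl)
      finally show ?case
        unfolding z_def[symmetric] g_def \<sigma>_def by (simp add: ring_distribs sum.distrib)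
    qed
    from landau_o.big.in_cong[OF this] show "(\<lambda>y. \<Sum>n\<in>M. \<sigma> n * ?z y powi n) \<in> O[at_right 0](\<lambda>_. 1)"
      using * by simp
  qed
  have inM: "0 \<in> M" "- 1 \<in> M" "- 2 * int k \<in> M" "1 - 2 * int k \<in> M"
    by (auto simp: M_def)
  have r_outside: "r n = 0" if "n \<notin> M" for n
    using that by (auto simp: r_def M_def)
  have r_pos: "r n = 0" if "n \<noteq> 0" "n > 1 - 2 * int k" for n
    using zero[of n] r_outside[of n] that by blast
  have r_low: "r n = 0" if "n < - 2 * int k" for n
  proof (cases "n \<in> M")
    case True
    have "r (- n - 2 * int k) = 0"
      using that k by (intro r_pos) auto
    then show ?thesis
      using \<sigma>[OF True] that by (simp add: \<sigma>_def)
  qed (rule r_outside)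
  have r_2k: "r (- 2 * int k) = - r 0"
    using \<sigma>[OF inM(3)] k by (simp add: \<sigma>_def power_int_minus add_eq_0_iff2)
  have r_1: "r (1 - 2 * int k) = 0" if "k \<noteq> 1"
  proof -
    have "r (- 1) = 0"
      using that k by (intro r_pos) auto
    then show ?thesis
      using \<sigma>[OF inM(4)] k by (simp add: \<sigma>_def)
  qed
  define \<eta> where "\<eta> = r (- 1)"
  have "g z = r 0 * (1 - z powi (- 2 * int k)) + (if k = 1 then \<eta> * z powi (- 1) else 0)" if z: "z \<noteq> 0" for z
  proof -
    have "g z = (\<Sum>n\<in>{0, - 2 * int k, 1 - 2 * int k}. r n * z powi n)"
      unfolding g_def
    proof (rule sum.mono_neutral_right[OF finM])
      show "{0, - 2 * int k, 1 - 2 * int k} \<subseteq> M"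
        using inM by auto
      show "\<forall>n\<in>M - {0, - 2 * int k, 1 - 2 * int k}. r n * z powi n = 0"
      proof
        fix n assume n: "n \<in> M - {0, - 2 * int k, 1 - 2 * int k}"
        then have "n > 1 - 2 * int k \<or> n < - 2 * int k"
          by auto
        then show "r n * z powi n = 0"
          using n r_pos[of n] r_low[of n] by auto
      qed
    qed
    also have "\<dots> = r 0 + r (- 2 * int k) * z powi (- 2 * int k) + r (1 - 2 * int k) * z powi (1 - 2 * int k)"
      using k by (subst sum.insert; simp)+
    also have "\<dots> = r 0 * (1 - z powi (- 2 * int k)) + (if k = 1 then \<eta> * z powi (- 1) else 0)"
      using r_2k r_1 by (auto simp: \<eta>_def algebra_simps)
    finally show ?thesis .
  qed
  then show ?thesis
    unfolding g by blast
qed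

section \<open>Poles and rationality\<close>

lemma isCont_pole_kernel:
  assumes "z \<noteq> of_real \<alpha>" "z \<noteq> of_real \<beta>"
  shows "isCont (pole_kernel k \<alpha> \<beta>) z"
  unfolding pole_kernel_def using assms by (intro continuous_intros) auto

lemma holomorphic_on_pole_kernel:
  assumes "of_real \<alpha> \<notin> A" "of_real \<beta> \<notin> A"
  shows "pole_kernel k \<alpha> \<beta> holomorphic_on A"
  unfolding pole_kernel_def using assms by (intro holomorphic_intros) auto

lemma is_pole_pole_kernel:
  assumes "\<alpha> \<noteq> \<beta>" "k \<ge> 1" "C \<noteq> 0"
  shows "is_pole (\<lambda>z. C * pole_kernel k \<alpha> \<beta> z) (of_real \<alpha>)"
    "is_pole (\<lambda>z. C * pole_kernel k \<alpha> \<beta> z) (of_real \<beta>)"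
proof -
  have "is_pole (\<lambda>z. (C * of_real (\<alpha> - \<beta>) ^ k / (z - of_real \<beta>) ^ k) / (z - of_real \<alpha>) ^ k) (of_real \<alpha>)"
    using assms by (intro is_pole_basic[where A = "- {of_real \<beta>}"] holomorphic_intros) auto
  then show "is_pole (\<lambda>z. C * pole_kernel k \<alpha> \<beta> z) (of_real \<alpha>)"
    unfolding pole_kernel_def by (simp add: mult.commute)
  have "is_pole (\<lambda>z. (C * of_real (\<alpha> - \<beta>) ^ k / (z - of_real \<alpha>) ^ k) / (z - of_real \<beta>) ^ k) (of_real \<beta>)"
    using assms by (intro is_pole_basic[where A = "- {of_real \<alpha>}"] holomorphic_intros) auto
  then show "is_pole (\<lambda>z. C * pole_kernel k \<alpha> \<beta> z) (of_real \<beta>)"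
    unfolding pole_kernel_def by simp
qed

text \<open>No two kernels share a pole: the points of Z are positive, their conjugates negative and
  pairwise distinct. So nothing cancels, and each kernel with nonzero coefficient keeps both
  poles.\<close>

lemma is_pole_kernel_sum_iff:
  fixes Z :: "real set" and cj :: "real \<Rightarrow> real" and C :: "real \<Rightarrow> complex"
  assumes fin: "finite Z" and k: "k \<ge> 1"
    and signs: "\<And>\<alpha>. \<alpha> \<in> Z \<Longrightarrow> \<alpha> > 0" "\<And>\<alpha>. \<alpha> \<in> Z \<Longrightarrow> cj \<alpha> < 0"
    and inj: "inj_on cj Z" and r: "isCont r z"
  shows "is_pole (\<lambda>z. (\<Sum>\<alpha>\<in>Z. C \<alpha> * pole_kernel k \<alpha> (cj \<alpha>) z) + r z) z \<longleftrightarrow>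
    (\<exists>\<alpha>\<in>Z. C \<alpha> \<noteq> 0 \<and> (z = of_real \<alpha> \<or> z = of_real (cj \<alpha>)))"
proof
  assume pole: "is_pole (\<lambda>z. (\<Sum>\<alpha>\<in>Z. C \<alpha> * pole_kernel k \<alpha> (cj \<alpha>) z) + r z) z"
  show "\<exists>\<alpha>\<in>Z. C \<alpha> \<noteq> 0 \<and> (z = of_real \<alpha> \<or> z = of_real (cj \<alpha>))"
  proof (rule ccontr)
    assume no: "\<not> ?thesis"
    have "isCont (\<lambda>z. C \<alpha> * pole_kernel k \<alpha> (cj \<alpha>) z) z" if "\<alpha> \<in> Z" for \<alpha>
    proof (cases "C \<alpha> = 0")
      case False
      then show ?thesis
        using no that by (intro continuous_intros isCont_pole_kernel) auto
    qed simp
    then have "isCont (\<lambda>z. (\<Sum>\<alpha>\<in>Z. C \<alpha> * pole_kernel k \<alpha> (cj \<alpha>) z) + r z) z"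
      by (intro continuous_add continuous_sum r)
    then show False
      using pole not_tendsto_and_filterlim_at_infinity[of "at z"] by (auto simp: isCont_def is_pole_def)
  qed
next
  assume "\<exists>\<alpha>\<in>Z. C \<alpha> \<noteq> 0 \<and> (z = of_real \<alpha> \<or> z = of_real (cj \<alpha>))"
  then obtain \<alpha>0 where \<alpha>0: "\<alpha>0 \<in> Z" "C \<alpha>0 \<noteq> 0" and z: "z = of_real \<alpha>0 \<or> z = of_real (cj \<alpha>0)"
    by blast
  have "isCont (\<lambda>z. C \<alpha> * pole_kernel k \<alpha> (cj \<alpha>) z) z" if \<alpha>: "\<alpha> \<in> Z - {\<alpha>0}" for \<alpha>
  proof -
    have "cj \<alpha> \<noteq> cj \<alpha>0"
      using \<alpha> \<alpha>0 inj by (auto simp: inj_on_def)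
    then have "z \<noteq> of_real \<alpha>" "z \<noteq> of_real (cj \<alpha>)"
      using z signs(1)[of \<alpha>] signs(2)[of \<alpha>] signs(1)[of \<alpha>0] signs(2)[of \<alpha>0] \<alpha> \<alpha>0 by auto
    then show ?thesis
      by (intro continuous_intros isCont_pole_kernel)
  qed
  then have "isCont (\<lambda>z. (\<Sum>\<alpha>\<in>Z - {\<alpha>0}. C \<alpha> * pole_kernel k \<alpha> (cj \<alpha>) z) + r z) z"
    by (intro continuous_add continuous_sum r)
  then have lim: "((\<lambda>z. (\<Sum>\<alpha>\<in>Z - {\<alpha>0}. C \<alpha> * pole_kernel k \<alpha> (cj \<alpha>) z) + r z)
      \<longlongrightarrow> (\<Sum>\<alpha>\<in>Z - {\<alpha>0}. C \<alpha> * pole_kernel k \<alpha> (cj \<alpha>) z) + r z) (at z)"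
    by (simp add: isCont_def)
  have "\<alpha>0 \<noteq> cj \<alpha>0"
    using signs(1)[OF \<alpha>0(1)] signs(2)[OF \<alpha>0(1)] by simp
  then have "is_pole (\<lambda>z. C \<alpha>0 * pole_kernel k \<alpha>0 (cj \<alpha>0) z) z"
    using z is_pole_pole_kernel[of \<alpha>0 "cj \<alpha>0" k "C \<alpha>0"] k \<alpha>0 by auto
  then have "is_pole (\<lambda>z. ((\<Sum>\<alpha>\<in>Z - {\<alpha>0}. C \<alpha> * pole_kernel k \<alpha> (cj \<alpha>) z) + r z) + C \<alpha>0 * pole_kernel k \<alpha>0 (cj \<alpha>0) z) z"
    unfolding is_pole_def by (rule tendsto_add_filterlim_at_infinity[OF lim])
  moreover have "((\<Sum>\<alpha>\<in>Z - {\<alpha>0}. C \<alpha> * pole_kernel k \<alpha> (cj \<alpha>) w) + r w) + C \<alpha>0 * pole_kernel k \<alpha>0 (cj \<alpha>0) w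
      = (\<Sum>\<alpha>\<in>Z. C \<alpha> * pole_kernel k \<alpha> (cj \<alpha>) w) + r w" for w
    using sum.remove[OF fin \<alpha>0(1), of "\<lambda>\<alpha>. C \<alpha> * pole_kernel k \<alpha> (cj \<alpha>) w"] by simp
  ultimately show "is_pole (\<lambda>z. (\<Sum>\<alpha>\<in>Z. C \<alpha> * pole_kernel k \<alpha> (cj \<alpha>) z) + r z) z"
    by simp
qed

text \<open>On the imaginary axis norm (z - \<beta>) is at least - \<beta>. The factor at \<alpha>
  leaves a beta kernel of order k at s = 1/2, which decays exponentially in both directions.\<close>

lemma pole_kernel_line_bound:
  assumes ab: "\<alpha> > 0" "\<beta> < 0" and k: "k \<ge> 1"
  shows "\<exists>K. \<forall>x. norm (pole_kernel k \<alpha> \<beta> (\<i> * of_real (exp x))) * exp (1 / 2 * x) \<le> K * exp (- (1 / 2) * \<bar>x\<bar>)"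
proof -
  define c where "c = \<i> * complex_of_real \<alpha>"
  have c: "Re c \<ge> 0" "c \<noteq> 0"
    using ab by (auto simp: c_def)
  define D where "D = ((\<alpha> - \<beta>) / (- \<beta>)) ^ k"
  define B where "B = 1 / (min 1 (norm c) / 2) ^ k"
  have D: "D \<ge> 0"
    unfolding D_def using ab by (intro zero_le_power divide_nonneg_nonneg) auto
  have "norm (pole_kernel k \<alpha> \<beta> (\<i> * of_real (exp x))) * exp (1 / 2 * x) \<le> D * B * exp (- (1 / 2) * \<bar>x\<bar>)" for x
  proof -
    have n1: "norm (\<i> * of_real (exp x) - complex_of_real \<alpha>) = norm (of_real (exp x) + c)"
    proof -
      have "\<i> * of_real (exp x) - complex_of_real \<alpha> = \<i> * (of_real (exp x) + c)"
        by (simp add: c_def algebra_simps)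
      then show ?thesis
        by (simp add: norm_mult)
    qed
    have n2: "norm (\<i> * of_real (exp x) - complex_of_real \<beta>) \<ge> - \<beta>"
      using abs_Re_le_cmod[of "\<i> * of_real (exp x) - complex_of_real \<beta>"] by simp
    have pos: "norm (of_real (exp x) + c) > 0"
      using exp_add_nonzero[OF c(1), of x] by simp
    have "norm (pole_kernel k \<alpha> \<beta> (\<i> * of_real (exp x))) =
        (\<alpha> - \<beta>) ^ k / (norm (of_real (exp x) + c) ^ k * norm (\<i> * of_real (exp x) - complex_of_real \<beta>) ^ k)"
      using ab by (simp only: pole_kernel_def norm_divide norm_mult norm_power n1 norm_of_real)
    also have "\<dots> \<le> (\<alpha> - \<beta>) ^ k / (norm (of_real (exp x) + c) ^ k * (- \<beta>) ^ k)"
      using ab n2 pos by (intro divide_left_mono mult_left_mono power_mono mult_pos_pos zero_less_power) auto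
    also have "\<dots> = D * (1 / norm (of_real (exp x) + c) ^ k)"
      unfolding D_def power_divide by (simp only: times_divide_times_eq mult_1_right mult.commute)
    finally have "norm (pole_kernel k \<alpha> \<beta> (\<i> * of_real (exp x))) * exp (1 / 2 * x)
        \<le> D * (1 / norm (of_real (exp x) + c) ^ k) * exp (1 / 2 * x)"
      by (intro mult_right_mono) auto
    also have "\<dots> = D * norm (exp (complex_of_real (1 / 2) * of_real x) / (of_real (exp x) + c) ^ k)"
      by (simp add: norm_divide norm_power norm_exp_eq_Re)
    also have "\<dots> \<le> D * (B * exp (- min (Re (complex_of_real (1 / 2))) (1 - Re (complex_of_real (1 / 2))) * \<bar>x\<bar>))"
      unfolding B_def using D k by (intro mult_left_mono beta_kernel_bound c) auto
    finally show ?thesis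
      by (simp add: mult.assoc)
  qed
  then show ?thesis
    by blast
qed

text \<open>The kernel has order 2k at infinity, which the weight factor exactly compensates. The
  values c = 0 and c = \<lambda> describe h|T and h|U near 0.\<close>

lemma pole_kernel_at_infinity:
  fixes c :: real
  shows "((\<lambda>y. (\<i> * of_real y) powi (- 2 * int k) * pole_kernel k \<alpha> \<beta> (of_real c - 1 / (\<i> * of_real y)))
    \<longlongrightarrow> of_real (\<alpha> - \<beta>) ^ k) (at_right 0)"
proof -
  let ?z = "\<lambda>y. \<i> * complex_of_real y"
  define f where "f = (\<lambda>z. complex_of_real (\<alpha> - \<beta>) ^ k / ((of_real (c - \<alpha>) * z - 1) ^ k * (of_real (c - \<beta>) * z - 1) ^ k))"
  have "((\<lambda>y. f (?z y)) \<longlongrightarrow> of_real (\<alpha> - \<beta>) ^ k / ((of_real (c - \<alpha>) * (\<i> * of_real 0) - 1) ^ k * (of_real (c - \<beta>) * (\<i> * of_real 0) - 1) ^ k)) (at_right 0)"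
    unfolding f_def by (intro tendsto_intros) auto
  also have "of_real (\<alpha> - \<beta>) ^ k / ((of_real (c - \<alpha>) * (\<i> * of_real 0) - 1) ^ k * (of_real (c - \<beta>) * (\<i> * of_real 0) - 1) ^ k)
      = (of_real (\<alpha> - \<beta>) ^ k :: complex)"
    by (simp flip: power_mult_distrib)
  finally show ?thesis
  proof (rule Lim_transform_eventually)
    show "\<forall>\<^sub>F y in at_right 0. f (?z y) = ?z y powi (- 2 * int k) * pole_kernel k \<alpha> \<beta> (of_real c - 1 / ?z y)"
      using eventually_at_right_less[of 0]
    proof eventually_elim
      case (elim y)
      define z where "z = ?z y"
      have z: "z \<noteq> 0"
        using elim by (simp add: z_def)
      have e: "of_real c - 1 / z - of_real a = (of_real (c - a) * z - 1) / z" for a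
        using z by (simp add: field_simps)
      have "z powi (- 2 * int k) = 1 / (z ^ k * z ^ k)"
      proof -
        have "z powi (- 2 * int k) = z powi (- int (2 * k))"
          by simp
        also have "\<dots> = inverse (z ^ (2 * k))"
          by (simp only: power_int_minus power_int_of_nat)
        also have "z ^ (2 * k) = z ^ k * z ^ k"
          by (simp only: mult_2 power_add)
        finally show ?thesis
          by (simp only: divide_inverse mult_1_left)
      qed
      then have "z powi (- 2 * int k) * pole_kernel k \<alpha> \<beta> (of_real c - 1 / z) = f z"
        unfolding pole_kernel_def e f_def power_divide using z by simp
      then show ?case
        by (simp add: z_def)
    qed
  qed
qed

section \<open>Closure properties of rational functions\<close>

lemma rational_fun_polys: "Q \<noteq> 0 \<Longrightarrow> rational_fun (\<lambda>z. poly P z / poly Q z)"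
  unfolding rational_fun_def by blast

lemma rational_fun_const: "rational_fun (\<lambda>_. c)"
  using rational_fun_polys[of 1 "[:c:]"] by simp

lemma rational_fun_add:
  assumes "rational_fun f" "rational_fun g"
  shows "rational_fun (\<lambda>z. f z + g z)"
proof -
  obtain P Q P' Q' where *: "Q \<noteq> 0" "\<And>z. poly Q z \<noteq> 0 \<Longrightarrow> f z = poly P z / poly Q z"
    "Q' \<noteq> 0" "\<And>z. poly Q' z \<noteq> 0 \<Longrightarrow> g z = poly P' z / poly Q' z"
    using assms unfolding rational_fun_def by blast
  have "f z + g z = poly (P * Q' + P' * Q) z / poly (Q * Q') z" if "poly (Q * Q') z \<noteq> 0" for z
    using * that by (simp add: field_simps)
  then show ?thesis
    unfolding rational_fun_def using *(1,3)
    by (intro exI[of _ "P * Q' + P' * Q"] exI[of _ "Q * Q'"] conjI allI impI) auto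
qed

lemma rational_fun_mult:
  assumes "rational_fun f" "rational_fun g"
  shows "rational_fun (\<lambda>z. f z * g z)"
proof -
  obtain P Q P' Q' where *: "Q \<noteq> 0" "\<And>z. poly Q z \<noteq> 0 \<Longrightarrow> f z = poly P z / poly Q z"
    "Q' \<noteq> 0" "\<And>z. poly Q' z \<noteq> 0 \<Longrightarrow> g z = poly P' z / poly Q' z"
    using assms unfolding rational_fun_def by blast
  have "f z * g z = poly (P * P') z / poly (Q * Q') z" if "poly (Q * Q') z \<noteq> 0" for z
    using * that by simp
  then show ?thesis
    unfolding rational_fun_def using *(1,3)
    by (intro exI[of _ "P * P'"] exI[of _ "Q * Q'"] conjI allI impI) auto
qed

lemma rational_fun_sum:
  assumes "\<And>i. i \<in> I \<Longrightarrow> rational_fun (f i)"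
  shows "rational_fun (\<lambda>z. \<Sum>i\<in>I. f i z)"
  using assms
  by (induction I rule: infinite_finite_induct) (auto intro: rational_fun_const rational_fun_add)

lemma rational_fun_pole_kernel: "rational_fun (pole_kernel k \<alpha> \<beta>)"
  using rational_fun_polys[of "[:- of_real \<alpha>, 1:] ^ k * [:- of_real \<beta>, 1:] ^ k" "[:of_real (\<alpha> - \<beta>) ^ k:]"]
  by (simp add: pole_kernel_def[abs_def] poly_power)

lemma rational_fun_power_int_neg: "rational_fun (\<lambda>z. z powi (- int m))"
  using rational_fun_polys[of "monom 1 m" 1] by (simp add: poly_monom power_int_minus divide_inverse)

text \<open>Where the function has a finite limit, r = 0 works; at a simple pole, r is the value of
  \<open>zor_poly\<close>, the function with the pole divided out.\<close>

lemma simple_pole_limit: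
  assumes mero: "\<Phi> meromorphic_on UNIV" and simple: "is_pole \<Phi> z \<Longrightarrow> zorder \<Phi> z = - 1"
  shows "\<exists>r. ((\<lambda>s. \<Phi> s * (s - z)) \<longlongrightarrow> r) (at z)"
proof -
  have m: "\<Phi> meromorphic_on {z}"
    using mero by (rule meromorphic_on_subset) simp
  then have iso: "isolated_singularity_at \<Phi> z"
    by (rule meromorphic_on_isolated_singularity)
  from meromorphic_on_not_essential[OF m] consider l where "(\<Phi> \<longlongrightarrow> l) (at z)" | "is_pole \<Phi> z"
    unfolding not_essential_def by blast
  then show ?thesis
  proof cases
    case 1
    then have "((\<lambda>s. \<Phi> s * (s - z)) \<longlongrightarrow> l * (z - z)) (at z)"
      by (intro tendsto_intros)
    then show ?thesis
      by blast
  next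
    case 2
    have ev: "eventually (\<lambda>w. zor_poly \<Phi> z w = \<Phi> w * (w - z)) (at z)"
      using zor_poly_pole_eq[OF iso 2] simple[OF 2] by simp
    obtain e where e: "e > 0" "\<Phi> holomorphic_on ball z e - {z}"
      using iso analytic_imp_holomorphic unfolding isolated_singularity_at_def by blast
    obtain r where r: "r > 0" "zor_poly \<Phi> z holomorphic_on cball z r"
      using zorder_exist_pole[OF e(2) open_ball _ 2] e(1) by (meson centre_in_ball)
    have "continuous_on (ball z r) (zor_poly \<Phi> z)"
      using r by (meson ball_subset_cball continuous_on_subset holomorphic_on_imp_continuous_on)
    then have "isCont (zor_poly \<Phi> z) z"
      using r by (simp add: continuous_on_eq_continuous_at)
    then have "(zor_poly \<Phi> z \<longlongrightarrow> zor_poly \<Phi> z z) (at z)"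
      by (simp add: isCont_def)
    from Lim_transform_eventually[OF this ev] show ?thesis
      by (rule exI)
  qed
qed

text \<open>The zeros i (1 + 1/n) accumulate at the interior point i, so the identity theorem
  applies.\<close>

lemma upper_half_plane_identity:
  fixes f :: "complex \<Rightarrow> complex"
  assumes holo: "f holomorphic_on {z. Im z > 0}"
    and zero: "\<And>y. y > 0 \<Longrightarrow> f (\<i> * of_real y) = 0" and z: "Im z > 0"
  shows "f z = 0"
proof -
  define U where "U = (\<lambda>y. \<i> * complex_of_real y) ` {0<..}"
  have "\<i> islimpt U"
  proof (rule islimpt_sequential[THEN iffD2], intro exI conjI allI)
    let ?f = "\<lambda>n. \<i> * complex_of_real (1 + 1 / real (Suc n))"
    show "?f n \<in> U - {\<i>}" for n
    proof -
      have "1 + 1 / real (Suc n) > 0" "1 / real (Suc n) > 0"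
        by (auto intro: add_pos_nonneg)
      then have "?f n \<in> U"
        unfolding U_def by (intro imageI) simp
      moreover have "Im (?f n) \<noteq> Im \<i>"
        using \<open>1 / real (Suc n) > 0\<close> by (simp del: of_nat_Suc)
      ultimately show ?thesis
        by (metis DiffI singletonD)
    qed
    have "(\<lambda>n. \<i> * complex_of_real (1 + 1 / real (Suc n))) \<longlonglongrightarrow> \<i> * complex_of_real (1 + 0)"
      by (intro tendsto_intros LIMSEQ_Suc[OF lim_1_over_n])
    then show "?f \<longlonglongrightarrow> \<i>"
      by simp
  qed
  moreover have "U \<subseteq> {z. Im z > 0}"
    by (auto simp: U_def)
  moreover have "f w = 0" if "w \<in> U" for w
    using that zero by (auto simp: U_def)
  moreover have "open {z. Im z > 0}" "connected {z. Im z > 0}"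
    by (rule open_halfspace_Im_gt, intro convex_connected convex_halfspace_Im_gt)
  ultimately show ?thesis
    using analytic_continuation[OF holo, of U \<i> z] z by simp
qed

section \<open>The converse theorem\<close>

lemma continuous_on_pole_kernel_line: "continuous_on UNIV (\<lambda>x. pole_kernel k \<alpha> \<beta> (\<i> * of_real (exp x)))"
proof -
  have "isCont (pole_kernel k \<alpha> \<beta>) (\<i> * of_real (exp x))" for x
    by (rule isCont_pole_kernel) (auto simp: complex_eq_iff)
  then have "continuous_on (range (\<lambda>x. \<i> * complex_of_real (exp x))) (pole_kernel k \<alpha> \<beta>)"
    by (auto simp: intro!: continuous_at_imp_continuous_on)
  then show ?thesis
    by (rule continuous_on_compose2) (auto intro!: continuous_intros)
qed

lemma pole_kernel_line_integrable:
  assumes ab: "\<alpha> > 0" "\<beta> < 0" and k: "k \<ge> 1" and s: "Re s = 1 / 2"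
  shows "integrable lborel (\<lambda>x. pole_kernel k \<alpha> \<beta> (\<i> * of_real (exp x)) * exp (s * of_real x))"
proof -
  obtain K where K: "\<And>x. norm (pole_kernel k \<alpha> \<beta> (\<i> * of_real (exp x))) * exp (1 / 2 * x) \<le> K * exp (- (1 / 2) * \<bar>x\<bar>)"
    using pole_kernel_line_bound[OF ab k] by blast
  show ?thesis
  proof (rule Bochner_Integration.integrable_bound)
    show "integrable lborel (\<lambda>x. K * exp (- (1 / 2) * \<bar>x\<bar>))"
      by (intro integrable_mult_right integrable_exp_neg_abs) simp
    have "continuous_on UNIV (\<lambda>x. pole_kernel k \<alpha> \<beta> (\<i> * of_real (exp x)) * exp (s * of_real x))"
      by (intro continuous_on_mult continuous_on_pole_kernel_line) (auto intro!: continuous_intros)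
    then show "(\<lambda>x. pole_kernel k \<alpha> \<beta> (\<i> * of_real (exp x)) * exp (s * of_real x)) \<in> borel_measurable lborel"
      using borel_measurable_continuous_onI by simp
    show "AE x in lborel. norm (pole_kernel k \<alpha> \<beta> (\<i> * of_real (exp x)) * exp (s * of_real x)) \<le> norm (K * exp (- (1 / 2) * \<bar>x\<bar>))"
    proof (rule AE_I2)
      fix x
      have "norm (pole_kernel k \<alpha> \<beta> (\<i> * of_real (exp x)) * exp (s * of_real x))
          = norm (pole_kernel k \<alpha> \<beta> (\<i> * of_real (exp x))) * exp (1 / 2 * x)"
        by (simp add: norm_mult norm_exp_eq_Re s)
      also have "\<dots> \<le> K * exp (- (1 / 2) * \<bar>x\<bar>)"
        by (rule K)
      also have "\<dots> \<le> norm (K * exp (- (1 / 2) * \<bar>x\<bar>))"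
        by simp
      finally show "norm (pole_kernel k \<alpha> \<beta> (\<i> * of_real (exp x)) * exp (s * of_real x)) \<le> norm (K * exp (- (1 / 2) * \<bar>x\<bar>))" .
    qed
  qed
qed

lemma pole_kernel_sum_line_bounded:
  fixes Z :: "real set" and cj :: "real \<Rightarrow> real" and C :: "real \<Rightarrow> complex"
  assumes fin: "finite Z" and k: "k \<ge> 1"
    and signs: "\<And>\<alpha>. \<alpha> \<in> Z \<Longrightarrow> \<alpha> > 0" "\<And>\<alpha>. \<alpha> \<in> Z \<Longrightarrow> cj \<alpha> < 0"
  shows "\<exists>K. \<forall>x. norm (\<Sum>\<alpha>\<in>Z. C \<alpha> * pole_kernel k \<alpha> (cj \<alpha>) (\<i> * of_real (exp x))) * exp (1 / 2 * x) \<le> K"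
proof -
  have "\<forall>\<alpha>\<in>Z. \<exists>K. \<forall>x. norm (pole_kernel k \<alpha> (cj \<alpha>) (\<i> * of_real (exp x))) * exp (1 / 2 * x) \<le> K * exp (- (1 / 2) * \<bar>x\<bar>)"
    using pole_kernel_line_bound signs k by blast
  then obtain K where K: "\<And>\<alpha> x. \<alpha> \<in> Z \<Longrightarrow>
      norm (pole_kernel k \<alpha> (cj \<alpha>) (\<i> * of_real (exp x))) * exp (1 / 2 * x) \<le> K \<alpha> * exp (- (1 / 2) * \<bar>x\<bar>)"
    by metis
  have "norm (\<Sum>\<alpha>\<in>Z. C \<alpha> * pole_kernel k \<alpha> (cj \<alpha>) (\<i> * of_real (exp x))) * exp (1 / 2 * x) \<le> (\<Sum>\<alpha>\<in>Z. norm (C \<alpha>) * \<bar>K \<alpha>\<bar>)" for x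
  proof -
    have "norm (\<Sum>\<alpha>\<in>Z. C \<alpha> * pole_kernel k \<alpha> (cj \<alpha>) (\<i> * of_real (exp x))) * exp (1 / 2 * x)
        \<le> (\<Sum>\<alpha>\<in>Z. norm (C \<alpha> * pole_kernel k \<alpha> (cj \<alpha>) (\<i> * of_real (exp x)))) * exp (1 / 2 * x)"
      by (intro mult_right_mono norm_sum) auto
    also have "\<dots> = (\<Sum>\<alpha>\<in>Z. norm (C \<alpha>) * (norm (pole_kernel k \<alpha> (cj \<alpha>) (\<i> * of_real (exp x))) * exp (1 / 2 * x)))"
      unfolding sum_distrib_right norm_mult by (simp only: mult.assoc)
    also have "\<dots> \<le> (\<Sum>\<alpha>\<in>Z. norm (C \<alpha>) * \<bar>K \<alpha>\<bar>)"
    proof (intro sum_mono mult_left_mono)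
      fix \<alpha> assume "\<alpha> \<in> Z"
      from K[OF this, of x] have "norm (pole_kernel k \<alpha> (cj \<alpha>) (\<i> * of_real (exp x))) * exp (1 / 2 * x) \<le> K \<alpha> * exp (- (1 / 2) * \<bar>x\<bar>)" .
      also have "\<dots> \<le> \<bar>K \<alpha>\<bar> * 1"
        by (intro mult_mono) auto
      finally show "norm (pole_kernel k \<alpha> (cj \<alpha>) (\<i> * of_real (exp x))) * exp (1 / 2 * x) \<le> \<bar>K \<alpha>\<bar>"
        by simp
    qed auto
    finally show ?thesis .
  qed
  then show ?thesis
    by blast
qed

theorem theorem3:
  fixes p k L :: nat
    and \<A> :: "nat \<Rightarrow> bqf set"
    and D :: "nat \<Rightarrow> real"
    and d :: "nat \<Rightarrow> complex"
    and a :: "nat \<Rightarrow> complex"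
    and \<gamma> :: real
    and \<phi> \<Phi> F :: "complex \<Rightarrow> complex"
  assumes p: "p \<ge> 3"
    and k: "odd k"
    and classes: "\<And>l. l \<in> {1..L} \<Longrightarrow> hyperbolic_class p (\<A> l)"
    and symm: "\<And>l. l \<in> {1..L} \<Longrightarrow> \<A> l = bqf_neg ` \<A> l"
    and disc: "\<And>l Q. l \<in> {1..L} \<Longrightarrow> Q \<in> \<A> l \<Longrightarrow> bqf_disc Q = D l"
    and abs_conv: "\<And>s. Re s > \<gamma> \<Longrightarrow>
          summable (\<lambda>n. norm (a (Suc n) * of_nat (Suc n) powr (- s)))"
    and \<phi>: "\<And>s. Re s > \<gamma> \<Longrightarrow> \<phi> s = (\<Sum>n. a (Suc n) * of_nat (Suc n) powr (- s))"
    and \<Phi>: "\<And>s. Re s > \<gamma> \<Longrightarrow> s \<notin> \<int>\<^sub>\<le>\<^sub>0 \<Longrightarrow>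
          \<Phi> s = of_real (2 * pi / hecke_lambda p) powr (- s) * Gamma s * \<phi> s"
    and mero: "\<Phi> meromorphic_on UNIV"
    and holo: "\<Phi> holomorphic_on (- \<int>)"
    and simple_poles: "\<And>n. n \<in> \<int> \<Longrightarrow> is_pole \<Phi> n \<Longrightarrow> zorder \<Phi> n = - 1"
    and bdd: "\<And>\<sigma>\<^sub>1 \<sigma>\<^sub>2 t\<^sub>0. t\<^sub>0 > 0 \<Longrightarrow> bounded (\<Phi> ` lacunary_strip \<sigma>\<^sub>1 \<sigma>\<^sub>2 t\<^sub>0)"
    and func_eq: "\<And>s. s \<notin> \<int> \<Longrightarrow>
          \<Phi> (2 * of_nat k - s) + \<Phi> s =
          - (\<Sum>l=1..L. d l * of_real (D l powr (- real k / 2)) * pow_branch \<i> s *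
              (\<Sum>\<alpha>\<in>simple_roots (\<A> l).
                 pow_branch (of_real \<alpha>) (s - of_nat k) * Beta (2 * of_nat k - s) (s - of_nat k) *
                   hypergeo_2F1 (of_nat k) (1 - of_nat k) (of_nat k - s + 1)
                     (of_real (hecke_conj p \<alpha> / (hecke_conj p \<alpha> - \<alpha>)))
               + pow_branch (of_real (hecke_conj p \<alpha>)) (s - of_nat k) * Beta s (of_nat k - s) *
                   hypergeo_2F1 (of_nat k) (1 - of_nat k) (s - of_nat k + 1)
                     (of_real (hecke_conj p \<alpha> / (hecke_conj p \<alpha> - \<alpha>)))))"
    and F: "\<And>z. F z =
          (\<Sum>n. a (Suc n) * exp (2 * of_real pi * \<i> * of_nat (Suc n) * z / of_real (hecke_lambda p)))"
  shows "\<exists>q q\<^sub>0 :: complex \<Rightarrow> complex. \<exists>c\<^sub>0 \<nu> \<eta> :: complex.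
          (\<forall>z. q\<^sub>0 z = (if 2 * k \<noteq> 2 then \<nu> * (1 - z powi (- 2 * int k))
                       else \<nu> * (1 - z powi (- 2)) + \<eta> * z powi (- 1))) \<and>
          (\<forall>z. q z =
             (\<Sum>l=1..L. d l * of_real (D l powr (- real k / 2)) *
                (\<Sum>\<alpha>\<in>simple_roots (\<A> l).
                   of_real (\<alpha> - hecke_conj p \<alpha>) ^ k /
                     ((z - of_real \<alpha>) ^ k * (z - of_real (hecke_conj p \<alpha>)) ^ k)))
             + c\<^sub>0 * q\<^sub>0 z) \<and>
          entire_automorphic_integral p k F q \<and>
          associated_dirichlet_series p F a \<and>
          hecke_symmetric p q"
proof -
  define lam where "lam = hecke_lambda p"
  define \<omega> where "\<omega> = 2 * pi / lam"
  have lam: "lam > 0"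
    using hecke_lambda_pos[OF p] by (simp add: lam_def)
  then have \<omega>: "\<omega> > 0"
    by (simp add: \<omega>_def)
  have k1: "k \<ge> 1"
    using k by (cases k) auto

  \<comment> \<open>The pole part, regrouped by roots\<close>
  define cj where "cj = hecke_conj p"
  define e where "e = (\<lambda>l. d l * complex_of_real (D l powr (- real k / 2)))"
  \<comment> \<open>Sums over an infinite set of roots are \<open>0\<close> by convention, so such classes contribute nothing.\<close>
  define Zf where "Zf = (\<lambda>l. if finite (simple_roots (\<A> l)) then simple_roots (\<A> l) else {})"
  define Z where "Z = (\<Union>l\<in>{1..L}. Zf l)"
  \<comment> \<open>The same class may be listed for several l, so one root can occur repeatedly; C
    collects its total coefficient.\<close>
  define C where "C = (\<lambda>\<alpha>. \<Sum>l=1..L. if \<alpha> \<in> Zf l then e l else 0)"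
  have finZ: "finite Z"
    by (auto simp: Z_def Zf_def)
  have regroup: "(\<Sum>l=1..L. e l * (\<Sum>\<alpha>\<in>simple_roots (\<A> l). g \<alpha>)) = (\<Sum>\<alpha>\<in>Z. C \<alpha> * g \<alpha>)" for g :: "real \<Rightarrow> complex"
  proof -
    have "(\<Sum>\<alpha>\<in>Z. C \<alpha> * g \<alpha>) = (\<Sum>\<alpha>\<in>Z. \<Sum>l=1..L. if \<alpha> \<in> Zf l then e l * g \<alpha> else 0)"
      unfolding C_def sum_distrib_right by (intro sum.cong refl) auto
    also have "\<dots> = (\<Sum>l=1..L. \<Sum>\<alpha>\<in>Z. if \<alpha> \<in> Zf l then e l * g \<alpha> else 0)"
      by (rule sum.swap)
    also have "\<dots> = (\<Sum>l=1..L. e l * (\<Sum>\<alpha>\<in>simple_roots (\<A> l). g \<alpha>))"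
    proof (rule sum.cong[OF refl])
      fix l assume l: "l \<in> {1..L}"
      have "(\<Sum>\<alpha>\<in>Z. if \<alpha> \<in> Zf l then e l * g \<alpha> else 0) = (\<Sum>\<alpha>\<in>Zf l. e l * g \<alpha>)"
        using l by (intro sum.mono_neutral_cong_right finZ) (auto simp: Z_def)
      also have "\<dots> = e l * (\<Sum>\<alpha>\<in>simple_roots (\<A> l). g \<alpha>)"
        by (simp add: Zf_def sum_distrib_left)
      finally show "(\<Sum>\<alpha>\<in>Z. if \<alpha> \<in> Zf l then e l * g \<alpha> else 0) = e l * (\<Sum>\<alpha>\<in>simple_roots (\<A> l). g \<alpha>)" .
    qed
    finally show ?thesis
      by simp
  qed
  have Z_root: "\<exists>l\<in>{1..L}. \<alpha> \<in> simple_roots (\<A> l)" if "\<alpha> \<in> Z" for \<alpha>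
    using that by (auto simp: Z_def Zf_def split: if_splits)
  have Z_props: "\<alpha> > 0" "cj \<alpha> < 0" "hyperbolic_fixed_point p \<alpha>" "hyperbolic_fixed_point p (cj \<alpha>)" "cj (cj \<alpha>) = \<alpha>"
    if "\<alpha> \<in> Z" for \<alpha>
    using Z_root[OF that] simple_root_properties[OF p classes] by (auto simp: cj_def)
  have inj: "inj_on cj Z"
    by (rule inj_on_inverseI[of Z cj]) (rule Z_props)
  define h where "h = (\<lambda>z. \<Sum>\<alpha>\<in>Z. C \<alpha> * pole_kernel k \<alpha> (cj \<alpha>) z)"
  have h_eq: "h z = (\<Sum>l=1..L. d l * of_real (D l powr (- real k / 2)) *
      (\<Sum>\<alpha>\<in>simple_roots (\<A> l). of_real (\<alpha> - hecke_conj p \<alpha>) ^ k /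
         ((z - of_real \<alpha>) ^ k * (z - of_real (hecke_conj p \<alpha>)) ^ k)))" for z
    unfolding h_def regroup[symmetric] by (simp only: e_def pole_kernel_def cj_def)
  have isCont_h: "isCont h z" if "\<And>\<alpha>. \<alpha> \<in> Z \<Longrightarrow> z \<noteq> of_real \<alpha>" "\<And>\<alpha>. \<alpha> \<in> Z \<Longrightarrow> z \<noteq> of_real (cj \<alpha>)" for z
    unfolding h_def using that by (intro continuous_sum continuous_mult continuous_const isCont_pole_kernel)
  have holo_h: "h holomorphic_on {z. Im z > 0}"
    unfolding h_def by (intro holomorphic_on_sum holomorphic_on_mult holomorphic_on_const holomorphic_on_pole_kernel) auto

  \<comment> \<open>The exponential series and a line of absolute convergence\<close>
  define c :: real where "c = of_int \<lceil>max \<gamma> (2 * real k)\<rceil> + 1 / 2"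
  \<comment> \<open>Beyond \<gamma> the Dirichlet series represents \<Phi>, and beyond 2k the line
    lies to the right of both 1/2 and 2k - 1/2. The added 1/2 keeps it away from the
    integers.\<close>
  have c_gt: "c > \<gamma>" "c > 2 * real k" "c > 0"
  proof -
    have "max \<gamma> (2 * real k) < c"
      unfolding c_def using le_of_int_ceiling[of "max \<gamma> (2 * real k)"] by linarith
    then show "c > \<gamma>" "c > 2 * real k" "c > 0"
      by auto
  qed
  have c_nonint: "c \<notin> \<int>"
  proof
    assume "c \<in> \<int>"
    then obtain m where "c = of_int m"
      by (auto elim: Ints_cases)
    then have "real_of_int (2 * (m - \<lceil>max \<gamma> (2 * real k)\<rceil>)) = 1"
      by (simp add: c_def)
    then have "2 * (m - \<lceil>max \<gamma> (2 * real k)\<rceil>) = 1"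
      by linarith
    then show False
      by presburger
  qed
  have summ: "summable (\<lambda>n. norm (a (Suc n)) * real (Suc n) powr (- c))"
  proof -
    have "norm (a (Suc n) * of_nat (Suc n) powr (- of_real c)) = norm (a (Suc n)) * real (Suc n) powr (- c)" for n
      using norm_powr_real_powr[of "of_nat (Suc n)" "- complex_of_real c"] by (simp add: norm_mult)
    then show ?thesis
      using abs_conv[of "of_real c"] c_gt by simp
  qed
  have F_eq: "F = exp_series a \<omega>"
  proof
    fix z
    have "2 * of_real pi * \<i> * of_nat (Suc n) * z / of_real (hecke_lambda p) = \<i> * of_real (\<omega> * real (Suc n)) * z" for n
      by (simp add: \<omega>_def lam_def)
    then show "F z = exp_series a \<omega> z"
      unfolding F exp_series_def by (simp only:)
  qed
  have F_sums: "(\<lambda>n. a (Suc n) * exp (2 * of_real pi * \<i> * of_nat (Suc n) * z / of_real (hecke_lambda p))) sums F z"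
    if "Im z > 0" for z
  proof -
    have "2 * of_real pi * \<i> * of_nat (Suc n) * z / of_real (hecke_lambda p) = \<i> * of_real (\<omega> * real (Suc n)) * z" for n
      by (simp add: \<omega>_def lam_def)
    then show ?thesis
      using exp_series_sums[OF \<omega> c_gt(3) summ that] unfolding F_eq by (simp only:)
  qed
  have holo_F: "F holomorphic_on {z. Im z > 0}"
    unfolding F_eq by (rule exp_series_holomorphic[OF \<omega> c_gt(3) summ])
  have F_per: "F (z + of_real (hecke_lambda p)) = F z" for z
  proof -
    have "exp (2 * of_real pi * \<i> * of_nat (Suc n) * (z + of_real (hecke_lambda p)) / of_real (hecke_lambda p))
        = exp (2 * of_real pi * \<i> * of_nat (Suc n) * z / of_real (hecke_lambda p))" for n
    proof -
      have "2 * of_real pi * \<i> * of_nat (Suc n) * (z + of_real (hecke_lambda p)) / of_real (hecke_lambda p)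
          = 2 * of_real pi * \<i> * of_nat (Suc n) * z / of_real (hecke_lambda p) + of_nat (Suc n) * (2 * of_real pi * \<i>)"
        using lam by (simp add: lam_def field_simps)
      moreover have "exp (of_nat (Suc n) * (2 * of_real pi * \<i>)) = 1"
        unfolding exp_of_nat_mult by simp
      ultimately show ?thesis
        by (simp only: exp_add mult_1_right)
    qed
    then show ?thesis
      unfolding F by (simp only:)
  qed

  \<comment> \<open>The functional equation on the imaginary axis\<close>
  define u where "u = (\<lambda>x::real. F (\<i> * of_real (exp x)))"
  define w where "w = (\<lambda>x::real. h (\<i> * of_real (exp x)))"
  have "\<exists>K. \<forall>x. norm (w x) * exp (1 / 2 * x) \<le> K"
    unfolding w_def h_def by (rule pole_kernel_sum_line_bounded[OF finZ k1]) (auto intro: Z_props)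
  then obtain K' where K': "\<And>x. norm (w x) * exp (1 / 2 * x) \<le> K'"
    by blast
  have w_exp: "w x * exp (s * of_real x) = (\<Sum>\<alpha>\<in>Z. C \<alpha> * (pole_kernel k \<alpha> (cj \<alpha>) (\<i> * of_real (exp x)) * exp (s * of_real x)))" for x s
    unfolding w_def h_def sum_distrib_right by (simp only: mult.assoc)
  have w_int: "integrable lborel (\<lambda>x. w x * exp (s * of_real x))" if "Re s = 1 / 2" for s
    unfolding w_exp using Z_props
    by (intro Bochner_Integration.integrable_sum integrable_mult_right pole_kernel_line_integrable k1 that) auto
  define G where "G = (\<lambda>s \<alpha>. pow_branch (of_real \<alpha>) (s - of_nat k) * Beta (2 * of_nat k - s) (s - of_nat k) *
                   hypergeo_2F1 (of_nat k) (1 - of_nat k) (of_nat k - s + 1)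
                     (of_real (cj \<alpha> / (cj \<alpha> - \<alpha>)))
               + pow_branch (of_real (cj \<alpha>)) (s - of_nat k) * Beta s (of_nat k - s) *
                   hypergeo_2F1 (of_nat k) (1 - of_nat k) (s - of_nat k + 1)
                     (of_real (cj \<alpha> / (cj \<alpha> - \<alpha>))))"
  have func': "\<Phi> (2 * of_nat k - s) + \<Phi> s = - (LBINT x. w x * exp (s * of_real x))" if s: "Re s = 1 / 2" for s
  proof -
    have "s \<notin> \<int>"
    proof
      assume "s \<in> \<int>"
      then obtain m where "s = of_int m"
        by (auto elim: Ints_cases)
      then have "real_of_int (2 * m) = 1"
        using s by simp
      then have "2 * m = 1"
        by linarith
      then show False
        by presburger
    qed
    have "\<Phi> (2 * of_nat k - s) + \<Phi> s = - (\<Sum>l=1..L. e l * pow_branch \<i> s * (\<Sum>\<alpha>\<in>simple_roots (\<A> l). G s \<alpha>))"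
      using func_eq[OF \<open>s \<notin> \<int>\<close>] by (simp only: e_def G_def cj_def)
    also have "(\<Sum>l=1..L. e l * pow_branch \<i> s * (\<Sum>\<alpha>\<in>simple_roots (\<A> l). G s \<alpha>))
        = (\<Sum>l=1..L. e l * (\<Sum>\<alpha>\<in>simple_roots (\<A> l). pow_branch \<i> s * G s \<alpha>))"
      by (simp add: sum_distrib_left mult.assoc)
    also have "\<dots> = (\<Sum>\<alpha>\<in>Z. C \<alpha> * (pow_branch \<i> s * G s \<alpha>))"
      by (rule regroup)
    also have "\<dots> = (\<Sum>\<alpha>\<in>Z. C \<alpha> * (LBINT x. pole_kernel k \<alpha> (cj \<alpha>) (\<i> * of_real (exp x)) * exp (s * of_real x)))"
    proof (rule sum.cong[OF refl])
      fix \<alpha> assume \<alpha>: "\<alpha> \<in> Z"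
      have "(LBINT x. pole_kernel k \<alpha> (cj \<alpha>) (\<i> * of_real (exp x)) * exp (s * of_real x)) = pow_branch \<i> s * G s \<alpha>"
        unfolding G_def
        by (rule pole_kernel_mellin[OF Z_props(1)[OF \<alpha>] Z_props(2)[OF \<alpha>] _ _ k1]) (use s in auto)
      then show "C \<alpha> * (pow_branch \<i> s * G s \<alpha>) = C \<alpha> * (LBINT x. pole_kernel k \<alpha> (cj \<alpha>) (\<i> * of_real (exp x)) * exp (s * of_real x))"
        by simp
    qed
    also have "\<dots> = (LBINT x. w x * exp (s * of_real x))"
    proof -
      have "(LBINT x. w x * exp (s * of_real x)) =
          (\<Sum>\<alpha>\<in>Z. LBINT x. C \<alpha> * (pole_kernel k \<alpha> (cj \<alpha>) (\<i> * of_real (exp x)) * exp (s * of_real x)))"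
        unfolding w_exp using Z_props
        by (intro Bochner_Integration.integral_sum integrable_mult_right pole_kernel_line_integrable k1 s) auto
      then show ?thesis
        by (simp only: integral_mult_right_zero)
    qed
    finally show ?thesis .
  qed
  have "\<forall>n::int. \<exists>r. ((\<lambda>s. \<Phi> s * (s - of_int n)) \<longlongrightarrow> r) (at (of_int n))"
    by (intro allI simple_pole_limit[OF mero] simple_poles Ints_of_int)
  from choice[OF this] obtain r where r: "\<And>n::int. ((\<lambda>s. \<Phi> s * (s - of_int n)) \<longlongrightarrow> r n) (at (of_int n))"
    by auto
  \<comment> \<open>With v = ln y, u and w are F and h at iy. \<Phi> is the Mellin transform of u on
    Re s = c, while that of w is available on Re s = 1/2.\<close>
  have "\<exists>N \<rho>. finite N \<and> (\<forall>v. u v + of_real (exp (- 2 * real k * v)) * u (- v) + w v =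
           (\<Sum>n\<in>N. \<rho> n * of_real (exp (real_of_int n * v))))"
  proof (rule mellin_functional_equation[OF holo bdd r k1 c_gt(2) c_nonint])
    have "continuous_on {z. Im z > 0} F"
      using holo_F by (rule holomorphic_on_imp_continuous_on)
    then show "continuous_on UNIV u"
      unfolding u_def by (rule continuous_on_compose2) (auto intro!: continuous_intros)
    have exp_c: "complex_of_real (exp (b * x)) = exp (of_real b * of_real x)" for b x
      by (simp only: of_real_mult[symmetric] exp_of_real)
    show "integrable lborel (\<lambda>x. u x * of_real (exp (c * x)))"
      unfolding u_def F_eq exp_c by (rule exp_series_mellin(1)[OF \<omega> c_gt(3) summ]) simp
    show "norm (u x) * exp (c * x) \<le> (\<Sum>n. norm (a (Suc n)) * real (Suc n) powr (- c)) * (c / \<omega>) powr c" for x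
      unfolding u_def F_eq by (rule exp_series_bounded[OF \<omega> c_gt(3) summ])
    show "\<Phi> (Complex c t) = (LBINT x. u x * exp (Complex c t * of_real x))" for t
    proof -
      have "Complex c t \<notin> \<int>\<^sub>\<le>\<^sub>0"
        using c_gt(3) by (auto elim!: nonpos_Ints_cases simp: complex_eq_iff)
      then have "\<Phi> (Complex c t) = of_real \<omega> powr (- Complex c t) * Gamma (Complex c t) *
          (\<Sum>n. a (Suc n) * of_nat (Suc n) powr (- Complex c t))"
        using \<Phi>[of "Complex c t"] \<phi>[of "Complex c t"] c_gt(1) by (simp add: \<omega>_def lam_def)
      also have "\<dots> = (LBINT x. u x * exp (Complex c t * of_real x))"
        unfolding u_def F_eq by (rule exp_series_mellin(2)[OF \<omega> c_gt(3) summ, symmetric]) simp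
      finally show ?thesis .
    qed
    show "continuous_on UNIV w"
      unfolding w_def h_def by (intro continuous_on_sum continuous_on_mult continuous_on_const continuous_on_pole_kernel_line)
    show "integrable lborel (\<lambda>x. w x * of_real (exp (1 / 2 * x)))"
      unfolding exp_c by (rule w_int) simp
    show "norm (w x) * exp (1 / 2 * x) \<le> K'" for x
      by (rule K')
    show "\<Phi> (2 * of_nat k - Complex (1 / 2) t) + \<Phi> (Complex (1 / 2) t) = - (LBINT x. w x * exp (Complex (1 / 2) t * of_real x))" for t
      by (rule func') simp
  qed
  then obtain N \<rho> where finN: "finite N" and log_eq: "\<And>v. u v + of_real (exp (- 2 * real k * v)) * u (- v) + w v =
           (\<Sum>n\<in>N. \<rho> n * of_real (exp (real_of_int n * v)))"
    by blast

  \<comment> \<open>The transformation law in the upper half-plane\<close>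
  define \<rho>' where "\<rho>' = (\<lambda>n. - \<rho> n * \<i> powi (- n))"
  define g where "g = (\<lambda>z. \<Sum>n\<in>N. \<rho>' n * z powi n)"
  define q1 where "q1 = (\<lambda>z. h z + g z)"
  have holo_g: "g holomorphic_on {z. Im z > 0}"
    unfolding g_def by (intro holomorphic_intros) auto
  have axis: "(\<i> * of_real y) powi (- 2 * int k) * F (- 1 / (\<i> * of_real y)) = F (\<i> * of_real y) + q1 (\<i> * of_real y)" if y: "y > 0" for y
  proof -
    \<comment> \<open>Oddness of k enters here: the sign turns F(iy) + y^(-2k) F(i/y) into F - F|T
      at iy.\<close>
    have ii: "\<i> powi (- 2 * int k) = - 1"
    proof -
      have "\<i> powi (- 2 * int k) = \<i> powi (- int (2 * k))"
        by simp
      also have "\<dots> = inverse (\<i> ^ (2 * k))"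
        by (simp only: power_int_minus power_int_of_nat)
      also have "\<i> ^ (2 * k) = - 1"
        using k by (simp add: power_mult)
      finally show ?thesis
        by simp
    qed
    have pw: "exp (real_of_int n * ln y) = y powi n" for n
      using y powr_real_of_int'[of y n] by (simp add: powr_def)
    have "exp (- 2 * real k * ln y) = y powi (- 2 * int k)"
      using pw[of "- 2 * int k"] by simp
    moreover have "exp (ln y) = y" "exp (- ln y) = 1 / y"
      using y by (simp_all add: exp_minus inverse_eq_divide)
    ultimately have eq: "F (\<i> * of_real y) + of_real (y powi (- 2 * int k)) * F (\<i> * of_real (1 / y)) + h (\<i> * of_real y)
        = (\<Sum>n\<in>N. \<rho> n * of_real (y powi n))"
      using log_eq[of "ln y"] unfolding u_def w_def pw by (simp only:)
    \<comment> \<open>The identity y^n = i^(-n) (iy)^n explains the power of i in \<rho>'; the minus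
      sign comes from solving for F|T - F.\<close>
    have "g (\<i> * of_real y) = - (\<Sum>n\<in>N. \<rho> n * of_real (y powi n))"
      unfolding g_def sum_negf[symmetric]
    proof (rule sum.cong[OF refl])
      fix n
      have 1: "\<i> powi (- n) * \<i> powi n = 1"
        by (subst power_int_add[symmetric]) auto
      have "\<rho>' n * (\<i> * of_real y) powi n = - \<rho> n * (\<i> powi (- n) * \<i> powi n) * of_real (y powi n)"
        unfolding \<rho>'_def power_int_mult_distrib of_real_power_int by (simp only: mult.assoc)
      then show "\<rho>' n * (\<i> * of_real y) powi n = - (\<rho> n * of_real (y powi n))"
        unfolding 1 by simp
    qed
    then have "F (\<i> * of_real y) + q1 (\<i> * of_real y) = - (of_real (y powi (- 2 * int k)) * F (\<i> * of_real (1 / y)))"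
      using eq unfolding q1_def by (simp add: algebra_simps)
    moreover have "- 1 / (\<i> * of_real y) = \<i> * complex_of_real (1 / y)"
      using y by (simp add: field_simps)
    moreover have "(\<i> * of_real y) powi (- 2 * int k) = - complex_of_real (y powi (- 2 * int k))"
      unfolding power_int_mult_distrib ii by (simp add: of_real_power_int)
    ultimately show ?thesis
      by simp
  qed
  have F_T: "z powi (- 2 * int k) * F (- 1 / z) = F z + q1 z" if z: "Im z > 0" for z
  proof -
    have Im_inv: "Im (- 1 / w) > 0" if "Im w > 0" for w :: complex
    proof -
      have "w \<noteq> 0"
        using that by auto
      then show ?thesis
        using that by (simp add: Im_divide sum_power2_gt_zero_iff complex_eq_iff)
    qed
    have "(\<lambda>z. z powi (- 2 * int k) * F (- 1 / z) - (F z + q1 z)) z = 0"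
    proof (rule upper_half_plane_identity[OF _ _ z])
      have "(\<lambda>z. F (- 1 / z)) holomorphic_on {z. Im z > 0}"
      proof (rule holomorphic_on_compose_gen[of _ _ F, unfolded o_def, OF _ holo_F])
        show "(\<lambda>z. - 1 / z) holomorphic_on {z. Im z > 0}"
          by (intro holomorphic_intros) auto
        show "(\<lambda>z. - 1 / z) ` {z. Im z > 0} \<subseteq> {z. Im z > 0}"
          using Im_inv by blast
      qed
      then show "(\<lambda>z. z powi (- 2 * int k) * F (- 1 / z) - (F z + q1 z)) holomorphic_on {z. Im z > 0}"
        unfolding q1_def by (intro holomorphic_intros holo_F holo_h holo_g) auto
      show "(\<i> * of_real y) powi (- 2 * int k) * F (- 1 / (\<i> * of_real y)) - (F (\<i> * of_real y) + q1 (\<i> * of_real y)) = 0"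
        if "y > 0" for y
        using axis[OF that] by simp
    qed
    then show ?thesis
      by simp
  qed

  \<comment> \<open>Determination of the Laurent part\<close>
  have h_inf: "(\<lambda>y. (\<i> * of_real y) powi (- 2 * int k) * h (of_real b - 1 / (\<i> * of_real y))) \<in> O[at_right 0](\<lambda>_. 1)" for b
  proof -
    have "(\<lambda>y. \<Sum>\<alpha>\<in>Z. C \<alpha> * ((\<i> * of_real y) powi (- 2 * int k) * pole_kernel k \<alpha> (cj \<alpha>) (of_real b - 1 / (\<i> * of_real y))))
        \<in> O[at_right 0](\<lambda>_. 1)"
      by (rule tendsto_imp_bigo_1[where l = "\<Sum>\<alpha>\<in>Z. C \<alpha> * of_real (\<alpha> - cj \<alpha>) ^ k"])
         (intro tendsto_sum tendsto_mult[OF tendsto_const] pole_kernel_at_infinity)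
    then show ?thesis
      unfolding h_def sum_distrib_left by (simp only: mult.left_commute)
  qed
  have h_zero: "(\<lambda>y. h (\<i> * of_real y)) \<in> O[at_right 0](\<lambda>_. 1)"
  proof -
    have cont: "isCont h 0"
    proof (rule isCont_h)
      show "0 \<noteq> complex_of_real \<alpha>" "0 \<noteq> complex_of_real (cj \<alpha>)" if "\<alpha> \<in> Z" for \<alpha>
        using Z_props(1,2)[OF that] by auto
    qed
    have "((\<lambda>y. \<i> * complex_of_real y) \<longlongrightarrow> 0) (at_right 0)"
      by (auto intro!: tendsto_eq_intros)
    from tendsto_imp_bigo_1[OF isCont_tendsto_compose[OF cont this]] show ?thesis .
  qed
  have "\<exists>\<nu> \<eta>. \<forall>z. z \<noteq> 0 \<longrightarrow> (\<Sum>n\<in>N. \<rho>' n * z powi n) =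
      \<nu> * (1 - z powi (- 2 * int k)) + (if k = 1 then \<eta> * z powi (- 1) else 0)"
  proof (rule laurent_part_form[OF p k1 F_per F_T finN])
    show "q1 z = h z + (\<Sum>n\<in>N. \<rho>' n * z powi n)" for z
      by (simp add: q1_def g_def)
    show "(\<lambda>y. h (\<i> * of_real y)) \<in> O[at_right 0](\<lambda>_. 1)"
      by (rule h_zero)
    show "(\<lambda>y. (\<i> * of_real y) powi (- 2 * int k) * h (- 1 / (\<i> * of_real y))) \<in> O[at_right 0](\<lambda>_. 1)"
      using h_inf[of 0] by simp
    show "(\<lambda>y. (\<i> * of_real y) powi (- 2 * int k) * h (of_real (hecke_lambda p) - 1 / (\<i> * of_real y))) \<in> O[at_right 0](\<lambda>_. 1)"
      by (rule h_inf)
    \<comment> \<open>The point is a cusp, hence not a root \<alpha>, and it is positive, hence not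
      one of the negative conjugates.\<close>
    show "isCont q1 (of_real (sin_ratio p (int j) / sin_ratio p (int j - 1)))" if j: "2 \<le> j" "j < p" for j
    proof -
      define x where "x = sin_ratio p (int j) / sin_ratio p (int j - 1)"
      have "sin_ratio p (int j) > 0" "sin_ratio p (int j - 1) > 0"
        using sin_ratio_ge_1[OF p, of "int j"] sin_ratio_ge_1[OF p, of "int j - 1"] j by auto
      then have x: "x > 0"
        by (simp add: x_def)
      have "complex_of_real x \<noteq> of_real \<alpha>" "complex_of_real x \<noteq> of_real (cj \<alpha>)" if \<alpha>: "\<alpha> \<in> Z" for \<alpha>
      proof -
        obtain l where l: "l \<in> {1..L}" "\<alpha> \<in> simple_roots (\<A> l)"
          using Z_root[OF \<alpha>] by blast
        have "\<alpha> \<noteq> x"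
          unfolding x_def by (rule simple_root_ne_sin_ratio[OF p classes[OF l(1)] l(2) j])
        then show "complex_of_real x \<noteq> of_real \<alpha>"
          by auto
        show "complex_of_real x \<noteq> of_real (cj \<alpha>)"
          using Z_props(2)[OF \<alpha>] x by auto
      qed
      then have "isCont h (of_real x)"
        by (rule isCont_h)
      moreover have "isCont g (of_real x)"
        unfolding g_def using x by (intro continuous_intros) auto
      ultimately show ?thesis
        unfolding q1_def x_def[symmetric] by (rule continuous_add)
    qed
  qed
  then obtain \<nu> \<eta> where g_form: "\<And>z. z \<noteq> 0 \<Longrightarrow> g z = \<nu> * (1 - z powi (- 2 * int k)) + (if k = 1 then \<eta> * z powi (- 1) else 0)"
    unfolding g_def by blast

  \<comment> \<open>The period function, its rationality and its poles\<close>
  define q0 where "q0 = (\<lambda>z. if 2 * k \<noteq> 2 then \<nu> * (1 - z powi (- 2 * int k)) else \<nu> * (1 - z powi (- 2)) + \<eta> * z powi (- 1))"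
  \<comment> \<open>The constant c0 is 1, because \<nu> and \<eta> already carry the coefficients.
    The formula for \<open>q0\<close> holds at every point by definition, and \<open>q\<close>
    agrees with \<open>q1\<close> away from 0.\<close>
  define q where "q = (\<lambda>z. h z + 1 * q0 z)"
  have q0_g: "q0 z = g z" if "z \<noteq> 0" for z
    using g_form[OF that] by (auto simp: q0_def)
  have isCont_q0: "isCont q0 z" if "z \<noteq> 0" for z
    unfolding q0_def using that by (cases "2 * k \<noteq> 2") (auto intro!: continuous_intros)
  have rat_q0: "rational_fun q0"
  proof -
    have "rational_fun (\<lambda>z. \<nu> * (1 + (- 1) * z powi (- int m)) + \<eta>' * z powi (- int n))" for m n \<eta>'
      by (intro rational_fun_add rational_fun_mult rational_fun_const rational_fun_power_int_neg)
    from this[of "2 * k" 0 1] this[of 2 \<eta> 1] show ?thesis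
      unfolding q0_def by (cases "k = 1") simp_all
  qed
  have rat_q: "rational_fun q"
    unfolding q_def h_def using rat_q0
    by (intro rational_fun_add rational_fun_sum rational_fun_mult rational_fun_const rational_fun_pole_kernel)
  have expansion: "has_hecke_expansion p F (\<lambda>n. if n = 0 then 0 else a n)"
    unfolding has_hecke_expansion_def
  proof (intro allI impI)
    fix z :: complex assume z: "Im z > 0"
    let ?t = "\<lambda>n. (if n = 0 then 0 else a n) * exp (2 * of_real pi * \<i> * of_nat n * z / of_real (hecke_lambda p))"
    have "(\<lambda>n. ?t (Suc n)) sums F z"
      using F_sums[OF z] by simp
    from sums_Suc[OF this] show "?t sums F z"
      by simp
  qed
  have "entire_automorphic_integral p k F q"
    unfolding entire_automorphic_integral_def
  proof (intro conjI allI impI)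
    show "\<exists>a. has_hecke_expansion p F a"
      using expansion by blast
    fix z :: complex assume z: "Im z > 0"
    then have "z \<noteq> 0"
      by auto
    then show "z powi (- 2 * int k) * F (- 1 / z) = F z + q z"
      using F_T[OF z] q0_g by (simp add: q_def q1_def)
  qed (fact holo_F rat_q)+
  moreover have "associated_dirichlet_series p F a"
    unfolding associated_dirichlet_series_def using expansion by auto
  moreover have "hecke_symmetric p q"
  proof -
    \<comment> \<open>Coefficients of repeated roots may cancel, so only roots with nonzero total
      coefficient give poles. A root and its conjugate share one coefficient, which makes the set of
      poles invariant.\<close>
    define Z' where "Z' = {\<alpha>\<in>Z. C \<alpha> \<noteq> 0}"
    have pole_iff: "is_pole q z \<longleftrightarrow> (\<exists>\<alpha>\<in>Z'. z = of_real \<alpha> \<or> z = of_real (cj \<alpha>))" if "z \<noteq> 0" for z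
    proof -
      have "isCont (\<lambda>z. 1 * q0 z) z"
        using isCont_q0[OF that] by simp
      then have "is_pole q z \<longleftrightarrow> (\<exists>\<alpha>\<in>Z. C \<alpha> \<noteq> 0 \<and> (z = of_real \<alpha> \<or> z = of_real (cj \<alpha>)))"
        unfolding q_def h_def by (intro is_pole_kernel_sum_iff finZ k1 inj) (auto intro: Z_props)
      then show ?thesis
        by (auto simp: Z'_def)
    qed
    have Z'_nz: "\<alpha> \<noteq> 0" "cj \<alpha> \<noteq> 0" if "\<alpha> \<in> Z'" for \<alpha>
      using that Z_props(1,2)[of \<alpha>] by (auto simp: Z'_def)
    have poles: "{\<alpha>. \<alpha> \<noteq> 0 \<and> is_pole q (of_real \<alpha>)} = Z' \<union> cj ` Z'"
    proof (intro set_eqI)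
      fix x :: real
      have eq: "(\<exists>\<alpha>\<in>Z'. complex_of_real x = of_real \<alpha> \<or> complex_of_real x = of_real (cj \<alpha>)) \<longleftrightarrow> x \<in> Z' \<union> cj ` Z'"
        unfolding of_real_eq_iff by blast
      show "x \<in> {\<alpha>. \<alpha> \<noteq> 0 \<and> is_pole q (of_real \<alpha>)} \<longleftrightarrow> x \<in> Z' \<union> cj ` Z'"
      proof (cases "x = 0")
        case True
        have "0 \<notin> Z' \<union> cj ` Z'"
          using Z'_nz(1)[of 0] Z'_nz(2) by auto
        then show ?thesis
          using True by simp
      next
        case False
        then have "complex_of_real x \<noteq> 0"
          by simp
        from pole_iff[OF this] show ?thesis
          unfolding eq using False by simp
      qed
    qed
    have cj2: "cj ` cj ` Z' = Z'"
    proof -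
      have "cj ` cj ` Z' = (\<lambda>\<alpha>. \<alpha>) ` Z'"
        unfolding image_image by (rule image_cong) (auto simp: Z'_def Z_props(5))
      then show ?thesis
        by simp
    qed
    have "\<forall>z. z \<noteq> 0 \<and> is_pole q z \<longrightarrow> (\<exists>\<alpha>. hyperbolic_fixed_point p \<alpha> \<and> z = of_real \<alpha>)"
    proof (intro allI impI)
      fix z assume z: "z \<noteq> 0 \<and> is_pole q z"
      then obtain \<alpha> where "\<alpha> \<in> Z" "z = of_real \<alpha> \<or> z = of_real (cj \<alpha>)"
        using pole_iff[of z] by (auto simp: Z'_def)
      then show "\<exists>\<alpha>. hyperbolic_fixed_point p \<alpha> \<and> z = of_real \<alpha>"
        using Z_props(3,4) by blast
    qed
    moreover have "hecke_conj p ` (Z' \<union> cj ` Z') = Z' \<union> cj ` Z'"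
      unfolding cj_def[symmetric] image_Un cj2 by (rule Un_commute)
    ultimately show ?thesis
      unfolding hecke_symmetric_def poles by blast
  qed
  moreover have "\<forall>z. q0 z = (if 2 * k \<noteq> 2 then \<nu> * (1 - z powi (- 2 * int k))
                       else \<nu> * (1 - z powi (- 2)) + \<eta> * z powi (- 1))"
    by (simp add: q0_def)
  moreover have "\<forall>z. q z =
             (\<Sum>l=1..L. d l * of_real (D l powr (- real k / 2)) *
                (\<Sum>\<alpha>\<in>simple_roots (\<A> l).
                   of_real (\<alpha> - hecke_conj p \<alpha>) ^ k /
                     ((z - of_real \<alpha>) ^ k * (z - of_real (hecke_conj p \<alpha>)) ^ k)))
             + 1 * q0 z"
    unfolding q_def h_eq by blast
  ultimately show ?thesis
    by blast
qed

end
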